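(* Let $M>0$, $|a|\le M$, and let $(\alpha,\underline\alpha,\rho,\sigma)$ be a smooth solution of the Maxwell equations (stated in the context) on the Kerr exterior relative to the algebraically special frame. Then the extremal components satisfy $$\Sigma\Big(D_4+\tfrac32\mathrm{tr}\chi-\tfrac12(\varepsilon\cdot\chi){}^\star\Big)\Big(D_3+\tfrac12\mathrm{tr}\underline\chi+\tfrac12(\varepsilon\cdot\underline\chi){}^\star\Big)\alpha-(D+2\eta)\,\mathrm{div}(\Sigma\alpha)+{}^\star(D+2\eta)\,\mathrm{curl}(\Sigma\alpha)=0,$$ $$\Big(D_3+\tfrac32\mathrm{tr}\underline\chi-\tfrac12(\varepsilon\cdot\underline\chi){}^\star\Big)\Big(D_4+\tfrac12\mathrm{tr}\chi+\tfrac12(\varepsilon\cdot\chi){}^\star+\hat\omega\Big)\underline\alpha-(D+2\underline\eta)\,\mathrm{div}\,\underline\alpha+{}^\star(D+2\underline\eta)\,\mathrm{curl}\,\underline\alpha=0.$$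
   Context: Kerr exterior. For $M>0$, $|a|\le M$ let $r_\pm=M\pm\sqrt{M^2-a^2}$, $\Delta=(r-r_+)(r-r_-)$, $\Sigma=r^2+a^2\cos^2\theta$. $(\mathcal M,g)$ is $\mathbb R_{\bar t}\times[r_+,\infty)_r\times\mathbb S^2_{(\theta,\bar\phi)}$ with $g=-(1-\frac{2Mr}{\Sigma})d\bar t^2+2d\bar t\,dr+\Sigma d\theta^2+\frac{(r^2+a^2)^2-\Delta a^2\sin^2\theta}{\Sigma}\sin^2\theta\,d\bar\phi^2-2a\sin^2\theta\,dr\,d\bar\phi-\frac{4aMr}{\Sigma}\sin^2\theta\,d\bar t\,d\bar\phi$. Boyer–Lindquist coordinates $(t,r,\theta,\phi)$ on $r>r_+$ are given (with $r_0=9M/4$) by $\bar t=t+\int_{r_0}^r\frac{s^2+a^2}{\Delta(s)}ds$, $\bar\phi=\phi+\int_{r_0}^r\frac{a}{\Delta(s)}ds$. Algebraically special frame and horizontal calculus. $e_4=\frac{r^2+a^2}{\Sigma}\partial_t+\frac{\Delta}{\Sigma}\partial_r+\frac a\Sigma\partial_\phi$, $e_3=\frac{r^2+a^2}{\Delta}\partial_t-\partial_r+\frac a\Delta\partial_\phi$ (Boyer–Lindquist; both extend smoothly to $r=r_+$), $e_1=\frac{a^2\sin\theta\cos\theta}{\Sigma}\partial_t+\frac r\Sigma\partial_\theta+\frac{a\cos\theta}{\Sigma\sin\theta}\partial_\phi$, $e_2=\frac{ar\sin\theta}{\Sigma}\partial_t-\frac{a\cos\theta}{\Sigma}\partial_\theta+\frac{r}{\Sigma\sin\theta}\partial_\phi$.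 $\mathfrak D=\langle e_3,e_4\rangle^\perp$ is the horizontal distribution, with orthonormal frame $(e_1,e_2)$; $\gamma=g|_{\mathfrak D}$, $\varepsilon$ its area form with $\varepsilon(e_1,e_2)=1$. $\mathfrak D$ one-forms are sections of $\mathfrak D^*$ (identified with spacetime one-forms vanishing on $e_3,e_4$). $D$ is the connection on $\mathfrak D$ obtained by orthogonally projecting to $\mathfrak D$ the Levi-Civita connection $\nabla$ of $g$: $(D_X\varsigma)(Y)=X(\varsigma(Y))-\varsigma(\Pi_{\mathfrak D}\nabla_XY)$; $D_3=D_{e_3}$, $D_4=D_{e_4}$, $D$ without index is differentiation in $\mathfrak D$-directions (for functions $Du=du|_{\mathfrak D}$). $\mathrm{div}\,\varsigma=\gamma^{AB}(D_A\varsigma)_B$, $\mathrm{curl}\,\varsigma=\varepsilon^{AB}(D_A\varsigma)_B$, $({}^\star\varsigma)_A=\varepsilon_A{}^B\varsigma_B$, $(\varsigma,\tilde\varsigma)=\gamma^{AB}\varsigma_A\tilde\varsigma_B$, $\varsigma\wedge\tilde\varsigma=\varepsilon^{AB}\varsigma_A\tilde\varsigma_B$. For a function $u$ and $\mathfrak D$ one-form $\xi$: $(D+\xi)u=Du+u\,\xi$ and ${}^\star(D+\xi)u={}^\star(Du+u\,\xi)$. Connection coefficients: $\mathrm{tr}\chi=\frac{2r\Delta}{\Sigma^2}$, $(\varepsilon\cdot\chi)=\frac{2a\Delta\cos\theta}{\Sigma^2}$, $\mathrm{tr}\underline\chi=-\frac{2r}\Sigma$, $(\varepsilon\cdot\underline\chi)=\frac{2a\cos\theta}{\Sigma}$,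 $\hat\omega=-\frac{2(a^2(M-r)\cos^2\theta+a^2r-Mr^2)}{\Sigma^2}$; $\chi\cdot\varsigma=\frac12\mathrm{tr}\chi\,\varsigma+\frac12(\varepsilon\cdot\chi){}^\star\varsigma$, $\underline\chi\cdot\varsigma=\frac12\mathrm{tr}\underline\chi\,\varsigma+\frac12(\varepsilon\cdot\underline\chi){}^\star\varsigma$; in Boyer–Lindquist coordinates $\eta=-\frac{a^2r}{\Sigma^2}\sin^2\theta\,dt-\frac{a^2\sin2\theta}{2\Sigma}d\theta+\frac{ar(r^2+a^2)}{\Sigma^2}\sin^2\theta\,d\phi$, $\underline\eta=\frac{a^2r}{\Sigma^2}\sin^2\theta\,dt-\frac{a^2\sin2\theta}{2\Sigma}d\theta-\frac{ar(r^2+a^2)}{\Sigma^2}\sin^2\theta\,d\phi$. Maxwell equations. For a two-form $F$ with $dF=0$, $d\star F=0$, set $\alpha(e_A)=F(e_A,e_4)$, $\underline\alpha(e_A)=F(e_A,e_3)$ ($A=1,2$), $\rho=\frac12F(e_3,e_4)$, $\sigma=\frac12\varepsilon^{AB}F(e_A,e_B)$. In terms of these the Maxwell equations are $D_3\sigma+\mathrm{tr}\underline\chi\,\sigma=-\mathrm{curl}\,\underline\alpha-(\varepsilon\cdot\underline\chi)\rho$, $D_3\rho+\mathrm{tr}\underline\chi\,\rho=-\mathrm{div}\,\underline\alpha+(\varepsilon\cdot\underline\chi)\sigma$, $D_4\sigma+\mathrm{tr}\chi\,\sigma=-\mathrm{curl}\,\alpha-(\eta+\underline\eta)\wedge\alpha+(\varepsilon\cdot\chi)\rho$,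 $D_4\rho+\mathrm{tr}\chi\,\rho=\mathrm{div}\,\alpha+(\eta+\underline\eta,\alpha)-(\varepsilon\cdot\chi)\sigma$, $D_3\alpha+\underline\chi\cdot\alpha=D\rho+{}^\star D\sigma+2\eta\rho+2{}^\star\eta\,\sigma$, $D_4\underline\alpha+\chi\cdot\underline\alpha+\hat\omega\,\underline\alpha=-D\rho+{}^\star D\sigma-2\underline\eta\rho+2{}^\star\underline\eta\,\sigma$. *)

theory Defs
  imports "HOL-Analysis.Analysis"
begin

section \<open>Calculus on subsets of a normed space\<close>

text \<open>
  All derivatives are taken within the set \<open>S\<close>.  On the Kerr exterior, a closed region of
  \<open>\<real>\<^sup>4\<close> with smooth boundary, the derivative within \<open>S\<close> is unique, is one-sided at the
  boundary, and does not see the values of the function outside \<open>S\<close>.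
\<close>

definition dir_deriv ::
  "'a::real_normed_vector set \<Rightarrow> ('a \<Rightarrow> 'b::real_normed_vector) \<Rightarrow> 'a \<Rightarrow> 'a \<Rightarrow> 'b"
  where "dir_deriv S f p v = frechet_derivative f (at p within S) v"

primrec Ck_on ::
  "nat \<Rightarrow> 'a::real_normed_vector set \<Rightarrow> ('a \<Rightarrow> 'b::real_normed_vector) \<Rightarrow> bool"
  where
    "Ck_on 0 S f \<longleftrightarrow> continuous_on S f"
  | "Ck_on (Suc k) S f \<longleftrightarrow>
       (\<forall>p\<in>S. f differentiable (at p within S)) \<and> (\<forall>v. Ck_on k S (\<lambda>p. dir_deriv S f p v))"

definition smooth_on ::
  "'a::real_normed_vector set \<Rightarrow> ('a \<Rightarrow> 'b::real_normed_vector) \<Rightarrow> bool"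
  where "smooth_on S f \<longleftrightarrow> (\<forall>k. Ck_on k S f)"

section \<open>The Kerr exterior\<close>

text \<open>
  The manifold \<open>\<real> \<times> [r\<^sub>+, \<infinity>) \<times> S\<^sup>2\<close> is covered by one global chart: the point
  \<open>(t, r, x)\<close> with \<open>x\<close> in the unit sphere is represented by \<open>(t, r x)\<close> in \<open>\<real>\<^sup>4\<close>, where
  \<open>t\<close> is the horizon-regular time (the barred one).  This is a diffeomorphism onto
  \<open>{(t, y). |y| \<ge> r\<^sub>+}\<close> because \<open>r\<^sub>+ > 0\<close>, and it includes the horizon and the axis.
  Tangent vectors and one-forms at a point are both represented by their components in this
  chart; the pairing of the two is the inner product of \<open>\<real>\<^sup>4\<close>.
\<close>

type_synonym pt = "real^4"

definition rad :: "pt \<Rightarrow> real"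
  where "rad p = sqrt ((p$2)\<^sup>2 + (p$3)\<^sup>2 + (p$4)\<^sup>2)"

definition costh :: "pt \<Rightarrow> real"
  where "costh p = p$4 / rad p"

definition sinth :: "pt \<Rightarrow> real"
  where "sinth p = sqrt ((p$2)\<^sup>2 + (p$3)\<^sup>2) / rad p"

text \<open>
  The azimuth is undefined on the axis; there we use the value \<open>0\<close>.  The frame vectors
  \<open>e1\<close>, \<open>e2\<close> below are thereby continued to the axis as limits along the meridian of
  azimuth \<open>0\<close>.  They are discontinuous at the axis, but are only ever used as a positively
  oriented orthonormal basis at a single point and are never differentiated.
\<close>

definition cosph :: "pt \<Rightarrow> real"
  where "cosph p = (if p$2 = 0 \<and> p$3 = 0 then 1 else p$2 / sqrt ((p$2)\<^sup>2 + (p$3)\<^sup>2))"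

definition sinph :: "pt \<Rightarrow> real"
  where "sinph p = (if p$2 = 0 \<and> p$3 = 0 then 0 else p$3 / sqrt ((p$2)\<^sup>2 + (p$3)\<^sup>2))"

definition r_plus :: "real \<Rightarrow> real \<Rightarrow> real"
  where "r_plus M a = M + sqrt (M\<^sup>2 - a\<^sup>2)"

definition r_minus :: "real \<Rightarrow> real \<Rightarrow> real"
  where "r_minus M a = M - sqrt (M\<^sup>2 - a\<^sup>2)"

definition exterior :: "real \<Rightarrow> real \<Rightarrow> pt set"
  where "exterior M a = {p. r_plus M a \<le> rad p}"

definition Delta_r :: "real \<Rightarrow> real \<Rightarrow> real \<Rightarrow> real"
  where "Delta_r M a r = (r - r_plus M a) * (r - r_minus M a)"

definition Delta :: "real \<Rightarrow> real \<Rightarrow> pt \<Rightarrow> real"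
  where "Delta M a p = Delta_r M a (rad p)"

definition Sigma_K :: "real \<Rightarrow> pt \<Rightarrow> real"
  where "Sigma_K a p = (rad p)\<^sup>2 + a\<^sup>2 * (costh p)\<^sup>2"

text \<open>
  Coordinate vector fields of the horizon-regular coordinates \<open>(t, r, \<theta>, \<phi>)\<close>, and the dual
  one-forms.  Here \<open>v_phs\<close> is \<open>(1 / sin \<theta>) \<partial>\<^sub>\<phi>\<close> and \<open>d_phs\<close> is \<open>sin \<theta> d\<phi>\<close>, which stay
  bounded at the axis.
\<close>

definition v_t :: "pt \<Rightarrow> pt"
  where "v_t p = vector [1, 0, 0, 0]"

definition v_r :: "pt \<Rightarrow> pt"
  where "v_r p = vector [0, sinth p * cosph p, sinth p * sinph p, costh p]"

definition v_th :: "pt \<Rightarrow> pt"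
  where "v_th p = rad p *\<^sub>R vector [0, costh p * cosph p, costh p * sinph p, - sinth p]"

definition v_phs :: "pt \<Rightarrow> pt"
  where "v_phs p = rad p *\<^sub>R vector [0, - sinph p, cosph p, 0]"

definition v_ph :: "pt \<Rightarrow> pt"
  where "v_ph p = sinth p *\<^sub>R v_phs p"

definition d_t :: "pt \<Rightarrow> pt"
  where "d_t p = v_t p"

definition d_r :: "pt \<Rightarrow> pt"
  where "d_r p = v_r p"

definition d_th :: "pt \<Rightarrow> pt"
  where "d_th p = (1 / (rad p)\<^sup>2) *\<^sub>R v_th p"

definition d_phs :: "pt \<Rightarrow> pt"
  where "d_phs p = (1 / (rad p)\<^sup>2) *\<^sub>R v_phs p"

definition sym_prod :: "pt \<Rightarrow> pt \<Rightarrow> pt \<Rightarrow> pt \<Rightarrow> real"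
  where "sym_prod w w' u v = ((w \<bullet> u) * (w' \<bullet> v) + (w' \<bullet> u) * (w \<bullet> v)) / 2"

definition kerr_g :: "real \<Rightarrow> real \<Rightarrow> pt \<Rightarrow> pt \<Rightarrow> pt \<Rightarrow> real"
  where "kerr_g M a p u v =
      - (1 - 2 * M * rad p / Sigma_K a p) * sym_prod (d_t p) (d_t p) u v
      + 2 * sym_prod (d_t p) (d_r p) u v
      + Sigma_K a p * sym_prod (d_th p) (d_th p) u v
      + (((rad p)\<^sup>2 + a\<^sup>2)\<^sup>2 - Delta M a p * a\<^sup>2 * (sinth p)\<^sup>2) / Sigma_K a p
          * sym_prod (d_phs p) (d_phs p) u v
      - 2 * a * sinth p * sym_prod (d_r p) (d_phs p) u v
      - 4 * a * M * rad p / Sigma_K a p * sinth p * sym_prod (d_t p) (d_phs p) u v"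

definition g_matrix :: "real \<Rightarrow> real \<Rightarrow> pt \<Rightarrow> real^4^4"
  where "g_matrix M a p = (\<chi> i j. kerr_g M a p (axis i 1) (axis j 1))"

text \<open>Christoffel symbols of the global chart, contracted with the vectors \<open>u\<close>, \<open>v\<close>.\<close>

definition christoffel :: "real \<Rightarrow> real \<Rightarrow> pt \<Rightarrow> pt \<Rightarrow> pt \<Rightarrow> pt"
  where "christoffel M a p u v = matrix_inv (g_matrix M a p) *v
    (\<chi> l. (dir_deriv (exterior M a) (\<lambda>q. kerr_g M a q v (axis l 1)) p u
         + dir_deriv (exterior M a) (\<lambda>q. kerr_g M a q u (axis l 1)) p v
         - dir_deriv (exterior M a) (\<lambda>q. kerr_g M a q u v) p (axis l 1)) / 2)"

text \<open>The Levi-Civita derivative of the vector field \<open>Y\<close> at \<open>p\<close> in the direction \<open>u\<close>.\<close>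

definition levi_civita :: "real \<Rightarrow> real \<Rightarrow> pt \<Rightarrow> (pt \<Rightarrow> pt) \<Rightarrow> pt \<Rightarrow> pt"
  where "levi_civita M a u Y p =
    dir_deriv (exterior M a) Y p u + christoffel M a p u (Y p)"

section \<open>The algebraically special frame and the horizontal calculus\<close>

text \<open>
  The null vectors are written in horizon-regular coordinates.  That they are the smooth
  extensions of the Boyer--Lindquist expressions is shown in \<open>e4_boyer_lindquist\<close>,
  \<open>e3_boyer_lindquist\<close> and \<open>bl_chart_has_derivative\<close>.
\<close>

definition e4 :: "real \<Rightarrow> real \<Rightarrow> pt \<Rightarrow> pt"
  where "e4 M a p =
      (2 * ((rad p)\<^sup>2 + a\<^sup>2) / Sigma_K a p) *\<^sub>R v_t p
    + (Delta M a p / Sigma_K a p) *\<^sub>R v_r p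
    + (2 * a / Sigma_K a p) *\<^sub>R v_ph p"

definition e3 :: "pt \<Rightarrow> pt"
  where "e3 p = - v_r p"

definition e1 :: "real \<Rightarrow> pt \<Rightarrow> pt"
  where "e1 a p =
      (a\<^sup>2 * sinth p * costh p / Sigma_K a p) *\<^sub>R v_t p
    + (rad p / Sigma_K a p) *\<^sub>R v_th p
    + (a * costh p / Sigma_K a p) *\<^sub>R v_phs p"

definition e2 :: "real \<Rightarrow> pt \<Rightarrow> pt"
  where "e2 a p =
      (a * rad p * sinth p / Sigma_K a p) *\<^sub>R v_t p
    - (a * costh p / Sigma_K a p) *\<^sub>R v_th p
    + (rad p / Sigma_K a p) *\<^sub>R v_phs p"

text \<open>
  Orthogonal projection to the horizontal distribution, using \<open>g(e3, e4) = -2\<close>; see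
  \<open>hproj_orthogonal\<close>.
\<close>

definition hproj :: "real \<Rightarrow> real \<Rightarrow> pt \<Rightarrow> pt \<Rightarrow> pt"
  where "hproj M a p v =
    v + (kerr_g M a p v (e3 p) / 2) *\<^sub>R e4 M a p + (kerr_g M a p v (e4 M a p) / 2) *\<^sub>R e3 p"

text \<open>Horizontal one-forms are spacetime one-forms that vanish on \<open>e3\<close> and \<open>e4\<close>.\<close>

definition smooth_horizontal :: "real \<Rightarrow> real \<Rightarrow> (pt \<Rightarrow> pt) \<Rightarrow> bool"
  where "smooth_horizontal M a \<omega> \<longleftrightarrow>
    smooth_on (exterior M a) \<omega> \<and>
    (\<forall>p\<in>exterior M a. \<omega> p \<bullet> e3 p = 0 \<and> \<omega> p \<bullet> e4 M a p = 0)"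

text \<open>
  \<open>(D\<^sub>u \<omega>)(Y) = u(\<omega>(Y)) - \<omega>(\<Pi> \<nabla>\<^sub>u Y)\<close> for horizontal fields \<open>Y\<close>.  The value at \<open>p\<close> depends on
  \<open>Y\<close> only through \<open>Y p\<close>, so the projections of the coordinate fields suffice; the resulting
  one-form again vanishes on \<open>e3\<close> and \<open>e4\<close>.
\<close>

definition hD :: "real \<Rightarrow> real \<Rightarrow> pt \<Rightarrow> (pt \<Rightarrow> pt) \<Rightarrow> pt \<Rightarrow> pt"
  where "hD M a u \<omega> p =
    (\<chi> i. let Y = (\<lambda>q. hproj M a q (axis i 1)) in
       dir_deriv (exterior M a) (\<lambda>q. \<omega> q \<bullet> Y q) p u
         - \<omega> p \<bullet> hproj M a p (levi_civita M a u Y p))"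

definition D3 :: "real \<Rightarrow> real \<Rightarrow> (pt \<Rightarrow> pt) \<Rightarrow> pt \<Rightarrow> pt"
  where "D3 M a \<omega> p = hD M a (e3 p) \<omega> p"

definition D4 :: "real \<Rightarrow> real \<Rightarrow> (pt \<Rightarrow> pt) \<Rightarrow> pt \<Rightarrow> pt"
  where "D4 M a \<omega> p = hD M a (e4 M a p) \<omega> p"

definition D3s :: "real \<Rightarrow> real \<Rightarrow> (pt \<Rightarrow> real) \<Rightarrow> pt \<Rightarrow> real"
  where "D3s M a u p = dir_deriv (exterior M a) u p (e3 p)"

definition D4s :: "real \<Rightarrow> real \<Rightarrow> (pt \<Rightarrow> real) \<Rightarrow> pt \<Rightarrow> real"
  where "D4s M a u p = dir_deriv (exterior M a) u p (e4 M a p)"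

text \<open>The restriction of \<open>du\<close> to the horizontal distribution.\<close>

definition hgrad :: "real \<Rightarrow> real \<Rightarrow> (pt \<Rightarrow> real) \<Rightarrow> pt \<Rightarrow> pt"
  where "hgrad M a u p = (\<chi> i. dir_deriv (exterior M a) u p (hproj M a p (axis i 1)))"

definition harea :: "real \<Rightarrow> real \<Rightarrow> pt \<Rightarrow> pt \<Rightarrow> pt \<Rightarrow> real"
  where "harea M a p u v =
      kerr_g M a p u (e1 a p) * kerr_g M a p v (e2 a p)
    - kerr_g M a p u (e2 a p) * kerr_g M a p v (e1 a p)"

definition hstar :: "real \<Rightarrow> real \<Rightarrow> pt \<Rightarrow> pt \<Rightarrow> pt"
  where "hstar M a p w =
    (\<chi> i. harea M a p (axis i 1) (e1 a p) * (w \<bullet> e1 a p)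
        + harea M a p (axis i 1) (e2 a p) * (w \<bullet> e2 a p))"

definition hinner :: "real \<Rightarrow> pt \<Rightarrow> pt \<Rightarrow> pt \<Rightarrow> real"
  where "hinner a p w w' = (w \<bullet> e1 a p) * (w' \<bullet> e1 a p) + (w \<bullet> e2 a p) * (w' \<bullet> e2 a p)"

definition hwedge :: "real \<Rightarrow> pt \<Rightarrow> pt \<Rightarrow> pt \<Rightarrow> real"
  where "hwedge a p w w' = (w \<bullet> e1 a p) * (w' \<bullet> e2 a p) - (w \<bullet> e2 a p) * (w' \<bullet> e1 a p)"

definition hdiv :: "real \<Rightarrow> real \<Rightarrow> (pt \<Rightarrow> pt) \<Rightarrow> pt \<Rightarrow> real"
  where "hdiv M a \<omega> p = hD M a (e1 a p) \<omega> p \<bullet> e1 a p + hD M a (e2 a p) \<omega> p \<bullet> e2 a p"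

definition hcurl :: "real \<Rightarrow> real \<Rightarrow> (pt \<Rightarrow> pt) \<Rightarrow> pt \<Rightarrow> real"
  where "hcurl M a \<omega> p = hD M a (e1 a p) \<omega> p \<bullet> e2 a p - hD M a (e2 a p) \<omega> p \<bullet> e1 a p"

text \<open>\<open>D_plus M a \<xi> u\<close> is the one-form \<open>(D + \<xi>) u\<close>.\<close>

definition D_plus :: "real \<Rightarrow> real \<Rightarrow> (pt \<Rightarrow> pt) \<Rightarrow> (pt \<Rightarrow> real) \<Rightarrow> pt \<Rightarrow> pt"
  where "D_plus M a \<xi> u p = hgrad M a u p + u p *\<^sub>R \<xi> p"

definition star_D_plus :: "real \<Rightarrow> real \<Rightarrow> (pt \<Rightarrow> pt) \<Rightarrow> (pt \<Rightarrow> real) \<Rightarrow> pt \<Rightarrow> pt"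
  where "star_D_plus M a \<xi> u p = hstar M a p (D_plus M a \<xi> u p)"

section \<open>Connection coefficients\<close>

text \<open>A trailing \<open>b\<close> stands for the underlined quantity; \<open>eps_chi\<close> is \<open>(\<epsilon> \<cdot> \<chi>)\<close>.\<close>

definition tr_chi :: "real \<Rightarrow> real \<Rightarrow> pt \<Rightarrow> real"
  where "tr_chi M a p = 2 * rad p * Delta M a p / (Sigma_K a p)\<^sup>2"

definition eps_chi :: "real \<Rightarrow> real \<Rightarrow> pt \<Rightarrow> real"
  where "eps_chi M a p = 2 * a * Delta M a p * costh p / (Sigma_K a p)\<^sup>2"

definition tr_chib :: "real \<Rightarrow> pt \<Rightarrow> real"
  where "tr_chib a p = - (2 * rad p / Sigma_K a p)"

definition eps_chib :: "real \<Rightarrow> pt \<Rightarrow> real"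
  where "eps_chib a p = 2 * a * costh p / Sigma_K a p"

definition omega_hat :: "real \<Rightarrow> real \<Rightarrow> pt \<Rightarrow> real"
  where "omega_hat M a p =
    - (2 * (a\<^sup>2 * (M - rad p) * (costh p)\<^sup>2 + a\<^sup>2 * rad p - M * (rad p)\<^sup>2) / (Sigma_K a p)\<^sup>2)"

definition chi_dot :: "real \<Rightarrow> real \<Rightarrow> pt \<Rightarrow> pt \<Rightarrow> pt"
  where "chi_dot M a p w = (1/2 * tr_chi M a p) *\<^sub>R w + (1/2 * eps_chi M a p) *\<^sub>R hstar M a p w"

definition chib_dot :: "real \<Rightarrow> real \<Rightarrow> pt \<Rightarrow> pt \<Rightarrow> pt"
  where "chib_dot M a p w = (1/2 * tr_chib a p) *\<^sub>R w + (1/2 * eps_chib a p) *\<^sub>R hstar M a p w"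

text \<open>
  The one-forms \<open>\<eta>\<close> and underlined \<open>\<eta>\<close> in horizon-regular coordinates: passing from
  Boyer--Lindquist \<open>dt\<close>, \<open>d\<phi>\<close> to the regular ones produces no \<open>dr\<close> term, see
  \<open>eta_boyer_lindquist\<close>.  We use \<open>sin\<^sup>2 \<theta> d\<phi> = sin \<theta> (sin \<theta> d\<phi>)\<close> and
  \<open>sin 2\<theta> = 2 sin \<theta> cos \<theta>\<close>.
\<close>

definition eta :: "real \<Rightarrow> pt \<Rightarrow> pt"
  where "eta a p =
    - (a\<^sup>2 * rad p / (Sigma_K a p)\<^sup>2 * (sinth p)\<^sup>2) *\<^sub>R d_t p
    - (a\<^sup>2 * (2 * sinth p * costh p) / (2 * Sigma_K a p)) *\<^sub>R d_th p
    + (a * rad p * ((rad p)\<^sup>2 + a\<^sup>2) / (Sigma_K a p)\<^sup>2 * sinth p) *\<^sub>R d_phs p"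

definition etab :: "real \<Rightarrow> pt \<Rightarrow> pt"
  where "etab a p =
      (a\<^sup>2 * rad p / (Sigma_K a p)\<^sup>2 * (sinth p)\<^sup>2) *\<^sub>R d_t p
    - (a\<^sup>2 * (2 * sinth p * costh p) / (2 * Sigma_K a p)) *\<^sub>R d_th p
    - (a * rad p * ((rad p)\<^sup>2 + a\<^sup>2) / (Sigma_K a p)\<^sup>2 * sinth p) *\<^sub>R d_phs p"

section \<open>The Maxwell equations relative to the frame\<close>

definition maxwell_solution ::
  "real \<Rightarrow> real \<Rightarrow> (pt \<Rightarrow> pt) \<Rightarrow> (pt \<Rightarrow> pt) \<Rightarrow> (pt \<Rightarrow> real) \<Rightarrow> (pt \<Rightarrow> real) \<Rightarrow> bool"
  where "maxwell_solution M a \<alpha> \<alpha>b \<rho> \<sigma> \<longleftrightarrow>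
    smooth_horizontal M a \<alpha> \<and> smooth_horizontal M a \<alpha>b \<and>
    smooth_on (exterior M a) \<rho> \<and> smooth_on (exterior M a) \<sigma> \<and>
    (\<forall>p\<in>exterior M a.
      D3s M a \<sigma> p + tr_chib a p * \<sigma> p
        = - hcurl M a \<alpha>b p - eps_chib a p * \<rho> p \<and>
      D3s M a \<rho> p + tr_chib a p * \<rho> p
        = - hdiv M a \<alpha>b p + eps_chib a p * \<sigma> p \<and>
      D4s M a \<sigma> p + tr_chi M a p * \<sigma> p
        = - hcurl M a \<alpha> p - hwedge a p (eta a p + etab a p) (\<alpha> p) + eps_chi M a p * \<rho> p \<and>
      D4s M a \<rho> p + tr_chi M a p * \<rho> p
        = hdiv M a \<alpha> p + hinner a p (eta a p + etab a p) (\<alpha> p) - eps_chi M a p * \<sigma> p \<and>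
      D3 M a \<alpha> p + chib_dot M a p (\<alpha> p)
        = hgrad M a \<rho> p + hstar M a p (hgrad M a \<sigma> p)
          + (2 * \<rho> p) *\<^sub>R eta a p + (2 * \<sigma> p) *\<^sub>R hstar M a p (eta a p) \<and>
      D4 M a \<alpha>b p + chi_dot M a p (\<alpha>b p) + omega_hat M a p *\<^sub>R \<alpha>b p
        = - hgrad M a \<rho> p + hstar M a p (hgrad M a \<sigma> p)
          - (2 * \<rho> p) *\<^sub>R etab a p + (2 * \<sigma> p) *\<^sub>R hstar M a p (etab a p))"

section \<open>Agreement with the Boyer--Lindquist expressions\<close>

lemma vector4 [simp]:
  "(vector [x, y, z, w] :: 'a::zero^4) $ 1 = x" "(vector [x, y, z, w] :: 'a^4) $ 2 = y"
  "(vector [x, y, z, w] :: 'a^4) $ 3 = z" "(vector [x, y, z, w] :: 'a^4) $ 4 = w"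
  unfolding vector_def by simp_all

lemma trig_identities:
  assumes "rad p > 0"
  shows "(sinth p)\<^sup>2 + (costh p)\<^sup>2 = 1" and "(sinph p)\<^sup>2 + (cosph p)\<^sup>2 = 1"
proof -
  have "(rad p)\<^sup>2 = (p$2)\<^sup>2 + (p$3)\<^sup>2 + (p$4)\<^sup>2" unfolding rad_def by simp
  moreover have "(rad p)\<^sup>2 \<noteq> 0" using assms by simp
  ultimately show "(sinth p)\<^sup>2 + (costh p)\<^sup>2 = 1"
    unfolding sinth_def costh_def
    by (simp add: power_divide divide_simps)
  show "(sinph p)\<^sup>2 + (cosph p)\<^sup>2 = 1"
    unfolding sinph_def cosph_def
    by (auto simp: power_divide add_divide_distrib[symmetric] sum_power2_eq_zero_iff)
qed

lemma pairing:
  assumes "rad p > 0"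
  shows "d_t p \<bullet> v_t p = 1" "d_t p \<bullet> v_r p = 0" "d_t p \<bullet> v_th p = 0" "d_t p \<bullet> v_phs p = 0"
    and "d_r p \<bullet> v_t p = 0" "d_r p \<bullet> v_r p = 1" "d_r p \<bullet> v_th p = 0" "d_r p \<bullet> v_phs p = 0"
    and "d_th p \<bullet> v_t p = 0" "d_th p \<bullet> v_r p = 0" "d_th p \<bullet> v_th p = 1" "d_th p \<bullet> v_phs p = 0"
    and "d_phs p \<bullet> v_t p = 0" "d_phs p \<bullet> v_r p = 0" "d_phs p \<bullet> v_th p = 0" "d_phs p \<bullet> v_phs p = 1"
proof -
  define s c s' c' R where "s = sinth p" "c = costh p" "s' = sinph p" "c' = cosph p" "R = rad p"
  note d = this
  have 1: "s\<^sup>2 = 1 - c\<^sup>2" "s'\<^sup>2 = 1 - c'\<^sup>2" "R \<noteq> 0"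
    using trig_identities[OF assms] assms by (auto simp: d)
  note defs = d_t_def d_r_def d_th_def d_phs_def v_t_def v_r_def v_th_def v_phs_def
    inner_vec_def sum_4 d[symmetric]
  show "d_t p \<bullet> v_t p = 1" "d_t p \<bullet> v_r p = 0" "d_t p \<bullet> v_th p = 0" "d_t p \<bullet> v_phs p = 0"
    "d_r p \<bullet> v_t p = 0" "d_th p \<bullet> v_t p = 0" "d_phs p \<bullet> v_t p = 0"
    "d_r p \<bullet> v_phs p = 0" "d_phs p \<bullet> v_r p = 0"
    "d_th p \<bullet> v_phs p = 0" "d_phs p \<bullet> v_th p = 0"
    using 1 by (simp_all add: defs)
  have "s * c' * (s * c') + s * s' * (s * s') + c * c = s\<^sup>2 * (c'\<^sup>2 + s'\<^sup>2) + c\<^sup>2"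
    by algebra
  then show "d_r p \<bullet> v_r p = 1" using 1 by (simp add: defs)
  have "c * c' * (c * c') + c * s' * (c * s') + s * s = c\<^sup>2 * (c'\<^sup>2 + s'\<^sup>2) + s\<^sup>2"
    by algebra
  then have 2: "c * c' * (c * c') + c * s' * (c * s') + s * s = 1" using 1 by simp
  have "d_th p \<bullet> v_th p = 1 / R\<^sup>2 * (R * R) * (c * c' * (c * c') + c * s' * (c * s') + s * s)"
    by (simp add: defs algebra_simps)
  then show "d_th p \<bullet> v_th p = 1" using 1 2 by (simp add: power2_eq_square)
  have 3: "s * c' * (c * c') + s * s' * (c * s') = s * c"
    using 1(2) by algebra
  have "d_r p \<bullet> v_th p = R * (s * c' * (c * c') + s * s' * (c * s') - s * c)"
    by (simp add: defs algebra_simps)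
  then show "d_r p \<bullet> v_th p = 0" using 3 by simp
  have "d_th p \<bullet> v_r p = 1 / R\<^sup>2 * R * (s * c' * (c * c') + s * s' * (c * s') - s * c)"
    by (simp add: defs algebra_simps)
  then show "d_th p \<bullet> v_r p = 0" using 3 by simp
  have "d_phs p \<bullet> v_phs p = 1 / R\<^sup>2 * (R * R) * (s'\<^sup>2 + c'\<^sup>2)"
    by (simp add: defs algebra_simps power2_eq_square)
  then show "d_phs p \<bullet> v_phs p = 1" using 1 by (simp add: power2_eq_square)
qed

lemma kerr_g_bilinear:
  "kerr_g M a p (u + u') v = kerr_g M a p u v + kerr_g M a p u' v"
  "kerr_g M a p u (v + v') = kerr_g M a p u v + kerr_g M a p u v'"
  "kerr_g M a p (u - u') v = kerr_g M a p u v - kerr_g M a p u' v"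
  "kerr_g M a p u (v - v') = kerr_g M a p u v - kerr_g M a p u v'"
  "kerr_g M a p (k *\<^sub>R u) v = k * kerr_g M a p u v"
  "kerr_g M a p u (k *\<^sub>R v) = k * kerr_g M a p u v"
  "kerr_g M a p (- u) v = - kerr_g M a p u v"
  "kerr_g M a p u (- v) = - kerr_g M a p u v"
  unfolding kerr_g_def sym_prod_def by (simp_all add: inner_simps algebra_simps add_divide_distrib diff_divide_distrib)

lemma kerr_g_sym: "kerr_g M a p u v = kerr_g M a p v u"
  unfolding kerr_g_def sym_prod_def by (simp add: algebra_simps)

text \<open>The familiar metric components in horizon-regular coordinates.\<close>

lemma kerr_g_coord:
  assumes "rad p > 0"
  shows "kerr_g M a p (v_t p) (v_t p) = - (1 - 2 * M * rad p / Sigma_K a p)"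
    and "kerr_g M a p (v_t p) (v_r p) = 1"
    and "kerr_g M a p (v_t p) (v_th p) = 0"
    and "kerr_g M a p (v_t p) (v_ph p) = - 2 * a * M * rad p / Sigma_K a p * (sinth p)\<^sup>2"
    and "kerr_g M a p (v_r p) (v_r p) = 0"
    and "kerr_g M a p (v_r p) (v_th p) = 0"
    and "kerr_g M a p (v_r p) (v_ph p) = - a * (sinth p)\<^sup>2"
    and "kerr_g M a p (v_th p) (v_th p) = Sigma_K a p"
    and "kerr_g M a p (v_th p) (v_ph p) = 0"
    and "kerr_g M a p (v_ph p) (v_ph p) =
      (((rad p)\<^sup>2 + a\<^sup>2)\<^sup>2 - Delta M a p * a\<^sup>2 * (sinth p)\<^sup>2) / Sigma_K a p * (sinth p)\<^sup>2"
  unfolding kerr_g_def sym_prod_def v_ph_def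
  by (simp_all add: pairing[OF assms] power2_eq_square)

lemma kerr_g_phs:
  assumes "rad p > 0"
  shows "kerr_g M a p (v_t p) (v_phs p) = - 2 * a * M * rad p / Sigma_K a p * sinth p"
    and "kerr_g M a p (v_r p) (v_phs p) = - a * sinth p"
    and "kerr_g M a p (v_th p) (v_phs p) = 0"
    and "kerr_g M a p (v_phs p) (v_phs p) =
      (((rad p)\<^sup>2 + a\<^sup>2)\<^sup>2 - Delta M a p * a\<^sup>2 * (sinth p)\<^sup>2) / Sigma_K a p"
  unfolding kerr_g_def sym_prod_def
  by (simp_all add: pairing[OF assms] power2_eq_square)

lemma Delta_expand:
  assumes "\<bar>a\<bar> \<le> M"
  shows "Delta_r M a r = r\<^sup>2 - 2 * M * r + a\<^sup>2"
proof -
  have "a\<^sup>2 \<le> M\<^sup>2" using assms by (metis abs_le_square_iff abs_of_nonneg abs_ge_zero order_trans)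
  then have "(sqrt (M\<^sup>2 - a\<^sup>2))\<^sup>2 = M\<^sup>2 - a\<^sup>2" by simp
  then show ?thesis
    unfolding Delta_r_def r_plus_def r_minus_def by algebra
qed

lemma exterior_rad_pos:
  assumes "M > 0" "\<bar>a\<bar> \<le> M" "p \<in> exterior M a"
  shows "rad p > 0"
proof -
  have "a\<^sup>2 \<le> M\<^sup>2" using assms(2) by (metis abs_le_square_iff abs_of_nonneg abs_ge_zero order_trans)
  then have "r_plus M a > 0" unfolding r_plus_def using assms(1) by (simp add: add_pos_nonneg)
  then show ?thesis using assms(3) by (simp add: exterior_def)
qed

text \<open>In particular \<open>(e1, e2)\<close> is orthonormal on the axis as well.\<close>

lemma frame_relations:
  assumes "rad p > 0" "\<bar>a\<bar> \<le> M"
  shows "kerr_g M a p (e3 p) (e3 p) = 0" "kerr_g M a p (e4 M a p) (e4 M a p) = 0"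
    and "kerr_g M a p (e3 p) (e4 M a p) = -2"
    and "kerr_g M a p (e1 a p) (e1 a p) = 1" "kerr_g M a p (e2 a p) (e2 a p) = 1"
    and "kerr_g M a p (e1 a p) (e2 a p) = 0"
    and "kerr_g M a p (e1 a p) (e3 p) = 0" "kerr_g M a p (e2 a p) (e3 p) = 0"
    and "kerr_g M a p (e1 a p) (e4 M a p) = 0" "kerr_g M a p (e2 a p) (e4 M a p) = 0"
proof -
  define s c R S where "s = sinth p" "c = costh p" "R = rad p" "S = Sigma_K a p"
  note d = this
  have R: "R > 0" using assms d by simp
  have sc: "s\<^sup>2 = 1 - c\<^sup>2" using trig_identities[OF assms(1)] by (simp add: d)
  have S: "S = R\<^sup>2 + a\<^sup>2 * c\<^sup>2" by (simp add: d Sigma_K_def)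
  have S0: "S \<noteq> 0" using R S by (metis add_pos_nonneg less_irrefl zero_le_mult_iff zero_le_power2 zero_less_power)
  have D: "Delta M a p = R\<^sup>2 - 2 * M * R + a\<^sup>2" by (simp add: d Delta_def Delta_expand[OF assms(2)])
  note G = kerr_g_bilinear kerr_g_coord[OF assms(1)] kerr_g_phs[OF assms(1)]
    kerr_g_sym[of M a p "v_r p" "v_t p"] kerr_g_sym[of M a p "v_th p" "v_t p"]
    kerr_g_sym[of M a p "v_phs p" "v_t p"] kerr_g_sym[of M a p "v_th p" "v_r p"]
    kerr_g_sym[of M a p "v_phs p" "v_r p"] kerr_g_sym[of M a p "v_phs p" "v_th p"]
  note F = e1_def e2_def e3_def e4_def v_ph_def G d[symmetric] D
  have q: "R\<^sup>2 + a\<^sup>2 - a\<^sup>2 * s\<^sup>2 = S" using S sc by algebra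
  show "kerr_g M a p (e3 p) (e3 p) = 0" by (simp add: F)
  show "kerr_g M a p (e3 p) (e4 M a p) = -2"
    using S0 q by (simp add: F field_simps power2_eq_square)
  show "kerr_g M a p (e1 a p) (e3 p) = 0" "kerr_g M a p (e2 a p) (e3 p) = 0"
    by (simp_all add: F field_simps power2_eq_square)
  have I: "x / S = x * inverse S" for x by (simp add: divide_inverse)
  have IS: "inverse S * S = 1" using S0 by simp
  show "kerr_g M a p (e4 M a p) (e4 M a p) = 0"
    apply (simp only: F) apply (simp only: I) using IS S sc by algebra
  show "kerr_g M a p (e1 a p) (e1 a p) = 1"
    apply (simp only: F) apply (simp only: I) using IS S sc by algebra
  show "kerr_g M a p (e2 a p) (e2 a p) = 1"
    apply (simp only: F) apply (simp only: I) using IS S sc by algebra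
  show "kerr_g M a p (e1 a p) (e2 a p) = 0"
    apply (simp only: F) apply (simp only: I) using IS S sc by algebra
  show "kerr_g M a p (e1 a p) (e4 M a p) = 0"
    apply (simp only: F) apply (simp only: I) using IS S sc by algebra
  show "kerr_g M a p (e2 a p) (e4 M a p) = 0"
    apply (simp only: F) apply (simp only: I) using IS S sc by algebra
qed

lemma harea_frame:
  assumes "rad p > 0" "\<bar>a\<bar> \<le> M"
  shows "harea M a p (e1 a p) (e2 a p) = 1"
  using frame_relations[OF assms] kerr_g_sym[of M a p "e2 a p" "e1 a p"]
  by (simp add: harea_def)

lemma hproj_orthogonal:
  assumes "rad p > 0" "\<bar>a\<bar> \<le> M"
  shows "kerr_g M a p (hproj M a p v) (e3 p) = 0" "kerr_g M a p (hproj M a p v) (e4 M a p) = 0"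
    and "v - hproj M a p v \<in> span {e3 p, e4 M a p}"
proof -
  note f = frame_relations[OF assms] kerr_g_sym[of M a p "e4 M a p" "e3 p"]
  show "kerr_g M a p (hproj M a p v) (e3 p) = 0" "kerr_g M a p (hproj M a p v) (e4 M a p) = 0"
    unfolding hproj_def by (simp_all add: kerr_g_bilinear f)
  have "v - hproj M a p v = - ((kerr_g M a p v (e3 p) / 2) *\<^sub>R e4 M a p
      + (kerr_g M a p v (e4 M a p) / 2) *\<^sub>R e3 p)"
    unfolding hproj_def by simp
  also have "\<dots> \<in> span {e3 p, e4 M a p}"
    by (intro span_neg span_add span_scale span_base) auto
  finally show "v - hproj M a p v \<in> span {e3 p, e4 M a p}" .
qed

text \<open>
  The Boyer--Lindquist coordinates \<open>(t, r, \<theta>, \<phi>)\<close> on \<open>r > r\<^sub>+\<close>: their coordinate vector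
  fields are \<open>v_t\<close>, \<open>bl_dr\<close>, \<open>v_th\<close>, \<open>v_ph\<close>.
\<close>

definition bl_dr :: "real \<Rightarrow> real \<Rightarrow> pt \<Rightarrow> pt"
  where "bl_dr M a p =
    v_r p + (((rad p)\<^sup>2 + a\<^sup>2) / Delta M a p) *\<^sub>R v_t p + (a / Delta M a p) *\<^sub>R v_ph p"

lemma e4_boyer_lindquist:
  assumes "Delta M a p \<noteq> 0"
  shows "e4 M a p = (((rad p)\<^sup>2 + a\<^sup>2) / Sigma_K a p) *\<^sub>R v_t p
    + (Delta M a p / Sigma_K a p) *\<^sub>R bl_dr M a p + (a / Sigma_K a p) *\<^sub>R v_ph p"
proof -
  have *: "2 * x / S = x / S + D / S * (x / D)" if "D \<noteq> 0" for x S D :: real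
    using that by (simp add: field_simps)
  show ?thesis
    unfolding e4_def bl_dr_def *[OF assms]
    by (simp add: scaleR_add_left scaleR_add_right)
qed

lemma e3_boyer_lindquist:
  "e3 p = (((rad p)\<^sup>2 + a\<^sup>2) / Delta M a p) *\<^sub>R v_t p - bl_dr M a p + (a / Delta M a p) *\<^sub>R v_ph p"
  unfolding e3_def bl_dr_def by simp

definition sph_chart :: "real^4 \<Rightarrow> pt"
  where "sph_chart x = vector [x$1, x$2 * sin (x$3) * cos (x$4), x$2 * sin (x$3) * sin (x$4), x$2 * cos (x$3)]"

definition bl_chart :: "real \<Rightarrow> real \<Rightarrow> real^4 \<Rightarrow> pt"
  where "bl_chart M a x = sph_chart (vector
    [x$1 + (LBINT s=9*M/4..x$2. (s\<^sup>2 + a\<^sup>2) / Delta_r M a s), x$2, x$3,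
     x$4 + (LBINT s=9*M/4..x$2. a / Delta_r M a s)])"

lemma sph_chart_coords:
  assumes "x$2 > 0" "0 < x$3" "x$3 < pi"
  shows "rad (sph_chart x) = x$2" "sinth (sph_chart x) = sin (x$3)" "costh (sph_chart x) = cos (x$3)"
    "sinph (sph_chart x) = sin (x$4)" "cosph (sph_chart x) = cos (x$4)"
proof -
  let ?p = "sph_chart x"
  have s: "sin (x$3) > 0" using assms sin_gt_zero by blast
  have p: "?p $ 2 = x$2 * sin (x$3) * cos (x$4)" "?p $ 3 = x$2 * sin (x$3) * sin (x$4)"
    "?p $ 4 = x$2 * cos (x$3)" by (simp_all add: sph_chart_def)
  have 1: "(?p$2)\<^sup>2 + (?p$3)\<^sup>2 = (x$2 * sin (x$3))\<^sup>2"
    unfolding p using sin_cos_squared_add[of "x$4"] by algebra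
  then have 2: "sqrt ((?p$2)\<^sup>2 + (?p$3)\<^sup>2) = x$2 * sin (x$3)" using assms s by simp
  have "(?p$2)\<^sup>2 + (?p$3)\<^sup>2 + (?p$4)\<^sup>2 = (x$2)\<^sup>2"
    unfolding 1 p(3) using sin_cos_squared_add[of "x$3"] by algebra
  then show r: "rad ?p = x$2" unfolding rad_def using assms by simp
  show "sinth ?p = sin (x$3)" "costh ?p = cos (x$3)"
    unfolding sinth_def costh_def r 2 p(3) using assms by simp_all
  have nz: "\<not> (?p$2 = 0 \<and> ?p$3 = 0)" using 1 assms s by auto
  show "sinph ?p = sin (x$4)" "cosph ?p = cos (x$4)"
    unfolding sinph_def cosph_def 2 using nz assms s by (auto simp: p)
qed

lemma vec4_expansion: "(\<Sum>i\<in>UNIV. (y $ i) *\<^sub>R (axis i 1 :: real^4)) = (y :: real^4)"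
  by (simp add: vec_eq_iff axis_def if_distrib cong: if_cong)

lemma sph_chart_has_derivative:
  assumes "x$2 > 0" "0 < x$3" "x$3 < pi"
  shows "(sph_chart has_derivative (\<lambda>h. (h$1) *\<^sub>R v_t (sph_chart x) + (h$2) *\<^sub>R v_r (sph_chart x)
     + (h$3) *\<^sub>R v_th (sph_chart x) + (h$4) *\<^sub>R v_ph (sph_chart x))) (at x)"
proof -
  have "((\<lambda>y. \<Sum>i\<in>UNIV. (sph_chart y $ i) *\<^sub>R (axis i 1 :: real^4)) has_derivative
     (\<lambda>h. \<Sum>i\<in>UNIV. (((h$1) *\<^sub>R v_t (sph_chart x) + (h$2) *\<^sub>R v_r (sph_chart x)
     + (h$3) *\<^sub>R v_th (sph_chart x) + (h$4) *\<^sub>R v_ph (sph_chart x)) $ i) *\<^sub>R (axis i 1 :: real^4))) (at x)"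
    unfolding sum_4 v_ph_def v_t_def v_r_def v_th_def v_phs_def sph_chart_coords[OF assms]
    unfolding sph_chart_def vector4
    by (auto intro!: derivative_eq_intros bounded_linear.has_derivative[OF bounded_linear_vec_nth]
         simp: algebra_simps)
  then show ?thesis by (simp only: vec4_expansion)
qed

lemma bl_integral_deriv:
  assumes "M > 0" "\<bar>a\<bar> \<le> M" "r > r_plus M a" "continuous_on UNIV f"
  shows "((\<lambda>u. LBINT s=9*M/4..u. f s / Delta_r M a s) has_real_derivative f r / Delta_r M a r) (at r)"
proof -
  have "sqrt (M\<^sup>2 - a\<^sup>2) \<le> sqrt (M\<^sup>2)" by (rule real_sqrt_le_mono) simp
  then have rp: "r_plus M a \<le> 2 * M" unfolding r_plus_def using assms(1) by simp
  have rm: "r_minus M a \<le> r_plus M a"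
    unfolding r_minus_def r_plus_def
    using assms by (simp add: abs_le_square_iff[symmetric])
  define lo hi where "lo = (r_plus M a + min r (9*M/4)) / 2" "hi = max r (9*M/4) + 1"
  have b: "r_plus M a < lo" "lo < r" "r < hi" "lo \<le> 9*M/4" "9*M/4 \<le> hi"
    using rp assms unfolding lo_hi_def by (auto simp: min_def max_def)
  have c: "continuous_on {lo..hi} (\<lambda>s. f s / Delta_r M a s)"
    unfolding Delta_r_def using b rm
    by (intro continuous_intros continuous_on_subset[OF assms(4)]) auto
  have "((\<lambda>u. LBINT s=9*M/4..u. f s / Delta_r M a s) has_vector_derivative f r / Delta_r M a r)
      (at r within {lo..hi})"
    by (rule interval_integral_FTC2[OF b(4,5) c]) (use b in auto)
  then show ?thesis
    using b at_within_interior[of r "{lo..hi}"]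
    by (simp add: has_real_derivative_iff_has_vector_derivative)
qed

lemma bl_chart_has_derivative:
  assumes "M > 0" "\<bar>a\<bar> \<le> M" "x$2 > r_plus M a" "0 < x$3" "x$3 < pi"
  defines "p \<equiv> bl_chart M a x"
  shows "(bl_chart M a has_derivative (\<lambda>h. (h$1) *\<^sub>R v_t p + (h$2) *\<^sub>R bl_dr M a p
     + (h$3) *\<^sub>R v_th p + (h$4) *\<^sub>R v_ph p)) (at x)"
proof -
  define T where "T y = (vector
    [y$1 + (LBINT s=9*M/4..y$2. (s\<^sup>2 + a\<^sup>2) / Delta_r M a s), y$2, y$3,
     y$4 + (LBINT s=9*M/4..y$2. a / Delta_r M a s)] :: real^4)" for y :: "real^4"
  have bT: "bl_chart M a = (\<lambda>y. sph_chart (T y))" by (simp add: fun_eq_iff bl_chart_def T_def)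
  have "a\<^sup>2 \<le> M\<^sup>2" using assms(2) by (metis abs_le_square_iff abs_of_nonneg abs_ge_zero order_trans)
  then have "r_plus M a > 0" unfolding r_plus_def using assms(1) by (simp add: add_pos_nonneg)
  then have T: "T x $ 2 > 0" "0 < T x $ 3" "T x $ 3 < pi" using assms by (auto simp: T_def)
  have p: "p = sph_chart (T x)" by (simp add: p_def bT)
  have rp: "rad p = x$2" using sph_chart_coords(1)[OF T] by (simp add: p T_def)
  define k l where "k = ((x$2)\<^sup>2 + a\<^sup>2) / Delta_r M a (x$2)" "l = a / Delta_r M a (x$2)"
  define T' where "T' h = (vector [h$1 + h$2 * k, h$2, h$3, h$4 + h$2 * l] :: real^4)" for h :: "real^4"
  have I1: "((\<lambda>y. LBINT s=9*M/4..y$2. (s\<^sup>2 + a\<^sup>2) / Delta_r M a s) has_derivative (\<lambda>h. h$2 * k)) (at x)"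
    using has_derivative_compose[OF bounded_linear.has_derivative[OF bounded_linear_vec_nth has_derivative_ident, of 2]
      bl_integral_deriv[OF assms(1-3), of "\<lambda>s. s\<^sup>2 + a\<^sup>2", unfolded has_field_derivative_def]]
    unfolding k_l_def by (simp add: mult.commute continuous_intros)
  have I2: "((\<lambda>y. LBINT s=9*M/4..y$2. a / Delta_r M a s) has_derivative (\<lambda>h. h$2 * l)) (at x)"
    using has_derivative_compose[OF bounded_linear.has_derivative[OF bounded_linear_vec_nth has_derivative_ident, of 2]
      bl_integral_deriv[OF assms(1-3), of "\<lambda>s. a", unfolded has_field_derivative_def]]
    unfolding k_l_def by (simp add: mult.commute continuous_intros)
  have "((\<lambda>y. \<Sum>i\<in>UNIV. (T y $ i) *\<^sub>R (axis i 1 :: real^4)) has_derivative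
     (\<lambda>h. \<Sum>i\<in>UNIV. (T' h $ i) *\<^sub>R (axis i 1 :: real^4))) (at x)"
    unfolding sum_4 T_def T'_def vector4
    by (intro has_derivative_add has_derivative_scaleR_left I1 I2
        bounded_linear.has_derivative[OF bounded_linear_vec_nth] has_derivative_ident)
  then have "(T has_derivative T') (at x)" by (simp only: vec4_expansion)
  from has_derivative_compose[OF this sph_chart_has_derivative[OF T]]
  have "(bl_chart M a has_derivative (\<lambda>h. (T' h$1) *\<^sub>R v_t p + (T' h$2) *\<^sub>R v_r p
     + (T' h$3) *\<^sub>R v_th p + (T' h$4) *\<^sub>R v_ph p)) (at x)"
    by (simp add: bT p)
  moreover have "bl_dr M a p = v_r p + k *\<^sub>R v_t p + l *\<^sub>R v_ph p"
    by (simp add: bl_dr_def k_l_def rp Delta_def)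
  ultimately show ?thesis
    by (simp add: T'_def algebra_simps)
qed

lemma eta_boyer_lindquist:
  fixes M a :: real and p :: pt
  defines "dt \<equiv> d_t p - (((rad p)\<^sup>2 + a\<^sup>2) / Delta M a p) *\<^sub>R d_r p"
    and "sin_dph \<equiv> d_phs p - (sinth p * (a / Delta M a p)) *\<^sub>R d_r p"
  shows "eta a p =
      - (a\<^sup>2 * rad p / (Sigma_K a p)\<^sup>2 * (sinth p)\<^sup>2) *\<^sub>R dt
      - (a\<^sup>2 * (2 * sinth p * costh p) / (2 * Sigma_K a p)) *\<^sub>R d_th p
      + (a * rad p * ((rad p)\<^sup>2 + a\<^sup>2) / (Sigma_K a p)\<^sup>2 * sinth p) *\<^sub>R sin_dph"
    and "etab a p =
      (a\<^sup>2 * rad p / (Sigma_K a p)\<^sup>2 * (sinth p)\<^sup>2) *\<^sub>R dt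
      - (a\<^sup>2 * (2 * sinth p * costh p) / (2 * Sigma_K a p)) *\<^sub>R d_th p
      - (a * rad p * ((rad p)\<^sup>2 + a\<^sup>2) / (Sigma_K a p)\<^sup>2 * sinth p) *\<^sub>R sin_dph"
proof -
  define A B k l where "A = a\<^sup>2 * rad p / (Sigma_K a p)\<^sup>2 * (sinth p)\<^sup>2"
    and "B = a * rad p * ((rad p)\<^sup>2 + a\<^sup>2) / (Sigma_K a p)\<^sup>2 * sinth p"
    and "k = ((rad p)\<^sup>2 + a\<^sup>2) / Delta M a p" and "l = sinth p * (a / Delta M a p)"
  note d = this
  have "A * k = B * l"
    unfolding d by (simp add: divide_inverse power2_eq_square algebra_simps)
  then have "A *\<^sub>R (k *\<^sub>R d_r p) = B *\<^sub>R (l *\<^sub>R d_r p)" by simp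
  then show "eta a p = - A *\<^sub>R dt
      - (a\<^sup>2 * (2 * sinth p * costh p) / (2 * Sigma_K a p)) *\<^sub>R d_th p + B *\<^sub>R sin_dph"
    and "etab a p = A *\<^sub>R dt
      - (a\<^sup>2 * (2 * sinth p * costh p) / (2 * Sigma_K a p)) *\<^sub>R d_th p - B *\<^sub>R sin_dph"
    unfolding eta_def etab_def dt_def sin_dph_def d(1,2)[symmetric] d(3,4)[symmetric]
    by (simp_all only: scaleR_minus_left scaleR_diff_right) simp_all
qed

end

theory Submission
  imports Defs
begin

text \<open>
  The first equation is obtained by writing \<open>\<beta> = D\<rho> + \<star>D\<sigma> + 2 \<rho> \<eta> + 2 \<sigma> \<star>\<eta>\<close> for the
  right-hand side of the Maxwell equation for \<open>D\<^sub>3 \<alpha>\<close>, applying \<open>D\<^sub>4\<close> to it and commuting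
  \<open>D\<^sub>4\<close> with \<open>D\<close>.  The commutator reproduces \<open>D\<close> of the transport equations of \<open>\<rho>\<close> and
  \<open>\<sigma>\<close> along \<open>e4\<close>, and these express \<open>div (\<Sigma> \<alpha>)\<close> and \<open>curl (\<Sigma> \<alpha>)\<close>.  Everything else is a
  multiple of \<open>\<rho>\<close> or \<open>\<sigma>\<close>, whose coefficient vanishes by one identity between the
  connection coefficients.  The second equation is the same computation along \<open>e3\<close>.
  Both are therefore instances of \<open>decoupling_identity\<close>, an identity for two arbitrary
  functions, proved for an abstract shear-free null field \<open>X\<close> (locale \<open>principal_null\<close>).

  The calculations rest on the vector fields \<open>hlift a p w\<close>.  In horizon-regular coordinates the
  horizontal distribution is the common kernel of \<open>dr\<close> and of the form \<open>\<lambda> = dt - a sin\<^sup>2\<theta> d\<phi>\<close>,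
  so it is spanned by \<open>\<partial>\<^sub>\<theta>\<close> and \<open>\<partial>\<^sub>\<phi> / sin \<theta> + a sin \<theta> \<partial>\<^sub>t\<close>.  For a constant vector
  \<open>w\<close> of \<open>\<real>\<^sup>3\<close>, \<open>hlift a p w\<close> is the horizontal vector whose angular part is \<open>r\<close> times the
  tangential part of \<open>w\<close> on the sphere.  These fields are smooth across the axis, they span the
  horizontal distribution at every point, \<open>g\<close> is \<open>\<Sigma>\<close> times the round inner product on them,
  and the Hodge star acts on them by the cross product with the radial direction
  (\<open>hstar_hlift\<close>).  They almost commute with the null fields: \<open>[H, e3] = 0\<close>, and \<open>[H, e4]\<close> is a
  rotation of \<open>H\<close> plus a multiple of \<open>e4\<close>, because \<open>\<Sigma> e4\<close> has coefficients depending on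
  \<open>r\<close> only (\<open>bracket_e3\<close>, \<open>bracket_e4\<close>).

  The Koszul formula needs only these brackets and inner products.  It shows that the
  horizontal part of \<open>\<nabla>\<^sub>H X\<close> is \<open>1/2 tr \<chi> H + 1/2 (\<epsilon> \<cdot> \<chi>) \<star>H\<close>
  (\<open>second_fundamental_form\<close>), so no Christoffel symbol is ever evaluated.  From it follow that
  \<open>D\<^sub>X\<close> commutes with the Hodge star (\<open>DX_hstar\<close>) and the commutator of \<open>D\<^sub>X\<close> and \<open>D\<close>
  on functions (\<open>DX_hgrad\<close>).  What is left are the two identities between connection coefficients,
  \<open>structure_equation_e4\<close> and \<open>structure_equation_e3\<close>, which are polynomial identities.
\<close>

section \<open>Symmetry of second derivatives\<close>

text \<open>
  The mean value theorem, once in direction \<open>v\<close> and once in direction \<open>w\<close>.  The double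
  difference is symmetric in \<open>v\<close> and \<open>w\<close>, which is what makes the second derivatives agree.
\<close>

lemma double_difference_mean_value:
  fixes f :: "'a::real_normed_vector \<Rightarrow> real"
  assumes f: "\<And>y. y \<in> U \<Longrightarrow> (f has_derivative f' y) (at y)"
    and fv: "\<And>y. y \<in> U \<Longrightarrow> ((\<lambda>y. f' y v) has_derivative g y) (at y)"
    and t: "0 < t"
    and U: "\<And>r s. 0 \<le> r \<Longrightarrow> r \<le> t \<Longrightarrow> 0 \<le> s \<Longrightarrow> s \<le> t \<Longrightarrow> x + r *\<^sub>R v + s *\<^sub>R w \<in> U"
  obtains r s where "0 \<le> r" "r \<le> t" "0 \<le> s" "s \<le> t"
    "f (x + t *\<^sub>R v + t *\<^sub>R w) - f (x + t *\<^sub>R v) - f (x + t *\<^sub>R w) + f x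
       = t\<^sup>2 * g (x + r *\<^sub>R v + s *\<^sub>R w) w"
proof -
  have lin: "((\<lambda>r. c + r *\<^sub>R d) has_derivative (\<lambda>k. k *\<^sub>R d)) (at r)" for c d :: 'a and r :: real
    by (auto intro!: derivative_eq_intros)
  have D1: "((\<lambda>r. f (c + r *\<^sub>R v)) has_real_derivative f' (c + r *\<^sub>R v) v) (at r)"
    if "c + r *\<^sub>R v \<in> U" for c r
  proof -
    interpret bounded_linear "f' (c + r *\<^sub>R v)" using f[OF that] by (rule has_derivative_bounded_linear)
    show ?thesis
      unfolding has_field_derivative_def using has_derivative_compose[OF lin f[OF that]]
      by (rule has_derivative_eq_rhs) (simp add: fun_eq_iff scaleR)
  qed
  have D2: "((\<lambda>s. f' (c + s *\<^sub>R w) v) has_real_derivative g (c + s *\<^sub>R w) w) (at s)"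
    if "c + s *\<^sub>R w \<in> U" for c s
  proof -
    interpret bounded_linear "g (c + s *\<^sub>R w)" using fv[OF that] by (rule has_derivative_bounded_linear)
    show ?thesis
      unfolding has_field_derivative_def using has_derivative_compose[OF lin fv[OF that]]
      by (rule has_derivative_eq_rhs) (simp add: fun_eq_iff scaleR)
  qed
  define h where "h r = f (x + t *\<^sub>R w + r *\<^sub>R v) - f (x + r *\<^sub>R v)" for r
  have "(h has_real_derivative f' (x + t *\<^sub>R w + r *\<^sub>R v) v - f' (x + r *\<^sub>R v) v) (at r)"
    if "0 \<le> r" "r \<le> t" for r
  proof -
    have "x + t *\<^sub>R w + r *\<^sub>R v \<in> U" "x + r *\<^sub>R v \<in> U"
      using U[OF that, of t] U[OF that, of 0] t by (simp_all add: add.assoc add.commute[of "t *\<^sub>R w"])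
    then show ?thesis unfolding h_def by (rule DERIV_diff[OF D1 D1])
  qed
  then obtain r where r: "0 < r" "r < t"
    "h t - h 0 = (t - 0) * (f' (x + t *\<^sub>R w + r *\<^sub>R v) v - f' (x + r *\<^sub>R v) v)"
    using MVT2[OF t, of h "\<lambda>r. f' (x + t *\<^sub>R w + r *\<^sub>R v) v - f' (x + r *\<^sub>R v) v"] by blast
  have "((\<lambda>s. f' (x + r *\<^sub>R v + s *\<^sub>R w) v) has_real_derivative g (x + r *\<^sub>R v + s *\<^sub>R w) w) (at s)"
    if "0 \<le> s" "s \<le> t" for s
    using U[of r s] r that by (intro D2) (simp del: scaleR_left_diff_distrib)
  then obtain s where s: "0 < s" "s < t"
    "f' (x + r *\<^sub>R v + t *\<^sub>R w) v - f' (x + r *\<^sub>R v + 0 *\<^sub>R w) v = (t - 0) * g (x + r *\<^sub>R v + s *\<^sub>R w) w"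
    using MVT2[OF t, of "\<lambda>s. f' (x + r *\<^sub>R v + s *\<^sub>R w) v" "\<lambda>s. g (x + r *\<^sub>R v + s *\<^sub>R w) w"] by blast
  show thesis
  proof (rule that[of r s])
    show "f (x + t *\<^sub>R v + t *\<^sub>R w) - f (x + t *\<^sub>R v) - f (x + t *\<^sub>R w) + f x
       = t\<^sup>2 * g (x + r *\<^sub>R v + s *\<^sub>R w) w"
      using r(3) s(3) by (simp add: h_def power2_eq_square algebra_simps)
  qed (use r s in auto)
qed

text \<open>
  Only the two mixed derivatives in question are required to be continuous.  Both are close to the
  same difference quotient over a small parallelogram.
\<close>

lemma second_derivative_symmetric:
  fixes f :: "'a::real_normed_vector \<Rightarrow> real"
  assumes "open U" "x \<in> U"
    and f: "\<And>y. y \<in> U \<Longrightarrow> (f has_derivative f' y) (at y)"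
    and fv: "\<And>y. y \<in> U \<Longrightarrow> ((\<lambda>y. f' y v) has_derivative g y) (at y)"
    and fw: "\<And>y. y \<in> U \<Longrightarrow> ((\<lambda>y. f' y w) has_derivative h y) (at y)"
    and cg: "continuous_on U (\<lambda>y. g y w)" and ch: "continuous_on U (\<lambda>y. h y v)"
  shows "g x w = h x v"
proof -
  have "\<bar>g x w - h x v\<bar> \<le> 2 * e" if e: "e > 0" for e
  proof -
    from assms(1,2) cg have "continuous (at x) (\<lambda>y. g y w)"
      by (simp add: continuous_on_eq_continuous_at)
    then obtain d1 where d1: "d1 > 0" "\<And>y. dist y x < d1 \<Longrightarrow> dist (g y w) (g x w) < e"
      using e unfolding continuous_at_eps_delta by blast
    from assms(1,2) ch have "continuous (at x) (\<lambda>y. h y v)"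
      by (simp add: continuous_on_eq_continuous_at)
    then obtain d2 where d2: "d2 > 0" "\<And>y. dist y x < d2 \<Longrightarrow> dist (h y v) (h x v) < e"
      using e unfolding continuous_at_eps_delta by blast
    obtain d3 where d3: "d3 > 0" "ball x d3 \<subseteq> U"
      using assms(1,2) openE by blast
    define d where "d = min d1 (min d2 d3)"
    \<comment> \<open>so small that the whole parallelogram lies in the ball of radius \<open>d\<close>\<close>
    define t where "t = d / (2 * (norm v + norm w + 1))"
    have d: "d > 0" using d1 d2 d3 by (simp add: d_def)
    have pos: "2 * (norm v + norm w + 1) > 0" by (simp add: add_nonneg_pos)
    then have t: "t > 0" using d by (simp add: t_def)
    have near: "dist (x + r *\<^sub>R v + s *\<^sub>R w) x < d" if "0 \<le> r" "r \<le> t" "0 \<le> s" "s \<le> t" for r s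
    proof -
      have "dist (x + r *\<^sub>R v + s *\<^sub>R w) x = norm (r *\<^sub>R v + s *\<^sub>R w)"
        by (simp add: dist_norm)
      also have "\<dots> \<le> r * norm v + s * norm w"
        using norm_triangle_ineq[of "r *\<^sub>R v" "s *\<^sub>R w"] that by simp
      also have "\<dots> \<le> t * norm v + t * norm w"
        using that by (intro add_mono mult_right_mono) auto
      also have "\<dots> < t * (2 * (norm v + norm w + 1))"
        using t by (simp add: algebra_simps add_nonneg_pos)
      also have "\<dots> = d" using pos by (simp add: t_def)
      finally show ?thesis .
    qed
    have inU: "x + r *\<^sub>R v + s *\<^sub>R w \<in> U" if "0 \<le> r" "r \<le> t" "0 \<le> s" "s \<le> t" for r s
      using near[OF that] d3 by (auto simp: d_def mem_ball dist_commute)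
    obtain r s where 1: "0 \<le> r" "r \<le> t" "0 \<le> s" "s \<le> t"
      "f (x + t *\<^sub>R v + t *\<^sub>R w) - f (x + t *\<^sub>R v) - f (x + t *\<^sub>R w) + f x
         = t\<^sup>2 * g (x + r *\<^sub>R v + s *\<^sub>R w) w"
      using double_difference_mean_value[OF f fv t inU] by blast
    have inU': "x + r *\<^sub>R w + s *\<^sub>R v \<in> U" if "0 \<le> r" "r \<le> t" "0 \<le> s" "s \<le> t" for r s
      using inU[OF that(3,4,1,2)] by (simp add: algebra_simps)
    obtain r' s' where 2: "0 \<le> r'" "r' \<le> t" "0 \<le> s'" "s' \<le> t"
      "f (x + t *\<^sub>R w + t *\<^sub>R v) - f (x + t *\<^sub>R w) - f (x + t *\<^sub>R v) + f x
         = t\<^sup>2 * h (x + r' *\<^sub>R w + s' *\<^sub>R v) v"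
      using double_difference_mean_value[OF f fw t inU'] by blast
    have "t\<^sup>2 * g (x + r *\<^sub>R v + s *\<^sub>R w) w = t\<^sup>2 * h (x + r' *\<^sub>R w + s' *\<^sub>R v) v"
      using 1(5) 2(5) by (simp add: algebra_simps)
    then have eq: "g (x + r *\<^sub>R v + s *\<^sub>R w) w = h (x + r' *\<^sub>R w + s' *\<^sub>R v) v"
      using t by simp
    have "dist (g (x + r *\<^sub>R v + s *\<^sub>R w) w) (g x w) < e"
      using near[OF 1(1-4)] by (intro d1) (simp add: d_def)
    moreover have "dist (h (x + r' *\<^sub>R w + s' *\<^sub>R v) v) (h x v) < e"
      using near[OF 2(3,4,1,2)] by (intro d2) (simp add: d_def algebra_simps)
    ultimately show ?thesis unfolding eq dist_real_def by arith
  qed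
  from this[of "\<bar>g x w - h x v\<bar> / 4"] show ?thesis
    by (cases "g x w = h x v") simp_all
qed

section \<open>Horizontal vectors in the global chart\<close>

definition spatial :: "pt \<Rightarrow> pt"
  where "spatial w = vector [0, w$2, w$3, w$4]"

text \<open>
  The rotation field of the axis at the point \<open>w\<close>, and the infinitesimal rotation applied to \<open>w\<close>.
\<close>

definition rot :: "pt \<Rightarrow> pt"
  where "rot w = vector [0, - (w$3), w$2, 0]"

definition cross :: "pt \<Rightarrow> pt \<Rightarrow> pt"
  where "cross v w = vector [0, v$3 * w$4 - v$4 * w$3, v$4 * w$2 - v$2 * w$4, v$2 * w$3 - v$3 * w$2]"

definition radial :: "pt \<Rightarrow> pt"
  where "radial p = (1 / rad p) *\<^sub>R spatial p"

text \<open>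
  The horizontal lift of \<open>w\<close>: the time component is the one that makes \<open>dt - a sin\<^sup>2\<theta> d\<phi>\<close>
  vanish on it.  Only the radial direction enters, so the field is smooth across the axis.
\<close>

definition hlift :: "real \<Rightarrow> pt \<Rightarrow> pt \<Rightarrow> pt"
  where "hlift a p w = (a * (rot (radial p) \<bullet> w)) *\<^sub>R axis 1 1
    + rad p *\<^sub>R (spatial w - (radial p \<bullet> w) *\<^sub>R radial p)"

text \<open>
  The one-form \<open>dt - a sin\<^sup>2\<theta> d\<phi>\<close>; up to sign it is the metric dual of \<open>e3\<close>.
\<close>

definition contact_form :: "real \<Rightarrow> pt \<Rightarrow> pt \<Rightarrow> real"
  where "contact_form a p u = u$1 - a * (rot (radial p) \<bullet> u) / rad p"

lemmas vec4_simps = vec_eq_iff forall_4 inner_vec_def sum_4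

lemma bounded_linear_spatial: "bounded_linear spatial"
  unfolding linear_conv_bounded_linear[symmetric]
  by (rule linearI) (simp_all add: spatial_def vec4_simps)

lemma bounded_linear_rot: "bounded_linear rot"
  unfolding linear_conv_bounded_linear[symmetric]
  by (rule linearI) (simp_all add: rot_def vec4_simps)

lemma bounded_bilinear_cross: "bounded_bilinear cross"
  unfolding bilinear_conv_bounded_bilinear[symmetric] bilinear_def
  by (auto intro!: linearI simp: cross_def vec4_simps algebra_simps)

lemma spatial_nth [simp]: "spatial w $ 1 = 0" "spatial w $ 2 = w $ 2" "spatial w $ 3 = w $ 3" "spatial w $ 4 = w $ 4"
  by (simp_all add: spatial_def)

lemma rot_nth [simp]: "rot w $ 1 = 0" "rot w $ 2 = - (w $ 3)" "rot w $ 3 = w $ 2" "rot w $ 4 = 0"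
  by (simp_all add: rot_def)

lemma cross_nth [simp]: "cross v w $ 1 = 0" "cross v w $ 2 = v$3 * w$4 - v$4 * w$3"
  "cross v w $ 3 = v$4 * w$2 - v$2 * w$4" "cross v w $ 4 = v$2 * w$3 - v$3 * w$2"
  by (simp_all add: cross_def)

lemma axis_nth [simp]: "(axis 1 x :: pt) $ 1 = x" "(axis 1 x :: pt) $ 2 = 0"
  "(axis 1 x :: pt) $ 3 = 0" "(axis 1 x :: pt) $ 4 = 0"
  by (simp_all add: axis_def)

lemma rad_eq: "rad p = sqrt (spatial p \<bullet> spatial p)"
  by (simp add: rad_def vec4_simps power2_eq_square)

lemma radial_nth [simp]: "radial p $ 1 = 0"
  by (simp add: radial_def)

lemma radial_sum_squares:
  assumes "rad p > 0"
  shows "(radial p $ 2)\<^sup>2 + (radial p $ 3)\<^sup>2 + (radial p $ 4)\<^sup>2 = 1"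
proof -
  have "(rad p)\<^sup>2 = (p$2)\<^sup>2 + (p$3)\<^sup>2 + (p$4)\<^sup>2" unfolding rad_def by simp
  moreover have "(rad p)\<^sup>2 \<noteq> 0" using assms by simp
  ultimately show ?thesis
    by (simp add: radial_def power_divide add_divide_distrib[symmetric])
qed

lemma spatial_eq_radial: "rad p > 0 \<Longrightarrow> spatial p = rad p *\<^sub>R radial p"
  by (simp add: radial_def)

lemma costh_eq: "costh p = radial p $ 4"
  by (simp add: radial_def costh_def)

lemma v_r_eq: "v_r p = radial p"
  by (auto simp: vec4_simps v_r_def radial_def sinth_def cosph_def sinph_def costh_def)

lemma v_ph_eq: "rad p > 0 \<Longrightarrow> v_ph p = rot p"
  by (auto simp: vec4_simps v_ph_def v_phs_def sinth_def cosph_def sinph_def)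

lemma e3_eq: "e3 p = - radial p"
  by (simp add: e3_def v_r_eq)

lemma v_t_eq: "v_t p = axis 1 1"
  by (simp add: v_t_def vec4_simps)

lemma sinth_sq:
  assumes "rad p > 0"
  shows "(sinth p)\<^sup>2 = 1 - (radial p $ 4)\<^sup>2"
  using trig_identities(1)[OF assms] by (simp add: costh_eq)

lemma Sigma_eq: "Sigma_K a p = (rad p)\<^sup>2 + a\<^sup>2 * (radial p $ 4)\<^sup>2"
  by (simp add: Sigma_K_def costh_eq)

lemma Sigma_pos:
  assumes "rad p > 0" shows "Sigma_K a p > 0"
  unfolding Sigma_eq using assms by (simp add: add_pos_nonneg)

lemma e4_eq:
  assumes "rad p > 0"
  shows "e4 M a p = (1 / Sigma_K a p) *\<^sub>R ((2 * ((rad p)\<^sup>2 + a\<^sup>2)) *\<^sub>R axis 1 1 + Delta M a p *\<^sub>R radial p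
    + (2 * a) *\<^sub>R rot p)"
  unfolding e4_def v_t_eq v_r_eq v_ph_eq[OF assms] by (simp add: scaleR_add_right)

text \<open>
  The round metric \<open>d\<theta>\<^sup>2 + sin\<^sup>2\<theta> d\<phi>\<^sup>2\<close>, rewritten without the angles; this form is
  evidently smooth on the axis.
\<close>

lemma sphere_metric:
  assumes "rad p > 0"
  shows "(d_th p \<bullet> u) * (d_th p \<bullet> v) + (d_phs p \<bullet> u) * (d_phs p \<bullet> v)
    = (spatial u \<bullet> spatial v - (radial p \<bullet> u) * (radial p \<bullet> v)) / (rad p)\<^sup>2"
proof -
  define s c s' c' R where "s = sinth p" "c = costh p" "s' = sinph p" "c' = cosph p" "R = rad p"
  note d = this
  have 1: "s\<^sup>2 + c\<^sup>2 = 1" "s'\<^sup>2 + c'\<^sup>2 = 1" and R: "R \<noteq> 0"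
    using trig_identities[OF assms] assms by (auto simp: d)
  have th: "d_th p \<bullet> u = (c * c' * u$2 + c * s' * u$3 - s * u$4) / R" for u
    using R by (simp add: d_th_def v_th_def vec4_simps d[symmetric] power2_eq_square field_simps)
  have ph: "d_phs p \<bullet> u = (- s' * u$2 + c' * u$3) / R" for u
    using R by (simp add: d_phs_def v_phs_def vec4_simps d[symmetric] power2_eq_square field_simps)
  have n: "radial p \<bullet> u = s * c' * u$2 + s * s' * u$3 + c * u$4" for u
    by (simp add: v_r_eq[symmetric] v_r_def vec4_simps d[symmetric])
  have "(c * c' * u$2 + c * s' * u$3 - s * u$4) * (c * c' * v$2 + c * s' * v$3 - s * v$4)
    + (- s' * u$2 + c' * u$3) * (- s' * v$2 + c' * v$3)
    = u$2 * v$2 + u$3 * v$3 + u$4 * v$4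
      - (s * c' * u$2 + s * s' * u$3 + c * u$4) * (s * c' * v$2 + s * s' * v$3 + c * v$4)"
    using 1 by algebra
  then show ?thesis unfolding th ph n d(5)[symmetric]
    by (simp add: vec4_simps add_divide_distrib[symmetric] power2_eq_square)
qed

lemma d_phs_eq:
  assumes "rad p > 0"
  shows "sinth p * (d_phs p \<bullet> u) = rot (radial p) \<bullet> u / rad p"
proof -
  have "sinth p *\<^sub>R d_phs p = (1 / (rad p)\<^sup>2) *\<^sub>R v_ph p"
    by (simp add: d_phs_def v_ph_def)
  also have "\<dots> = (1 / rad p) *\<^sub>R rot (radial p)"
    unfolding v_ph_eq[OF assms] by (simp add: vec4_simps radial_def power2_eq_square)
  finally have "(sinth p *\<^sub>R d_phs p) \<bullet> u = ((1 / rad p) *\<^sub>R rot (radial p)) \<bullet> u" by simp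
  then show ?thesis by simp
qed

text \<open>
  The metric in terms of \<open>dr\<close>, the contact form, \<open>sin\<^sup>2\<theta> d\<phi>\<close> and the round metric.  The first two
  vanish on horizontal vectors, which leaves \<open>\<Sigma>\<close> times the round metric there.
\<close>

lemma kerr_g_eq:
  assumes "rad p > 0" "\<bar>a\<bar> \<le> M"
  defines "\<psi> \<equiv> \<lambda>u. rot (radial p) \<bullet> u / rad p"
  shows "kerr_g M a p u v = contact_form a p u * (radial p \<bullet> v) + contact_form a p v * (radial p \<bullet> u)
    + (a\<^sup>2 * (1 - (radial p $ 4)\<^sup>2) - Delta M a p) / Sigma_K a p * (contact_form a p u * contact_form a p v)
    + Sigma_K a p * ((spatial u \<bullet> spatial v - (radial p \<bullet> u) * (radial p \<bullet> v)) / (rad p)\<^sup>2)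
    - a * (contact_form a p u * \<psi> v + contact_form a p v * \<psi> u)"
proof -
  define s c R S D where "s = sinth p" "c = costh p" "R = rad p" "S = Sigma_K a p" "D = Delta M a p"
  note d = this
  have R: "R > 0" using assms d by simp
  have sc: "s\<^sup>2 = 1 - c\<^sup>2" using trig_identities[OF assms(1)] by (simp add: d)
  have S: "S = R\<^sup>2 + a\<^sup>2 * c\<^sup>2" by (simp add: d Sigma_K_def)
  have S0: "inverse S * S = 1" using Sigma_pos[OF assms(1), of a] by (simp add: d)
  have D: "D = R\<^sup>2 - 2 * M * R + a\<^sup>2" by (simp add: d Delta_def Delta_expand[OF assms(2)])
  define L N T P where "L = contact_form a p" "N u = radial p \<bullet> u" "T u = d_th p \<bullet> u" "P u = d_phs p \<bullet> u" for u
  note e = this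
  have psi: "\<psi> u = s * P u" for u
    unfolding \<psi>_def d e using d_phs_eq[OF assms(1)] by simp
  have t: "d_t p \<bullet> u = L u + a * s * P u" for u
    using psi[of u]
    by (simp only: e contact_form_def \<psi>_def d_t_def v_t_eq inner_axis' mult.assoc[of a s] flip: times_divide_eq_right) simp
  have I: "x / S = x * inverse S" for x by (simp add: divide_inverse)
  have N: "d_r p \<bullet> u = N u" for u by (simp add: d_r_def v_r_eq e)
  have H: "(spatial u \<bullet> spatial v - N u * N v) / R\<^sup>2 = T u * T v + P u * P v"
    using sphere_metric[OF assms(1), of u v] by (simp add: e d)
  show ?thesis
    unfolding H kerr_g_def sym_prod_def t psi
      d[symmetric] e(3,4)[symmetric] e(1)[symmetric] N e(2)[symmetric] costh_eq[symmetric] I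
    unfolding D using sc S0 S by algebra
qed

lemma kerr_g_e3:
  assumes "rad p > 0" "\<bar>a\<bar> \<le> M"
  shows "kerr_g M a p (e3 p) v = - contact_form a p v"
proof -
  have n: "radial p \<bullet> radial p = 1" "rot (radial p) \<bullet> radial p = 0" "spatial (radial p) = radial p"
    using radial_sum_squares[OF assms(1)] by (simp_all add: vec4_simps power2_eq_square)
  have "radial p \<bullet> spatial v = radial p \<bullet> v" by (simp add: vec4_simps)
  moreover have "contact_form a p (radial p) = 0" by (simp add: contact_form_def n)
  ultimately have "kerr_g M a p (radial p) v = contact_form a p v"
    unfolding kerr_g_eq[OF assms] by (simp add: n)
  then show ?thesis by (simp add: e3_eq kerr_g_bilinear)
qed

lemma kerr_g_e4:
  assumes "rad p > 0" "\<bar>a\<bar> \<le> M"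
  shows "kerr_g M a p (e4 M a p) v = 2 * (radial p \<bullet> v) - Delta M a p / Sigma_K a p * contact_form a p v"
proof -
  define K where "K = (2 * ((rad p)\<^sup>2 + a\<^sup>2)) *\<^sub>R axis 1 1 + Delta M a p *\<^sub>R radial p + (2 * a) *\<^sub>R rot p"
  define R n2 n3 n4 where "R = rad p" "n2 = radial p $ 2" "n3 = radial p $ 3" "n4 = radial p $ 4"
  note d = this
  have n: "n2\<^sup>2 + n3\<^sup>2 + n4\<^sup>2 = 1" using radial_sum_squares[OF assms(1)] by (simp add: d)
  have q: "p $ 2 = R * n2" "p $ 3 = R * n3" "p $ 4 = R * n4"
    using assms by (simp_all add: d radial_def)
  have R: "R \<noteq> 0" using assms d by simp
  have S: "Sigma_K a p = R\<^sup>2 + a\<^sup>2 * n4\<^sup>2" by (simp add: Sigma_eq d)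
  have S0: "Sigma_K a p \<noteq> 0" using Sigma_pos[OF assms(1), of a] by simp
  have "rot (radial p) \<bullet> K / R = 2 * a * (1 - n4\<^sup>2)"
  proof -
    have "rot (radial p) \<bullet> K = R * (2 * a * (n2\<^sup>2 + n3\<^sup>2))"
      by (simp add: K_def vec4_simps d[symmetric] q algebra_simps power2_eq_square)
    then have "rot (radial p) \<bullet> K / R = 2 * a * (n2\<^sup>2 + n3\<^sup>2)" using R by simp
    also have "n2\<^sup>2 + n3\<^sup>2 = 1 - n4\<^sup>2" using n by simp
    finally show ?thesis .
  qed
  note psi = this
  have NK: "radial p \<bullet> K = Delta M a p"
  proof -
    have "radial p \<bullet> K = Delta M a p * (n2\<^sup>2 + n3\<^sup>2 + n4\<^sup>2)"
      by (simp add: K_def vec4_simps d[symmetric] q algebra_simps power2_eq_square)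
    then show ?thesis using n by simp
  qed
  have L: "contact_form a p K = 2 * Sigma_K a p"
  proof -
    have "contact_form a p K = 2 * (R\<^sup>2 + a\<^sup>2) - a * (rot (radial p) \<bullet> K / R)"
      by (simp add: contact_form_def d[symmetric]) (simp add: K_def d[symmetric])
    then show ?thesis unfolding psi S by (simp add: algebra_simps power2_eq_square)
  qed
  have h: "(spatial K \<bullet> spatial v - (radial p \<bullet> K) * (radial p \<bullet> v)) / R\<^sup>2 = 2 * a * (rot (radial p) \<bullet> v / R)"
  proof -
    have "spatial K \<bullet> spatial v - (radial p \<bullet> K) * (radial p \<bullet> v) = 2 * a * R * (rot (radial p) \<bullet> v)"
      unfolding NK by (simp add: K_def vec4_simps d[symmetric] q algebra_simps)
    then show ?thesis using R by (simp add: power2_eq_square)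
  qed
  have "kerr_g M a p K v = 2 * Sigma_K a p * (radial p \<bullet> v) - Delta M a p * contact_form a p v"
    unfolding kerr_g_eq[OF assms] d(1)[symmetric] h[unfolded NK] psi NK L d(4)[symmetric]
    using S0 by (simp add: field_simps power2_eq_square)
  then show ?thesis
    using S0 unfolding e4_eq[OF assms(1)] K_def[symmetric] kerr_g_bilinear by (simp add: field_simps)
qed

lemma contact_form_hlift: "contact_form a p (hlift a p w) = 0" if "rad p > 0"
proof -
  have "rot (radial p) \<bullet> hlift a p w = rad p * (rot (radial p) \<bullet> w)"
    by (simp add: hlift_def vec4_simps algebra_simps)
  then show ?thesis using that by (simp add: contact_form_def hlift_def)
qed

lemma radial_hlift: "radial p \<bullet> hlift a p w = 0" if "rad p > 0"
proof -
  have "radial p \<bullet> hlift a p w = rad p * (radial p \<bullet> w) * (1 - ((radial p $ 2)\<^sup>2 + (radial p $ 3)\<^sup>2 + (radial p $ 4)\<^sup>2))"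
    by (simp add: hlift_def vec4_simps algebra_simps power2_eq_square)
  then show ?thesis using radial_sum_squares[OF that] by simp
qed

lemma spatial_hlift: "spatial (hlift a p w) = rad p *\<^sub>R (spatial w - (radial p \<bullet> w) *\<^sub>R radial p)"
  by (simp add: hlift_def vec4_simps)

lemma hlift_spatial:
  assumes "rad p > 0" "contact_form a p u = 0" "radial p \<bullet> u = 0"
  shows "hlift a p ((1 / rad p) *\<^sub>R u) = u"
proof -
  have t: "u $ 1 = a * (rot (radial p) \<bullet> u) / rad p" using assms(2) by (simp add: contact_form_def)
  have "hlift a p ((1 / rad p) *\<^sub>R u) = (a * (rot (radial p) \<bullet> u) / rad p) *\<^sub>R axis 1 1
    + rad p *\<^sub>R (spatial ((1 / rad p) *\<^sub>R u))"
    by (simp add: hlift_def assms(3))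
  also have "\<dots> = u"
    unfolding t[symmetric] using assms(1) by (simp add: vec_eq_iff forall_4)
  finally show ?thesis .
qed

lemma kerr_g_hlift:
  assumes "rad p > 0" "\<bar>a\<bar> \<le> M"
  shows "kerr_g M a p (hlift a p w) (hlift a p w') =
    Sigma_K a p * (spatial w \<bullet> spatial w' - (radial p \<bullet> w) * (radial p \<bullet> w'))"
proof -
  have n: "radial p \<bullet> radial p = 1" 
    using radial_sum_squares[OF assms(1)] by (simp_all add: vec4_simps power2_eq_square)
  have s: "radial p \<bullet> spatial v = radial p \<bullet> v" "spatial v \<bullet> radial p = radial p \<bullet> v" for v
    by (simp_all add: vec4_simps mult.commute)
  show ?thesis
    unfolding kerr_g_eq[OF assms] contact_form_hlift[OF assms(1)] radial_hlift[OF assms(1)] spatial_hlift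
    using assms(1) by (simp add: inner_simps n s power2_eq_square)
qed

lemma kerr_g_hlift_null:
  assumes "rad p > 0" "\<bar>a\<bar> \<le> M"
  shows "kerr_g M a p (e3 p) (hlift a p w) = 0" "kerr_g M a p (e4 M a p) (hlift a p w) = 0"
    "kerr_g M a p (hlift a p w) (e3 p) = 0" "kerr_g M a p (hlift a p w) (e4 M a p) = 0"
  using kerr_g_e3[OF assms] kerr_g_e4[OF assms] contact_form_hlift[OF assms(1)] radial_hlift[OF assms(1)]
  by (simp_all add: kerr_g_sym[of M a p "hlift a p w"])

text \<open>
  On such vectors the metric is \<open>\<Sigma>\<close> times the round metric of the angular part, hence definite.
\<close>

lemma horizontal_eq_0:
  assumes "rad p > 0" "\<bar>a\<bar> \<le> M" "kerr_g M a p u (e3 p) = 0" "kerr_g M a p u (e4 M a p) = 0" "kerr_g M a p u u = 0"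
  shows "u = 0"
proof -
  have l: "contact_form a p u = 0" using assms(3) kerr_g_e3[OF assms(1,2)] by (simp add: kerr_g_sym[of M a p u])
  then have n: "radial p \<bullet> u = 0" using assms(4) kerr_g_e4[OF assms(1,2)] by (simp add: kerr_g_sym[of M a p u])
  have "Sigma_K a p * ((spatial u \<bullet> spatial u) / (rad p)\<^sup>2) = 0"
    using assms(5) unfolding kerr_g_eq[OF assms(1,2)] l n by simp
  then have s: "spatial u = 0" using Sigma_pos[OF assms(1), of a] assms(1) by simp
  then have "u $ 2 = 0" "u $ 3 = 0" "u $ 4 = 0" by (simp_all add: vec4_simps)
  with l show ?thesis by (simp add: contact_form_def vec4_simps)
qed

lemma kerr_g_nondegenerate:
  assumes "rad p > 0" "\<bar>a\<bar> \<le> M" "\<And>v. kerr_g M a p u v = 0"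
  shows "u = 0"
  using horizontal_eq_0[OF assms(1,2)] assms(3) by simp

text \<open>
  Every horizontal vector is a lift, so that one-forms may be tested on lifts.
\<close>

lemma hproj_hlift:
  assumes "rad p > 0" "\<bar>a\<bar> \<le> M"
  shows "hproj M a p v = hlift a p ((1 / rad p) *\<^sub>R hproj M a p v)"
proof -
  note o = hproj_orthogonal(1,2)[OF assms, of v]
  have l: "contact_form a p (hproj M a p v) = 0" using o(1) kerr_g_e3[OF assms] by (simp add: kerr_g_sym[of M a p "hproj M a p v"])
  then have "radial p \<bullet> hproj M a p v = 0" using o(2) kerr_g_e4[OF assms] by (simp add: kerr_g_sym[of M a p "hproj M a p v"])
  then show ?thesis using hlift_spatial[OF assms(1) l] by simp
qed

lemma hproj_of_hlift:
  assumes "rad p > 0" "\<bar>a\<bar> \<le> M"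
  shows "hproj M a p (hlift a p w) = hlift a p w"
  using kerr_g_hlift_null[OF assms] by (simp add: hproj_def)

lemma hproj_null:
  assumes "rad p > 0" "\<bar>a\<bar> \<le> M"
  shows "hproj M a p (e3 p) = 0" "hproj M a p (e4 M a p) = 0"
  using frame_relations[OF assms] kerr_g_sym[of M a p "e4 M a p" "e3 p"] by (simp_all add: hproj_def)

lemma hlift_add: "hlift a p (v + w) = hlift a p v + hlift a p w"
  and hlift_scaleR: "hlift a p (k *\<^sub>R w) = k *\<^sub>R hlift a p w"
  by (simp_all add: hlift_def vec4_simps algebra_simps)

lemma linear_hlift: "linear (hlift a p)"
  by (rule linearI) (simp_all add: hlift_add hlift_scaleR)

text \<open>
  Turning the lift of \<open>w\<close> by a right angle in the oriented plane \<open>(e1, e2)\<close> is the cross product of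
  the radial direction with \<open>w\<close>.  The proof uses the meridian and azimuthal unit vectors, with
  respect to which \<open>e1\<close>, \<open>e2\<close> are the lifts of an orthogonal basis turned by the argument of
  \<open>r + i a cos \<theta>\<close>.
\<close>

lemma hlift_cross:
  assumes "rad p > 0" "\<bar>a\<bar> \<le> M"
  shows "kerr_g M a p (hlift a p w) (e1 a p) *\<^sub>R e2 a p - kerr_g M a p (hlift a p w) (e2 a p) *\<^sub>R e1 a p
    = hlift a p (cross (radial p) w)"
    and e1_hlift: "hproj M a p (e1 a p) = e1 a p" and e2_hlift: "hproj M a p (e2 a p) = e2 a p"
proof -
  define s c s' c' R S where "s = sinth p" "c = costh p" "s' = sinph p" "c' = cosph p" "R = rad p" "S = Sigma_K a p"
  note d = this
  define th ph :: pt where "th = vector [0, c * c', c * s', - s]" "ph = vector [0, - s', c', 0]"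
  note tp = this
  have 1: "s\<^sup>2 + c\<^sup>2 = 1" "s'\<^sup>2 + c'\<^sup>2 = 1" and R: "R \<noteq> 0" and S: "S = R\<^sup>2 + a\<^sup>2 * c\<^sup>2" "S \<noteq> 0"
    using trig_identities[OF assms(1)] assms(1) Sigma_pos[OF assms(1), of a] by (auto simp: d Sigma_K_def)
  have n: "radial p $ 2 = s * c'" "radial p $ 3 = s * s'" "radial p $ 4 = c"
    by (simp_all add: v_r_eq[symmetric] v_r_def d)
  have th0: "radial p \<bullet> th = 0" "radial p \<bullet> ph = 0" and tp1: "th \<bullet> th = 1" "ph \<bullet> ph = 1" "th \<bullet> ph = 0"
    and rt: "rot (radial p) \<bullet> th = 0" "rot (radial p) \<bullet> ph = s"
    unfolding vec4_simps rot_nth by (simp_all add: tp n) (use 1 in algebra)+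
  have sp: "spatial th = th" "spatial ph = ph" by (simp_all add: vec4_simps tp)
  have hth: "hlift a p th = v_th p" and hph: "hlift a p ph = v_phs p + (a * s) *\<^sub>R v_t p"
    unfolding hlift_def th0 rt sp
    by (simp_all add: vec4_simps tp v_th_def v_phs_def v_t_eq d)
  have e1: "e1 a p = hlift a p ((1 / S) *\<^sub>R (R *\<^sub>R th + (a * c) *\<^sub>R ph))"
    unfolding hlift_add hlift_scaleR hth hph
    by (simp add: e1_def d algebra_simps scaleR_add_right power2_eq_square)
  have e2: "e2 a p = hlift a p ((1 / S) *\<^sub>R (R *\<^sub>R ph - (a * c) *\<^sub>R th))"
    unfolding linear_diff[OF linear_hlift] hlift_scaleR hth hph
    by (simp add: e2_def d algebra_simps scaleR_add_right power2_eq_square)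
  show "hproj M a p (e1 a p) = e1 a p" "hproj M a p (e2 a p) = e2 a p"
    unfolding e1 e2 by (rule hproj_of_hlift[OF assms])+
  have sw: "spatial w \<bullet> v = w \<bullet> spatial v" for v by (simp add: vec4_simps)
  have spl: "spatial ((1 / S) *\<^sub>R (x *\<^sub>R ph - y *\<^sub>R th)) = (1 / S) *\<^sub>R (x *\<^sub>R ph - y *\<^sub>R th)"
    "spatial ((1 / S) *\<^sub>R (x *\<^sub>R th + y *\<^sub>R ph)) = (1 / S) *\<^sub>R (x *\<^sub>R th + y *\<^sub>R ph)" for x y
    by (simp_all add: vec4_simps tp)
  have g: "kerr_g M a p (hlift a p w) (e1 a p) = R * (w \<bullet> th) + a * c * (w \<bullet> ph)"
    "kerr_g M a p (hlift a p w) (e2 a p) = R * (w \<bullet> ph) - a * c * (w \<bullet> th)"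
    unfolding e1 e2 kerr_g_hlift[OF assms] sw spl
    using S(2) by (simp_all add: inner_simps th0 d(6)[symmetric])
  have cr: "cross (radial p) w = (w \<bullet> th) *\<^sub>R ph - (w \<bullet> ph) *\<^sub>R th"
  proof -
    have w: "w \<bullet> th = w $ 2 * (c * c') + w $ 3 * (c * s') - w $ 4 * s" "w \<bullet> ph = w $ 3 * c' - w $ 2 * s'"
      by (simp_all add: tp vec4_simps)
    have t: "th $ 1 = 0" "th $ 2 = c * c'" "th $ 3 = c * s'" "th $ 4 = - s"
      "ph $ 1 = 0" "ph $ 2 = - s'" "ph $ 3 = c'" "ph $ 4 = 0" by (simp_all add: tp)
    show ?thesis
      unfolding vec_eq_iff forall_4 cross_nth n vector_minus_component vector_scaleR_component w t
        real_scaleR_def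
    using 1(2) by (intro conjI; (simp add: algebra_simps; fail | algebra))
  qed
  have "hlift a p ((w \<bullet> th) *\<^sub>R ph - (w \<bullet> ph) *\<^sub>R th) =
    hlift a p ((R * (w \<bullet> th) + a * c * (w \<bullet> ph)) *\<^sub>R ((1 / S) *\<^sub>R (R *\<^sub>R ph - (a * c) *\<^sub>R th))
      - (R * (w \<bullet> ph) - a * c * (w \<bullet> th)) *\<^sub>R ((1 / S) *\<^sub>R (R *\<^sub>R th + (a * c) *\<^sub>R ph)))"
  proof (rule arg_cong[where f = "hlift a p"])
    define x y where "x = w \<bullet> th" "y = w \<bullet> ph"
    have "S *\<^sub>R ((x) *\<^sub>R ph - (y) *\<^sub>R th) = (R * (x) + a * c * (y)) *\<^sub>R ((R *\<^sub>R ph - (a * c) *\<^sub>R th))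
      - (R * (y) - a * c * (x)) *\<^sub>R ((R *\<^sub>R th + (a * c) *\<^sub>R ph))"
      unfolding S(1) by (simp add: algebra_simps power2_eq_square)
    then have "(1/S) *\<^sub>R (S *\<^sub>R (x *\<^sub>R ph - y *\<^sub>R th)) = (1/S) *\<^sub>R ((R * x + a * c * y) *\<^sub>R (R *\<^sub>R ph - (a * c) *\<^sub>R th)
      - (R * y - a * c * x) *\<^sub>R (R *\<^sub>R th + (a * c) *\<^sub>R ph))" by simp
    then show "(w \<bullet> th) *\<^sub>R ph - (w \<bullet> ph) *\<^sub>R th =
    (R * (w \<bullet> th) + a * c * (w \<bullet> ph)) *\<^sub>R ((1 / S) *\<^sub>R (R *\<^sub>R ph - (a * c) *\<^sub>R th))
      - (R * (w \<bullet> ph) - a * c * (w \<bullet> th)) *\<^sub>R ((1 / S) *\<^sub>R (R *\<^sub>R th + (a * c) *\<^sub>R ph))"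
      using S(2) unfolding x_y_def[symmetric] by (simp add: scaleR_diff_right mult.commute)
  qed
  then show "kerr_g M a p (hlift a p w) (e1 a p) *\<^sub>R e2 a p - kerr_g M a p (hlift a p w) (e2 a p) *\<^sub>R e1 a p
    = hlift a p (cross (radial p) w)"
    unfolding g cr by (simp add: e1 e2 linear_diff[OF linear_hlift] hlift_scaleR)
qed

section \<open>Derivatives and brackets of the chart fields\<close>

text \<open>
  The derivative of the radial direction at \<open>p\<close> along \<open>u\<close>.
\<close>

definition dradial :: "pt \<Rightarrow> pt \<Rightarrow> pt"
  where "dradial p u = (1 / rad p) *\<^sub>R (spatial u - (radial p \<bullet> u) *\<^sub>R radial p)"

text \<open>
  The derivative of \<open>hlift a p w\<close> in \<open>p\<close> along \<open>u\<close>, for constant \<open>w\<close>.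
\<close>

definition dhlift :: "real \<Rightarrow> pt \<Rightarrow> pt \<Rightarrow> pt \<Rightarrow> pt"
  where "dhlift a p u w = (a * (rot (dradial p u) \<bullet> w)) *\<^sub>R axis 1 1
    + (radial p \<bullet> u) *\<^sub>R (spatial w - (radial p \<bullet> w) *\<^sub>R radial p)
    - rad p *\<^sub>R ((dradial p u \<bullet> w) *\<^sub>R radial p + (radial p \<bullet> w) *\<^sub>R dradial p u)"

lemma spatial_minus: "spatial (- u) = - spatial u"
  by (simp add: vec4_simps)

lemma rad_has_derivative:
  assumes "rad p > 0"
  shows "(rad has_derivative (\<lambda>u. radial p \<bullet> u)) (at p within T)"
proof -
  have p: "spatial p \<bullet> spatial p > 0" using assms by (simp add: rad_eq)
  note s = bounded_linear_imp_has_derivative[OF bounded_linear_spatial, of "at p within T"]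
  note D = has_derivative_real_sqrt[OF p has_derivative_inner[OF s s]]
  have i: "spatial p \<bullet> spatial u = spatial p \<bullet> u" for u
    by (simp add: vec4_simps)
  have "(spatial p \<bullet> spatial u + spatial u \<bullet> spatial p) * (inverse (sqrt (spatial p \<bullet> spatial p)) / 2) = radial p \<bullet> u" for u
    unfolding inner_commute[of "spatial u"] rad_eq[symmetric]
    unfolding i by (simp add: radial_def inverse_eq_divide)
  then have "((\<lambda>q. sqrt (spatial q \<bullet> spatial q)) has_derivative (\<lambda>u. radial p \<bullet> u)) (at p within T)"
    by (intro has_derivative_eq_rhs[OF D]) (simp add: fun_eq_iff)
  then show ?thesis by (simp only: rad_eq[abs_def])
qed

lemma radial_has_derivative:
  assumes "rad p > 0"
  shows "(radial has_derivative dradial p) (at p within T)"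
proof -
  note s = bounded_linear_imp_has_derivative[OF bounded_linear_spatial, of "at p within T"]
  have "((\<lambda>q. (1 / rad q) *\<^sub>R spatial q) has_derivative dradial p) (at p within T)"
    using assms
    by (auto intro!: derivative_eq_intros s rad_has_derivative simp: fun_eq_iff dradial_def spatial_eq_radial
        algebra_simps)
  then show ?thesis by (simp add: radial_def[abs_def])
qed

lemma hlift_has_derivative:
  assumes "rad p > 0" "(W has_derivative W') (at p within T)"
  shows "((\<lambda>q. hlift a q (W q)) has_derivative (\<lambda>u. dhlift a p u (W p) + hlift a p (W' u))) (at p within T)"
proof -
  note s = bounded_linear.has_derivative[OF bounded_linear_spatial assms(2)]
  note r = bounded_linear.has_derivative[OF bounded_linear_rot radial_has_derivative[OF assms(1), of T]]
  show ?thesis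
    unfolding hlift_def
    apply (rule has_derivative_eq_rhs)
     apply (rule derivative_intros s r rad_has_derivative assms radial_has_derivative)+
    apply (simp add: fun_eq_iff dhlift_def algebra_simps inner_commute)
    done
qed

lemma Sigma_has_derivative:
  assumes "rad p > 0"
  shows "(Sigma_K a has_derivative (\<lambda>u. 2 * rad p * (radial p \<bullet> u) + 2 * a\<^sup>2 * radial p $ 4 * dradial p u $ 4)) (at p within T)"
  unfolding Sigma_eq[abs_def]
  apply (rule has_derivative_eq_rhs)
   apply (rule derivative_intros rad_has_derivative radial_has_derivative bounded_linear.has_derivative[OF bounded_linear_vec_nth] assms)+
  apply (simp add: fun_eq_iff)
  done

lemma Delta_has_derivative:
  assumes "rad p > 0" "\<bar>a\<bar> \<le> M"
  shows "(Delta M a has_derivative (\<lambda>u. (2 * rad p - 2 * M) * (radial p \<bullet> u))) (at p within T)"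
  unfolding Delta_def[abs_def] Delta_expand[OF assms(2)]
  apply (rule has_derivative_eq_rhs)
   apply (rule derivative_intros rad_has_derivative assms)+
  apply (simp add: fun_eq_iff algebra_simps)
  done

lemma e3_has_derivative:
  assumes "rad p > 0"
  shows "(e3 has_derivative (\<lambda>u. - dradial p u)) (at p within T)"
  unfolding e3_eq[abs_def] by (intro derivative_intros radial_has_derivative assms)

lemma rad_pos_nhds:
  assumes "rad p > 0"
  shows "\<forall>\<^sub>F q in at p within T. rad q > 0"
proof -
  have "continuous (at p within T) rad"
    using rad_has_derivative[OF assms] by (rule has_derivative_continuous)
  then show ?thesis using assms unfolding continuous_within by (rule order_tendstoD)
qed

lemma e4_has_derivative:
  assumes "rad p > 0" "\<bar>a\<bar> \<le> M" "p \<in> T"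
  shows "(e4 M a has_derivative (\<lambda>u. (1 / Sigma_K a p) *\<^sub>R ((4 * rad p * (radial p \<bullet> u)) *\<^sub>R axis 1 1
      + ((2 * rad p - 2 * M) * (radial p \<bullet> u)) *\<^sub>R radial p + Delta M a p *\<^sub>R dradial p u + (2 * a) *\<^sub>R rot u)
    - ((2 * rad p * (radial p \<bullet> u) + 2 * a\<^sup>2 * radial p $ 4 * dradial p u $ 4) / Sigma_K a p) *\<^sub>R e4 M a p)) (at p within T)"
proof -
  have S: "Sigma_K a p \<noteq> 0" using Sigma_pos[OF assms(1), of a] by simp
  have "((\<lambda>q. (1 / Sigma_K a q) *\<^sub>R ((2 * ((rad q)\<^sup>2 + a\<^sup>2)) *\<^sub>R axis 1 1 + Delta M a q *\<^sub>R radial q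
    + (2 * a) *\<^sub>R rot q)) has_derivative (\<lambda>u. (1 / Sigma_K a p) *\<^sub>R ((4 * rad p * (radial p \<bullet> u)) *\<^sub>R axis 1 1
      + ((2 * rad p - 2 * M) * (radial p \<bullet> u)) *\<^sub>R radial p + Delta M a p *\<^sub>R dradial p u + (2 * a) *\<^sub>R rot u)
    - ((2 * rad p * (radial p \<bullet> u) + 2 * a\<^sup>2 * radial p $ 4 * dradial p u $ 4) / Sigma_K a p) *\<^sub>R e4 M a p)) (at p within T)"
    apply (rule has_derivative_eq_rhs)
     apply (rule derivative_intros rad_has_derivative radial_has_derivative Sigma_has_derivative
        Delta_has_derivative bounded_linear.has_derivative[OF bounded_linear_rot] assms S)+
    unfolding e4_eq[OF assms(1)]
    apply (simp add: fun_eq_iff scaleR_add_right scaleR_add_left algebra_simps divide_inverse power2_eq_square)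
    done
  then show ?thesis
    by (rule has_derivative_transform_eventually)
      (use assms in \<open>auto simp: e4_eq intro: eventually_mono[OF rad_pos_nhds]\<close>)
qed

lemma dradial_hlift:
  assumes "rad p > 0"
  shows "dradial p (hlift a p w) = spatial w - (radial p \<bullet> w) *\<^sub>R radial p"
  using assms by (simp add: dradial_def spatial_hlift radial_hlift)

lemma radial_unit:
  assumes "rad p > 0"
  shows "radial p \<bullet> radial p = 1" "rot (radial p) \<bullet> radial p = 0" "radial p \<bullet> rot (radial p) = 0"
    "spatial (radial p) = radial p" "spatial (rot v) = rot v" "rot (spatial v) = rot v"
  using radial_sum_squares[OF assms] by (simp_all add: vec4_simps power2_eq_square)

text \<open>
  The bracket of a lift with \<open>e3\<close> vanishes, since in horizon-regular coordinates \<open>e3\<close> is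
  \<open>- \<partial>\<^sub>r\<close> and the lifts have components independent of \<open>r\<close>.
\<close>

lemma bracket_e3:
  assumes "rad p > 0"
  shows "- dradial p (hlift a p w) = dhlift a p (e3 p) w"
proof -
  have "dradial p (- radial p) = 0"
    using assms by (simp add: dradial_def radial_unit spatial_minus)
  moreover have "rot 0 = 0" by (simp add: vec4_simps)
  ultimately show ?thesis
    using assms by (simp add: dradial_hlift dhlift_def e3_eq radial_unit)
qed

lemma e4_radial:
  assumes "rad p > 0"
  shows "radial p \<bullet> e4 M a p = Delta M a p / Sigma_K a p"
    and "dradial p (e4 M a p) = (2 * a / Sigma_K a p) *\<^sub>R rot (radial p)"
proof -
  have rp: "rot p = rad p *\<^sub>R rot (radial p)" using assms by (simp add: vec4_simps radial_def)
  show 1: "radial p \<bullet> e4 M a p = Delta M a p / Sigma_K a p"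
    unfolding e4_eq[OF assms] rp by (simp add: inner_simps radial_unit[OF assms] inner_axis)
  have "spatial (e4 M a p) = (Delta M a p / Sigma_K a p) *\<^sub>R radial p + (2 * a * rad p / Sigma_K a p) *\<^sub>R rot (radial p)"
    unfolding e4_eq[OF assms] rp by (simp add: vec4_simps add_divide_distrib diff_divide_distrib)
  then show "dradial p (e4 M a p) = (2 * a / Sigma_K a p) *\<^sub>R rot (radial p)"
    unfolding dradial_def 1 using assms by simp
qed

text \<open>
  The left-hand side is the bracket of the lift of \<open>w\<close> with \<open>e4\<close>, the derivative of \<open>e4\<close> being
  written out.  The field \<open>\<Sigma> e4\<close> is a combination of \<open>\<partial>\<^sub>t\<close>, \<open>\<partial>\<^sub>r\<close>, \<open>\<partial>\<^sub>\<phi>\<close> with coefficients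
  depending on \<open>r\<close> only.  Lifts do not differentiate \<open>r\<close>, and of the three coordinate fields only
  \<open>\<partial>\<^sub>\<phi>\<close> moves a lift: it rotates \<open>w\<close>.  The last term differentiates the factor \<open>1 / \<Sigma>\<close>.
\<close>

lemma bracket_e4:
  assumes "rad p > 0"
  shows "(1 / Sigma_K a p) *\<^sub>R ((4 * rad p * (radial p \<bullet> hlift a p w)) *\<^sub>R axis 1 1
      + ((2 * rad p - 2 * M) * (radial p \<bullet> hlift a p w)) *\<^sub>R radial p + Delta M a p *\<^sub>R dradial p (hlift a p w) + (2 * a) *\<^sub>R rot (hlift a p w))
    - ((2 * rad p * (radial p \<bullet> hlift a p w) + 2 * a\<^sup>2 * radial p $ 4 * dradial p (hlift a p w) $ 4) / Sigma_K a p) *\<^sub>R e4 M a p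
    - dhlift a p (e4 M a p) w
    = (2 * a / Sigma_K a p) *\<^sub>R hlift a p (rot w)
      - (2 * a\<^sup>2 * radial p $ 4 * (w $ 4 - (radial p \<bullet> w) * radial p $ 4) / Sigma_K a p) *\<^sub>R e4 M a p"
proof -
  define S where "S = Sigma_K a p"
  have S: "S \<noteq> 0" using Sigma_pos[OF assms(1), of a] by (simp add: S_def)
  have dh: "S *\<^sub>R dhlift a p (e4 M a p) w = Delta M a p *\<^sub>R (spatial w - (radial p \<bullet> w) *\<^sub>R radial p)
     + (2 * a) *\<^sub>R ((a * (rot (rot (radial p)) \<bullet> w)) *\<^sub>R axis 1 1
        - rad p *\<^sub>R ((rot (radial p) \<bullet> w) *\<^sub>R radial p + (radial p \<bullet> w) *\<^sub>R rot (radial p)))"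
    using S unfolding dhlift_def e4_radial[OF assms] S_def[symmetric]
    by (simp add: vec4_simps algebra_simps)
  have "(2 * a) *\<^sub>R rot (hlift a p w) - (2 * a) *\<^sub>R ((a * (rot (rot (radial p)) \<bullet> w)) *\<^sub>R axis 1 1
        - rad p *\<^sub>R ((rot (radial p) \<bullet> w) *\<^sub>R radial p + (radial p \<bullet> w) *\<^sub>R rot (radial p)))
     = (2 * a) *\<^sub>R hlift a p (rot w)"
    by (simp add: hlift_def vec4_simps) (simp add: algebra_simps)
  then have "(1 / S) *\<^sub>R (S *\<^sub>R ((1 / S) *\<^sub>R (Delta M a p *\<^sub>R dradial p (hlift a p w) + (2 * a) *\<^sub>R rot (hlift a p w))
     - dhlift a p (e4 M a p) w)) = (1 / S) *\<^sub>R ((2 * a) *\<^sub>R hlift a p (rot w))"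
    unfolding scaleR_diff_right[of S] dh using S by (simp add: dradial_hlift[OF assms] algebra_simps)
  then have "(1 / S) *\<^sub>R (Delta M a p *\<^sub>R dradial p (hlift a p w) + (2 * a) *\<^sub>R rot (hlift a p w))
     - dhlift a p (e4 M a p) w = (2 * a / S) *\<^sub>R hlift a p (rot w)"
    using S by simp
  then show ?thesis unfolding S_def[symmetric]
    by (simp add: radial_hlift[OF assms] dradial_hlift[OF assms] algebra_simps)
qed

text \<open>
  The horizontal distribution is not integrable: up to sign this is the exterior derivative of the
  contact form on two lifts, and the source of the twists \<open>(\<epsilon> \<cdot> \<chi>)\<close>.
\<close>

lemma contact_form_bracket_hlift:
  assumes "rad p > 0"
  shows "contact_form a p (dhlift a p (hlift a p w) w' - dhlift a p (hlift a p w') w) = 2 * a * radial p $ 4 * (cross (radial p) w \<bullet> w')"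
proof -
  define n2 n3 n4 where "n2 = radial p $ 2" "n3 = radial p $ 3" "n4 = radial p $ 4"
  note d = this
  have n: "n2\<^sup>2 + n3\<^sup>2 + n4\<^sup>2 = 1" using radial_sum_squares[OF assms(1)] by (simp add: d)
  have *: "contact_form a p (dhlift a p (hlift a p w) w') = a * (rot (spatial w - (radial p \<bullet> w) *\<^sub>R radial p) \<bullet> w')
    + a * (radial p \<bullet> w') * (rot (radial p) \<bullet> w)" for w w'
  proof -
    have "rot (radial p) \<bullet> dhlift a p (hlift a p w) w' = - rad p * (radial p \<bullet> w') * (rot (radial p) \<bullet> w)"
      unfolding dhlift_def radial_hlift[OF assms] dradial_hlift[OF assms]
      by (simp add: inner_simps radial_unit[OF assms]) (simp add: vec4_simps)
    then have "contact_form a p (dhlift a p (hlift a p w) w') = dhlift a p (hlift a p w) w' $ 1 + a * (radial p \<bullet> w') * (rot (radial p) \<bullet> w)"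
      using assms by (simp add: contact_form_def)
    also have "dhlift a p (hlift a p w) w' $ 1 = a * (rot (spatial w - (radial p \<bullet> w) *\<^sub>R radial p) \<bullet> w')"
      unfolding dhlift_def radial_hlift[OF assms] dradial_hlift[OF assms] by simp
    finally show ?thesis .
  qed
  have contact_form_diff: "contact_form a p (x - y) = contact_form a p x - contact_form a p y" for x y
    by (simp add: contact_form_def inner_diff_right diff_divide_distrib right_diff_distrib)
  show ?thesis unfolding contact_form_diff * using n
    by (simp add: vec4_simps d[symmetric]) algebra
qed

section \<open>Levi-Civita connection on the exterior\<close>

locale kerr_exterior =
  fixes M a :: real
  assumes M_pos: "M > 0" and a_le: "\<bar>a\<bar> \<le> M"
begin

abbreviation "S \<equiv> exterior M a"
abbreviation "dd \<equiv> dir_deriv S"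
abbreviation "g \<equiv> kerr_g M a"
abbreviation "H \<equiv> hlift a"

lemma rad_pos: "p \<in> S \<Longrightarrow> rad p > 0"
  using exterior_rad_pos[OF M_pos a_le] .

text \<open>
  Along any straight line through a point the radius is non-decreasing in one of the two senses.  So the
  exterior contains points in every coordinate direction, even at the horizon.
\<close>

lemma has_derivative_exterior_unique:
  fixes f :: "pt \<Rightarrow> 'b::real_normed_vector"
  assumes p: "p \<in> S" and "(f has_derivative f') (at p within S)" "(f has_derivative f'') (at p within S)"
  shows "f' = f''"
proof (rule frechet_derivative_unique_within[OF assms(2,3)])
  fix i :: pt and e :: real
  assume "e > 0"
  \<comment> \<open>the sign is chosen so that the radius does not decrease\<close>
  define d where "d = (if spatial p \<bullet> i \<ge> 0 then e / 2 else - e / 2)"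
  have "(spatial p \<bullet> i) * d \<ge> 0" using \<open>e > 0\<close> by (auto simp: d_def mult_nonneg_nonneg mult_nonpos_nonneg)
  moreover have "spatial (p + d *\<^sub>R i) \<bullet> spatial (p + d *\<^sub>R i)
      = spatial p \<bullet> spatial p + 2 * ((spatial p \<bullet> i) * d) + d\<^sup>2 * (spatial i \<bullet> spatial i)"
    by (simp add: vec4_simps algebra_simps power2_eq_square)
  ultimately have "spatial p \<bullet> spatial p \<le> spatial (p + d *\<^sub>R i) \<bullet> spatial (p + d *\<^sub>R i)" by simp
  then have "rad p \<le> rad (p + d *\<^sub>R i)" unfolding rad_eq by (rule real_sqrt_le_mono)
  then have "p + d *\<^sub>R i \<in> S" using p by (simp add: exterior_def)
  moreover have "0 < \<bar>d\<bar>" "\<bar>d\<bar> < e" using \<open>e > 0\<close> by (auto simp: d_def)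
  ultimately show "\<exists>d. 0 < \<bar>d\<bar> \<and> \<bar>d\<bar> < e \<and> p + d *\<^sub>R i \<in> S" by blast
qed

lemma dir_deriv_eq:
  assumes "p \<in> S" "(f has_derivative f') (at p within S)"
  shows "dd f p = f'"
proof -
  have "(f has_derivative frechet_derivative f (at p within S)) (at p within S)"
    using assms(2) frechet_derivative_works differentiable_def by blast
  then show ?thesis
    using has_derivative_exterior_unique[OF assms(1) _ assms(2)] by (auto simp: dir_deriv_def fun_eq_iff)
qed

lemma has_dir_deriv:
  assumes "f differentiable (at p within S)"
  shows "(f has_derivative dd f p) (at p within S)"
  using assms unfolding frechet_derivative_works by (simp add: dir_deriv_def[abs_def])

lemma dir_deriv_cong:
  assumes "p \<in> S" "\<And>q. q \<in> S \<Longrightarrow> f q = h q"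
  shows "dd f p = dd h p"
proof -
  have "(f has_derivative f') (at p within S) \<longleftrightarrow> (h has_derivative f') (at p within S)" for f'
    using assms has_derivative_transform[of p S] by metis
  then show ?thesis by (simp add: dir_deriv_def[abs_def] frechet_derivative_def)
qed

lemma differentiable_cong_exterior:
  assumes "p \<in> S" "\<And>q. q \<in> S \<Longrightarrow> f q = h q" "f differentiable (at p within S)"
  shows "h differentiable (at p within S)"
  using assms has_derivative_transform[of p S h f] unfolding differentiable_def by metis

lemma linear_dir_deriv:
  assumes "f differentiable (at p within S)"
  shows "linear (dd f p)"
  using has_dir_deriv[OF assms] has_derivative_bounded_linear bounded_linear.linear by blast

lemma kerr_g_sum: "g p u (sum f A) = (\<Sum>i\<in>A. g p u (f i))" "g p (sum f A) u = (\<Sum>i\<in>A. g p (f i) u)"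
proof -
  interpret linear "g p u" by (rule linearI) (simp_all add: kerr_g_bilinear)
  show 1: "g p u (sum f A) = (\<Sum>i\<in>A. g p u (f i))" by (rule sum)
  then show "g p (sum f A) u = (\<Sum>i\<in>A. g p (f i) u)"
    by (simp add: kerr_g_sym[of M a p _ u])
qed

lemma kerr_g_expand: "g p u v = (\<Sum>i\<in>UNIV. \<Sum>j\<in>UNIV. u $ i * v $ j * g p (axis i 1) (axis j 1))"
proof -
  have "g p u v = g p (\<Sum>i\<in>UNIV. (u $ i) *\<^sub>R axis i 1) (\<Sum>j\<in>UNIV. (v $ j) *\<^sub>R axis j 1)"
    by (simp only: vec4_expansion)
  also have "\<dots> = (\<Sum>i\<in>UNIV. \<Sum>j\<in>UNIV. u $ i * v $ j * g p (axis i 1) (axis j 1))"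
    unfolding kerr_g_sum kerr_g_bilinear by (simp add: sum_distrib_left algebra_simps) (rule sum.swap)
  finally show ?thesis .
qed

text \<open>
  Differentiability is read off from the form of the metric without angles, so the axis is no
  exception.
\<close>

lemma kerr_g_differentiable:
  assumes "p \<in> S"
  shows "(\<lambda>q. g q u v) differentiable (at p within S)"
proof -
  note r = rad_pos[OF assms]
  have S0: "Sigma_K a p \<noteq> 0" using Sigma_pos[OF r, of a] by simp
  have R: "rad differentiable (at p within S)" "radial differentiable (at p within S)"
      "Sigma_K a differentiable (at p within S)" "Delta M a differentiable (at p within S)"
    using rad_has_derivative[OF r] radial_has_derivative[OF r] Sigma_has_derivative[OF r]
      Delta_has_derivative[OF r a_le] unfolding differentiable_def by blast+
  have rt: "(\<lambda>q. rot (radial q)) differentiable (at p within S)"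
    using bounded_linear.has_derivative[OF bounded_linear_rot radial_has_derivative[OF r]]
    unfolding differentiable_def by blast
  have r4: "(\<lambda>q. radial q $ 4) differentiable (at p within S)"
    using bounded_linear.has_derivative[OF bounded_linear_vec_nth radial_has_derivative[OF r]]
    unfolding differentiable_def by blast
  have nz: "(rad p)\<^sup>2 \<noteq> 0" using r by simp
  have "(\<lambda>q. contact_form a q u * (radial q \<bullet> v) + contact_form a q v * (radial q \<bullet> u)
    + (a\<^sup>2 * (1 - (radial q $ 4)\<^sup>2) - Delta M a q) / Sigma_K a q * (contact_form a q u * contact_form a q v)
    + Sigma_K a q * ((spatial u \<bullet> spatial v - (radial q \<bullet> u) * (radial q \<bullet> v)) / (rad q)\<^sup>2)
    - a * (contact_form a q u * (rot (radial q) \<bullet> v / rad q) + contact_form a q v * (rot (radial q) \<bullet> u / rad q)))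
    differentiable (at p within S)"
    unfolding contact_form_def using r nz S0
    by (intro differentiable_add differentiable_diff differentiable_mult differentiable_divide
        differentiable_power differentiable_const differentiable_inner R rt r4) auto
  then show ?thesis
    by (rule differentiable_cong_exterior[OF assms, rotated]) (simp add: kerr_g_eq[OF rad_pos a_le])
qed

text \<open>
  The derivative of the metric itself enters as the derivative with frozen arguments.  In this form it
  can be eliminated in favour of derivatives of inner products of fields, see \<open>koszul\<close>.
\<close>

lemma kerr_g_has_derivative:
  assumes p: "p \<in> S" and Y: "(Y has_derivative Y') (at p within S)" and Z: "(Z has_derivative Z') (at p within S)"
  shows "((\<lambda>q. g q (Y q) (Z q)) has_derivative
    (\<lambda>u. dd (\<lambda>q. g q (Y p) (Z p)) p u + g p (Y' u) (Z p) + g p (Y p) (Z' u))) (at p within S)"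
proof -
  define dg where "dg i j = dd (\<lambda>q. g q (axis i 1) (axis j 1)) p" for i j
  note G = has_dir_deriv[OF kerr_g_differentiable[OF p]]
  have rule: "((\<lambda>q. g q (Y q) (Z q)) has_derivative
      (\<lambda>u. (\<Sum>i\<in>UNIV. \<Sum>j\<in>UNIV. Y p $ i * Z p $ j * dg i j u) + g p (Y' u) (Z p) + g p (Y p) (Z' u))) (at p within S)"
    if Y: "(Y has_derivative Y') (at p within S)" and Z: "(Z has_derivative Z') (at p within S)" for Y Y' Z Z'
  proof -
    have "((\<lambda>q. \<Sum>i\<in>UNIV. \<Sum>j\<in>UNIV. Y q $ i * Z q $ j * g q (axis i 1) (axis j 1)) has_derivative
      (\<lambda>u. \<Sum>i\<in>UNIV. \<Sum>j\<in>UNIV. Y p $ i * Z p $ j * dg i j u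
        + (Y p $ i * Z' u $ j + Y' u $ i * Z p $ j) * g p (axis i 1) (axis j 1))) (at p within S)"
      unfolding dg_def
      by (intro has_derivative_sum has_derivative_mult G
          bounded_linear.has_derivative[OF bounded_linear_vec_nth] Y Z)
    moreover have "(\<Sum>i\<in>UNIV. \<Sum>j\<in>UNIV. Y p $ i * Z p $ j * dg i j u
        + (Y p $ i * Z' u $ j + Y' u $ i * Z p $ j) * g p (axis i 1) (axis j 1))
      = (\<Sum>i\<in>UNIV. \<Sum>j\<in>UNIV. Y p $ i * Z p $ j * dg i j u) + g p (Y' u) (Z p) + g p (Y p) (Z' u)" for u
      unfolding kerr_g_expand[of p "Y' u"] kerr_g_expand[of p "Y p"]
      by (simp add: sum.distrib[symmetric] algebra_simps)
    ultimately show ?thesis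
      unfolding kerr_g_expand[of _ "Y _" "Z _"] by simp
  qed
  have "g p 0 v = 0" "g p v 0 = 0" for v
    using kerr_g_bilinear(5)[of M a p 0 v v] kerr_g_bilinear(6)[of M a p v 0 v] by simp_all
  then have "dd (\<lambda>q. g q (Y p) (Z p)) p = (\<lambda>u. \<Sum>i\<in>UNIV. \<Sum>j\<in>UNIV. Y p $ i * Z p $ j * dg i j u)"
    using dir_deriv_eq[OF p rule[OF has_derivative_const has_derivative_const, of "Y p" "Z p"]] by simp
  with rule[OF Y Z] show ?thesis by simp
qed

lemma dir_deriv_kerr_g:
  assumes "p \<in> S" "(Y has_derivative Y') (at p within S)" "(Z has_derivative Z') (at p within S)"
  shows "dd (\<lambda>q. g q (Y p) (Z p)) p u = dd (\<lambda>q. g q (Y q) (Z q)) p u - g p (Y' u) (Z p) - g p (Y p) (Z' u)"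
  using dir_deriv_eq[OF assms(1) kerr_g_has_derivative[OF assms]] by simp

lemma christoffel_sym: "christoffel M a p u v = christoffel M a p v u"
  by (simp add: christoffel_def kerr_g_sym[of M a _ u v] add.commute)

text \<open>
  The Koszul formula for constant fields.  It holds because the metric is nondegenerate, so that
  \<open>matrix_inv\<close> is an inverse of the matrix of the metric.
\<close>

lemma christoffel_kerr_g:
  assumes p: "p \<in> S"
  shows "g p (christoffel M a p u v) z =
    (dd (\<lambda>q. g q v z) p u + dd (\<lambda>q. g q u z) p v - dd (\<lambda>q. g q u v) p z) / 2"
proof -
  define b where "b z = (dd (\<lambda>q. g q v z) p u + dd (\<lambda>q. g q u z) p v - dd (\<lambda>q. g q u v) p z) / 2" for z
  note G = has_dir_deriv[OF kerr_g_differentiable[OF p]]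
  have add: "dd (\<lambda>q. g q v (z + z')) p u = dd (\<lambda>q. g q v z) p u + dd (\<lambda>q. g q v z') p u" for u v z z'
    unfolding kerr_g_bilinear using dir_deriv_eq[OF p has_derivative_add[OF G G]] by simp
  have sc: "dd (\<lambda>q. g q v (k *\<^sub>R z)) p u = k * dd (\<lambda>q. g q v z) p u" for u v z k
    unfolding kerr_g_bilinear using dir_deriv_eq[OF p has_derivative_mult_right[OF G]] by simp
  have "linear b"
    unfolding b_def
    by (rule linearI)
      (simp_all add: add sc linear_add[OF linear_dir_deriv[OF kerr_g_differentiable[OF p]]]
        linear_scale[OF linear_dir_deriv[OF kerr_g_differentiable[OF p]]] add_divide_distrib[symmetric]
        diff_divide_distrib[symmetric] algebra_simps)
  then interpret b: linear b .
  have mult: "(g_matrix M a p *v x) $ l = g p x (axis l 1)" for x l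
  proof -
    have "g p x (axis l 1) = g p (axis l 1) (\<Sum>i\<in>UNIV. (x $ i) *\<^sub>R axis i 1)"
      by (simp only: vec4_expansion kerr_g_sym[of M a p x])
    then show ?thesis
      unfolding kerr_g_sum kerr_g_bilinear by (simp add: matrix_vector_mult_def g_matrix_def mult.commute)
  qed
  have "\<exists>B. B ** g_matrix M a p = mat 1"
    unfolding matrix_left_invertible_ker
  proof (intro allI impI)
    fix x assume x: "g_matrix M a p *v x = 0"
    show "x = 0"
    proof (rule kerr_g_nondegenerate[OF rad_pos[OF p] a_le])
      fix w
      have "g p x w = g p x (\<Sum>i\<in>UNIV. (w $ i) *\<^sub>R axis i 1)" by (simp only: vec4_expansion)
      also have "\<dots> = (\<Sum>i\<in>UNIV. w $ i * (g_matrix M a p *v x) $ i)"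
        unfolding mult kerr_g_sum kerr_g_bilinear ..
      finally show "g p x w = 0" by (simp add: x)
    qed
  qed
  then have "invertible (g_matrix M a p)" by (simp add: invertible_left_inverse)
  then have "g_matrix M a p ** matrix_inv (g_matrix M a p) = mat 1"
    unfolding invertible_def matrix_inv_def by (rule someI2_ex) simp
  then have "g_matrix M a p *v christoffel M a p u v = (\<chi> l. b (axis l 1))"
    unfolding christoffel_def b_def by (simp add: matrix_vector_mul_assoc)
  then have l: "g p (christoffel M a p u v) (axis l 1) = b (axis l 1)" for l
    by (simp add: mult[symmetric])
  have "g p (christoffel M a p u v) z = g p (christoffel M a p u v) (\<Sum>i\<in>UNIV. (z $ i) *\<^sub>R axis i 1)"
    by (simp only: vec4_expansion)
  also have "\<dots> = b (\<Sum>i\<in>UNIV. (z $ i) *\<^sub>R axis i 1)"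
    unfolding kerr_g_sum kerr_g_bilinear l b.sum b.scale by simp
  finally show ?thesis by (simp add: vec4_expansion b_def)
qed

text \<open>
  The Koszul formula for the covariant derivative of \<open>X\<close> along \<open>Y\<close>.  It involves no
  derivative of the metric components, only derivatives of inner products of the three fields and their
  brackets.
\<close>

lemma koszul:
  assumes p: "p \<in> S" and X: "(X has_derivative X') (at p within S)"
    and Y: "(Y has_derivative Y') (at p within S)" and Z: "(Z has_derivative Z') (at p within S)"
  shows "2 * g p (X' (Y p) + christoffel M a p (Y p) (X p)) (Z p)
    = dd (\<lambda>q. g q (X q) (Z q)) p (Y p) + dd (\<lambda>q. g q (Y q) (Z q)) p (X p) - dd (\<lambda>q. g q (X q) (Y q)) p (Z p)
      + g p (X' (Y p) - Y' (X p)) (Z p) + g p (X' (Z p) - Z' (X p)) (Y p) - g p (X p) (Z' (Y p) - Y' (Z p))"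
  unfolding kerr_g_bilinear christoffel_kerr_g[OF p] dir_deriv_kerr_g[OF p X Z] dir_deriv_kerr_g[OF p Y Z]
    kerr_g_sym[of M a _ "Y _" "X _"] dir_deriv_kerr_g[OF p X Y]
  using kerr_g_sym[of M a p "Y p"] kerr_g_sym[of M a p "Z p"]
  by (simp add: kerr_g_bilinear field_simps)

lemma linear_christoffel:
  assumes p: "p \<in> S"
  shows "linear (christoffel M a p u)"
proof (rule linearI)
  note G = has_dir_deriv[OF kerr_g_differentiable[OF p]]
  have add: "dd (\<lambda>q. g q v z + g q v' z') p u = dd (\<lambda>q. g q v z) p u + dd (\<lambda>q. g q v' z') p u" for u v v' z z'
    using dir_deriv_eq[OF p has_derivative_add[OF G G]] by simp
  have sc: "dd (\<lambda>q. k * g q v z) p u = k * dd (\<lambda>q. g q v z) p u" for u v z k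
    using dir_deriv_eq[OF p has_derivative_mult_right[OF G]] by simp
  note lin = linear_dir_deriv[OF kerr_g_differentiable[OF p]]
  fix v w :: pt and k :: real
  have "christoffel M a p u (v + w) - (christoffel M a p u v + christoffel M a p u w) = 0"
    by (rule kerr_g_nondegenerate[OF rad_pos[OF p] a_le])
      (simp add: kerr_g_bilinear christoffel_kerr_g[OF p] add linear_add[OF lin] add_divide_distrib diff_divide_distrib)
  then show "christoffel M a p u (v + w) = christoffel M a p u v + christoffel M a p u w" by simp
  have "christoffel M a p u (k *\<^sub>R v) - k *\<^sub>R christoffel M a p u v = 0"
    by (rule kerr_g_nondegenerate[OF rad_pos[OF p] a_le])
      (simp add: kerr_g_bilinear christoffel_kerr_g[OF p] sc linear_scale[OF lin] add_divide_distrib diff_divide_distrib algebra_simps)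
  then show "christoffel M a p u (k *\<^sub>R v) = k *\<^sub>R christoffel M a p u v" by simp
qed

section \<open>Horizontal one-forms\<close>

definition horizontal :: "(pt \<Rightarrow> pt) \<Rightarrow> bool"
  where "horizontal \<omega> \<longleftrightarrow> (\<forall>p\<in>S. \<omega> p \<bullet> e3 p = 0 \<and> \<omega> p \<bullet> e4 M a p = 0)"

definition C1_horizontal :: "(pt \<Rightarrow> pt) \<Rightarrow> bool"
  where "C1_horizontal \<omega> \<longleftrightarrow> horizontal \<omega> \<and> (\<forall>p\<in>S. \<omega> differentiable (at p within S))"

lemma linear_hproj: "linear (hproj M a p)"
  by (rule linearI) (simp_all add: hproj_def kerr_g_bilinear algebra_simps add_divide_distrib)

lemma inner_hproj:
  assumes "x \<bullet> e3 p = 0" "x \<bullet> e4 M a p = 0"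
  shows "x \<bullet> hproj M a p v = x \<bullet> v"
  using assms by (simp add: hproj_def inner_add_right)

text \<open>
  A horizontal form takes the same value on a vector and on its projection, and the projection is a lift.
\<close>

lemma horizontal_eqI:
  assumes "p \<in> S" "x \<bullet> e3 p = 0" "x \<bullet> e4 M a p = 0" "y \<bullet> e3 p = 0" "y \<bullet> e4 M a p = 0"
    and "\<And>w. x \<bullet> H p w = y \<bullet> H p w"
  shows "x = y"
proof -
  have "x \<bullet> v = y \<bullet> v" for v
    using assms inner_hproj[of x p v] inner_hproj[of y p v] hproj_hlift[OF rad_pos a_le, of p v] by metis
  then show ?thesis by (metis vector_eq_rdot)
qed

lemma hlift_differentiable:
  assumes "p \<in> S" shows "(\<lambda>q. H q w) differentiable (at p within S)"
  using hlift_has_derivative[OF rad_pos[OF assms] has_derivative_const] unfolding differentiable_def by blast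

lemma null_differentiable:
  assumes "p \<in> S" shows "e3 differentiable (at p within S)" "e4 M a differentiable (at p within S)"
  using e3_has_derivative[OF rad_pos[OF assms]] e4_has_derivative[OF rad_pos[OF assms] a_le assms]
  unfolding differentiable_def by blast+

lemma hproj_differentiable:
  assumes p: "p \<in> S" and V: "V differentiable (at p within S)"
  shows "(\<lambda>q. hproj M a q (V q)) differentiable (at p within S)"
proof -
  note n = null_differentiable[OF p]
  have G: "(\<lambda>q. g q (V q) (Z q)) differentiable (at p within S)" if "Z differentiable (at p within S)" for Z
    using kerr_g_has_derivative[OF p has_dir_deriv[OF V] has_dir_deriv[OF that]] unfolding differentiable_def by blast
  show ?thesis unfolding hproj_def divide_inverse
    by (intro differentiable_add differentiable_scaleR differentiable_mult differentiable_const V G n)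
qed

text \<open>
  The components of a horizontal form are combinations of its values on lifts, with differentiable
  coefficients.
\<close>

lemma differentiable_from_hlift:
  assumes h: "horizontal \<omega>" and p: "p \<in> S" and d: "\<And>w. (\<lambda>q. \<omega> q \<bullet> H q w) differentiable (at p within S)"
  shows "\<omega> differentiable (at p within S)"
proof -
  have 1: "(\<lambda>q. \<omega> q \<bullet> v) differentiable (at p within S)" for v
  proof -
    have P: "(\<lambda>q. (hproj M a q v $ i / rad q) * (\<omega> q \<bullet> H q (axis i 1))) differentiable (at p within S)" for i
      using bounded_linear.has_derivative[OF bounded_linear_vec_nth
          has_dir_deriv[OF hproj_differentiable[OF p differentiable_const, of v]], of i]
        rad_has_derivative[OF rad_pos[OF p]] rad_pos[OF p]
      by (intro differentiable_mult differentiable_divide d) (auto simp: differentiable_def)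
    have e: "(\<Sum>i\<in>UNIV. (hproj M a q v $ i / rad q) * (\<omega> q \<bullet> H q (axis i 1))) = \<omega> q \<bullet> v" if "q \<in> S" for q
    proof -
      have "\<omega> q \<bullet> v = \<omega> q \<bullet> H q ((1 / rad q) *\<^sub>R (\<Sum>i\<in>UNIV. (hproj M a q v $ i) *\<^sub>R axis i 1))"
        unfolding vec4_expansion using hproj_hlift[OF rad_pos[OF that] a_le, of v] inner_hproj[of "\<omega> q" q v] h that
        by (simp add: horizontal_def)
      also have "\<dots> = (\<Sum>i\<in>UNIV. (hproj M a q v $ i / rad q) * (\<omega> q \<bullet> H q (axis i 1)))"
        unfolding hlift_scaleR linear_sum[OF linear_hlift] by (simp add: inner_sum_right sum_distrib_left)
      finally show ?thesis ..
    qed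
    show ?thesis
      by (rule differentiable_cong_exterior[OF p e]) (assumption, intro differentiable_sum ballI P finite_class.finite_UNIV)
  qed
  have "(\<lambda>q. \<Sum>b\<in>Basis. (\<omega> q \<bullet> b) *\<^sub>R b) differentiable (at p within S)"
    by (auto intro!: differentiable_sum differentiable_scaleR 1)
  then show ?thesis by (simp add: euclidean_representation)
qed

text \<open>
  The covariant derivative is defined through the projections of the constant fields.  By the Leibniz
  rule the same formula holds with the projection of any differentiable field \<open>V\<close>.
\<close>

lemma hD_inner:
  assumes p: "p \<in> S" and w: "\<omega> differentiable (at p within S)" and h: "horizontal \<omega>"
    and V: "V differentiable (at p within S)"
  defines "Y \<equiv> \<lambda>q. hproj M a q (V q)"
  shows "hD M a u \<omega> p \<bullet> V p = dd (\<lambda>q. \<omega> q \<bullet> Y q) p u - \<omega> p \<bullet> (dd Y p u + christoffel M a p u (Y p))"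
proof -
  define B where "B i q = hproj M a q (axis i 1)" for i :: 4 and q
  have dB: "B i differentiable (at p within S)" for i
    unfolding B_def by (intro hproj_differentiable p differentiable_const)
  note Bd = has_dir_deriv[OF dB] and wd = has_dir_deriv[OF w]
  have Vd: "((\<lambda>q. V q $ i) has_derivative (\<lambda>u. dd V p u $ i)) (at p within S)" for i
    by (rule bounded_linear.has_derivative[OF bounded_linear_vec_nth has_dir_deriv[OF V]])
  have wB: "((\<lambda>q. \<omega> q \<bullet> B i q) has_derivative dd (\<lambda>q. \<omega> q \<bullet> B i q) p) (at p within S)" for i
    by (intro has_dir_deriv differentiable_inner w dB)
  have Y: "Y q = (\<Sum>i\<in>UNIV. V q $ i *\<^sub>R B i q)" for q
  proof -
    have "Y q = hproj M a q (\<Sum>i\<in>UNIV. V q $ i *\<^sub>R axis i 1)" by (simp only: Y_def vec4_expansion)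
    then show ?thesis unfolding linear_sum[OF linear_hproj] linear_scale[OF linear_hproj] B_def .
  qed
  have d1: "dd (\<lambda>q. \<omega> q \<bullet> Y q) p u = (\<Sum>i\<in>UNIV. V p $ i * dd (\<lambda>q. \<omega> q \<bullet> B i q) p u + dd V p u $ i * (\<omega> p \<bullet> B i p))"
    unfolding Y inner_sum_right inner_scaleR_right
    by (subst dir_deriv_eq[OF p has_derivative_sum[OF has_derivative_mult[OF Vd wB]]]) simp
  have d2: "dd Y p u = (\<Sum>i\<in>UNIV. V p $ i *\<^sub>R dd (B i) p u + dd V p u $ i *\<^sub>R B i p)"
    unfolding Y[abs_def]
    by (subst dir_deriv_eq[OF p has_derivative_sum[OF has_derivative_scaleR[OF Vd Bd]]]) simp
  note lc = linear_christoffel[OF p, of u]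
  have wp: "\<omega> p \<bullet> hproj M a p v = \<omega> p \<bullet> v" for v
    using h p by (intro inner_hproj) (auto simp: horizontal_def)
  have "hD M a u \<omega> p $ i = dd (\<lambda>q. \<omega> q \<bullet> B i q) p u - \<omega> p \<bullet> (dd (B i) p u + christoffel M a p u (B i p))" for i
    by (simp add: hD_def Let_def B_def[abs_def] wp levi_civita_def)
  then have "hD M a u \<omega> p \<bullet> V p = (\<Sum>i\<in>UNIV. (dd (\<lambda>q. \<omega> q \<bullet> B i q) p u - \<omega> p \<bullet> (dd (B i) p u + christoffel M a p u (B i p))) * V p $ i)"
    by (simp add: inner_vec_def[of "hD M a u \<omega> p"])
  also have "\<dots> = dd (\<lambda>q. \<omega> q \<bullet> Y q) p u - \<omega> p \<bullet> (dd Y p u + christoffel M a p u (Y p))"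
    unfolding d1 d2 unfolding Y linear_sum[OF lc] linear_scale[OF lc]
    by (simp add: inner_sum_right inner_add_right sum.distrib sum_subtractf[symmetric] sum_distrib_left algebra_simps)
  finally show ?thesis .
qed

text \<open>
  The previous lemma applied to a field whose projection vanishes identically.
\<close>

lemma hD_null:
  assumes p: "p \<in> S" and w: "\<omega> differentiable (at p within S)" and h: "horizontal \<omega>"
  shows "hD M a u \<omega> p \<bullet> e3 p = 0" "hD M a u \<omega> p \<bullet> e4 M a p = 0"
proof -
  have *: "hD M a u \<omega> p \<bullet> V p = 0" if "V differentiable (at p within S)" "\<And>q. q \<in> S \<Longrightarrow> hproj M a q (V q) = 0" for V
  proof -
    have "dd (\<lambda>q. \<omega> q \<bullet> hproj M a q (V q)) p = dd (\<lambda>q. 0) p" by (rule dir_deriv_cong[OF p]) (simp add: that)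
    moreover have "dd (\<lambda>q. hproj M a q (V q)) p = dd (\<lambda>q. 0::pt) p" by (rule dir_deriv_cong[OF p]) (simp add: that)
    moreover have "dd (\<lambda>q. 0::pt) p = (\<lambda>u. 0)" by (rule dir_deriv_eq[OF p has_derivative_const])
    moreover have "dd (\<lambda>q. 0::real) p = (\<lambda>u. 0)" by (rule dir_deriv_eq[OF p has_derivative_const])
    ultimately show ?thesis
      using hD_inner[OF p w h that(1), of u] that(2)[OF p] linear_0[OF linear_christoffel[OF p, of u]] by simp
  qed
  show "hD M a u \<omega> p \<bullet> e3 p = 0" "hD M a u \<omega> p \<bullet> e4 M a p = 0"
    using hproj_null[OF rad_pos a_le] by (auto intro!: * null_differentiable[OF p])
qed

lemma hD_hlift:
  assumes p: "p \<in> S" and w: "\<omega> differentiable (at p within S)" and h: "horizontal \<omega>"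
  shows "hD M a u \<omega> p \<bullet> H p w = dd (\<lambda>q. \<omega> q \<bullet> H q w) p u - \<omega> p \<bullet> (dhlift a p u w + christoffel M a p u (H p w))"
proof -
  have e: "hproj M a q (H q w) = H q w" if "q \<in> S" for q
    using hproj_of_hlift[OF rad_pos[OF that] a_le] .
  have 1: "dd (\<lambda>q. \<omega> q \<bullet> hproj M a q (H q w)) p = dd (\<lambda>q. \<omega> q \<bullet> H q w) p"
    by (rule dir_deriv_cong[OF p]) (simp add: e)
  have 2: "dd (\<lambda>q. hproj M a q (H q w)) p = dd (\<lambda>q. H q w) p"
    by (rule dir_deriv_cong[OF p]) (simp add: e)
  have 3: "dd (\<lambda>q. H q w) p = (\<lambda>u. dhlift a p u w)"
    using dir_deriv_eq[OF p hlift_has_derivative[OF rad_pos[OF p] has_derivative_const]] by (simp add: linear_0[OF linear_hlift])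
  show ?thesis
    using hD_inner[OF p w h hlift_differentiable[OF p], of u w] by (simp add: 1 2 3 e p)
qed

lemma hD_cong:
  assumes p: "p \<in> S" and e: "\<And>q. q \<in> S \<Longrightarrow> \<omega> q = \<omega>' q"
  shows "hD M a u \<omega> p = hD M a u \<omega>' p"
proof -
  have "dd (\<lambda>q. \<omega> q \<bullet> hproj M a q v) p = dd (\<lambda>q. \<omega>' q \<bullet> hproj M a q v) p" for v
    by (rule dir_deriv_cong[OF p]) (simp add: e)
  then show ?thesis by (simp add: hD_def Let_def e[OF p])
qed

lemma hD_add:
  assumes p: "p \<in> S" and w: "C1_horizontal \<omega>" and w': "C1_horizontal \<omega>'"
  shows "hD M a u (\<lambda>q. \<omega> q + \<omega>' q) p = hD M a u \<omega> p + hD M a u \<omega>' p"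
proof -
  have d: "(\<lambda>q. \<omega> q \<bullet> hproj M a q v) differentiable (at p within S)" "(\<lambda>q. \<omega>' q \<bullet> hproj M a q v) differentiable (at p within S)" for v
    using w w' p by (auto intro!: differentiable_inner hproj_differentiable simp: C1_horizontal_def)
  have "dd (\<lambda>q. (\<omega> q + \<omega>' q) \<bullet> hproj M a q v) p u = dd (\<lambda>q. \<omega> q \<bullet> hproj M a q v) p u + dd (\<lambda>q. \<omega>' q \<bullet> hproj M a q v) p u" for v
    using dir_deriv_eq[OF p has_derivative_add[OF has_dir_deriv[OF d(1)] has_dir_deriv[OF d(2)]]]
    by (simp add: inner_add_left)
  then show ?thesis by (simp add: hD_def Let_def vec_eq_iff inner_add_left)
qed

lemma hD_scaleR:
  assumes p: "p \<in> S" and w: "C1_horizontal \<omega>" and f: "f differentiable (at p within S)"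
  shows "hD M a u (\<lambda>q. f q *\<^sub>R \<omega> q) p = f p *\<^sub>R hD M a u \<omega> p + dd f p u *\<^sub>R \<omega> p"
proof -
  have d: "(\<lambda>q. \<omega> q \<bullet> hproj M a q v) differentiable (at p within S)" for v
    using w p by (auto intro!: differentiable_inner hproj_differentiable simp: C1_horizontal_def)
  have wp: "\<omega> p \<bullet> hproj M a p v = \<omega> p \<bullet> v" for v
    using w p by (intro inner_hproj) (auto simp: C1_horizontal_def horizontal_def)
  have "dd (\<lambda>q. (f q *\<^sub>R \<omega> q) \<bullet> hproj M a q v) p u = f p * dd (\<lambda>q. \<omega> q \<bullet> hproj M a q v) p u + dd f p u * (\<omega> p \<bullet> v)" for v
    using dir_deriv_eq[OF p has_derivative_mult[OF has_dir_deriv[OF f] has_dir_deriv[OF d]]]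
    by (simp add: wp)
  then show ?thesis by (simp add: hD_def Let_def vec_eq_iff algebra_simps inner_axis)
qed

lemma hstar_inner:
  "hstar M a p x \<bullet> v = harea M a p v (e1 a p) * (x \<bullet> e1 a p) + harea M a p v (e2 a p) * (x \<bullet> e2 a p)"
proof -
  have "hstar M a p x \<bullet> v = (\<Sum>i\<in>UNIV. harea M a p (v $ i *\<^sub>R axis i 1) (e1 a p) * (x \<bullet> e1 a p)
      + harea M a p (v $ i *\<^sub>R axis i 1) (e2 a p) * (x \<bullet> e2 a p))"
    unfolding inner_vec_def[of "hstar M a p x"]
    by (simp add: hstar_def harea_def kerr_g_bilinear algebra_simps)
  also have "\<dots> = harea M a p (\<Sum>i\<in>UNIV. v $ i *\<^sub>R axis i 1) (e1 a p) * (x \<bullet> e1 a p)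
      + harea M a p (\<Sum>i\<in>UNIV. v $ i *\<^sub>R axis i 1) (e2 a p) * (x \<bullet> e2 a p)"
    by (simp add: harea_def kerr_g_sum sum.distrib sum_distrib_right sum_distrib_left sum_subtractf algebra_simps)
  finally show ?thesis by (simp only: vec4_expansion)
qed

text \<open>
  The formula extends the Hodge star smoothly over the axis, where \<open>e1\<close> and \<open>e2\<close> are discontinuous.
\<close>

lemma hstar_hlift:
  assumes p: "p \<in> S"
  shows "hstar M a p x \<bullet> H p w = x \<bullet> H p (cross (radial p) w)"
proof -
  note r = rad_pos[OF p]
  have "x \<bullet> H p (cross (radial p) w) = g p (H p w) (e1 a p) * (x \<bullet> e2 a p) - g p (H p w) (e2 a p) * (x \<bullet> e1 a p)"
    unfolding hlift_cross(1)[OF r a_le, symmetric] by (simp add: inner_diff_right)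
  then show ?thesis
    unfolding hstar_inner using frame_relations[OF r a_le] kerr_g_sym[of M a p "e2 a p" "e1 a p"]
    by (simp add: harea_def)
qed

lemma hstar_null:
  assumes p: "p \<in> S"
  shows "hstar M a p x \<bullet> e3 p = 0" "hstar M a p x \<bullet> e4 M a p = 0"
  unfolding hstar_inner harea_def
  using frame_relations[OF rad_pos[OF p] a_le]
  by (simp_all add: kerr_g_sym[of M a p "e3 p" "e1 a p"] kerr_g_sym[of M a p "e3 p" "e2 a p"]
      kerr_g_sym[of M a p "e4 M a p" "e1 a p"] kerr_g_sym[of M a p "e4 M a p" "e2 a p"])

lemma hlift_cross_cross:
  assumes p: "p \<in> S"
  shows "H p (cross (radial p) (cross (radial p) w)) = - H p w"
proof -
  define n2 n3 n4 where "n2 = radial p $ 2" "n3 = radial p $ 3" "n4 = radial p $ 4"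
  note d = this
  have n: "n2\<^sup>2 + n3\<^sup>2 + n4\<^sup>2 = 1" using radial_sum_squares[OF rad_pos[OF p]] by (simp add: d)
  have 1: "cross (radial p) (cross (radial p) w) = (radial p \<bullet> w) *\<^sub>R radial p - spatial w"
    unfolding vec_eq_iff forall_4 by (simp add: vec4_simps d[symmetric]) (use n in \<open>intro conjI; algebra\<close>)
  have "H p (radial p) = 0" by (simp add: hlift_def radial_unit[OF rad_pos[OF p]])
  moreover have "H p (spatial w) = H p w"
    by (simp add: hlift_def vec4_simps)
  ultimately show ?thesis unfolding 1 linear_diff[OF linear_hlift] hlift_scaleR by simp
qed

lemma smooth_C2:
  assumes "smooth_on S f" "p \<in> S"
  shows "f differentiable (at p within S)" "(\<lambda>q. dd f q v) differentiable (at p within S)"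
    "continuous_on S (\<lambda>q. dd (\<lambda>q. dd f q v) q w)"
proof -
  have C: "Ck_on (Suc (Suc 0)) S f" using assms(1) by (simp only: smooth_on_def)
  then have v: "Ck_on (Suc 0) S (\<lambda>q. dd f q v)" by (simp only: Ck_on.simps(2)[of "Suc 0"])
  show "f differentiable (at p within S)"
    using C assms(2) by (simp only: Ck_on.simps(2)[of "Suc 0"])
  show "(\<lambda>q. dd f q v) differentiable (at p within S)" "continuous_on S (\<lambda>q. dd (\<lambda>q. dd f q v) q w)"
    using v assms(2) by (simp_all only: Ck_on.simps)
qed

text \<open>
  In the interior this is the symmetry of second derivatives; points of the horizon are limits of
  interior points, and the second derivatives are continuous up to the boundary.
\<close>

lemma dir_deriv_commute:
  fixes u :: "pt \<Rightarrow> real"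
  assumes u: "smooth_on S u" and p: "p \<in> S"
  shows "dd (\<lambda>q. dd u q v) p w = dd (\<lambda>q. dd u q w) p v"
proof -
  define U where "U = {q. rad q > r_plus M a}"
  have "open U"
    unfolding U_def rad_def by (intro open_Collect_less continuous_intros)
  have US: "U \<subseteq> S" by (auto simp: U_def exterior_def)
  have at: "at q within S = at q" if "q \<in> U" for q
    using at_within_interior[of q S] interiorI[OF \<open>open U\<close> that US] by simp
  have int: "dd (\<lambda>q. dd u q v) q w = dd (\<lambda>q. dd u q w) q v" if q: "q \<in> U" for q
  proof (rule second_derivative_symmetric[OF \<open>open U\<close> q])
    show "(u has_derivative dd u y) (at y)" if "y \<in> U" for y
      using has_dir_deriv[OF smooth_C2(1)[OF u subsetD[OF US that]]] unfolding at[OF that] .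
    have D: "((\<lambda>y. dd u y x) has_derivative dd (\<lambda>q. dd u q x) y) (at y)" if "y \<in> U" for y x
      using has_dir_deriv[OF smooth_C2(2)[OF u subsetD[OF US that]]] unfolding at[OF that] .
    have C: "continuous_on U (\<lambda>y. dd (\<lambda>q. dd u q x) y z)" for x z
      using smooth_C2(3)[OF u p] US by (rule continuous_on_subset)
    show "((\<lambda>y. dd u y v) has_derivative dd (\<lambda>q. dd u q v) y) (at y)"
      "((\<lambda>y. dd u y w) has_derivative dd (\<lambda>q. dd u q w) y) (at y)" if "y \<in> U" for y
      by (rule D[OF that])+
    show "continuous_on U (\<lambda>y. dd (\<lambda>q. dd u q v) y w)" "continuous_on U (\<lambda>y. dd (\<lambda>q. dd u q w) y v)"
      by (rule C)+
  qed
  define F where "F q = dd (\<lambda>q. dd u q v) q w - dd (\<lambda>q. dd u q w) q v" for q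
  have F: "continuous_on S F" unfolding F_def by (intro continuous_on_diff smooth_C2(3)[OF u p])
  \<comment> \<open>interior points that approach \<open>p\<close> radially\<close>
  define x where "x k = p + (1 / real (Suc k)) *\<^sub>R radial p" for k
  have "(\<lambda>k. p + (1 / real (Suc k)) *\<^sub>R radial p) \<longlonglongrightarrow> p + 0 *\<^sub>R radial p"
    by (intro tendsto_intros LIMSEQ_inverse_real_of_nat[unfolded inverse_eq_divide])
  then have x: "x \<longlonglongrightarrow> p" by (simp add: x_def[abs_def])
  have xU: "x k \<in> U" for k
  proof -
    note n = radial_unit[OF rad_pos[OF p]]
    have "spatial (x k) = (rad p + 1 / real (Suc k)) *\<^sub>R radial p"
      using spatial_eq_radial[OF rad_pos[OF p]] by (simp add: x_def vec4_simps algebra_simps)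
    then have "rad (x k) = \<bar>rad p + 1 / real (Suc k)\<bar>"
      unfolding rad_eq by (simp add: n power2_eq_square[symmetric])
    moreover have "1 / real (Suc k) > 0" by simp
    moreover have "rad p \<ge> r_plus M a" using p by (simp add: exterior_def)
    ultimately have "rad (x k) > r_plus M a" using rad_pos[OF p] by linarith
    then show ?thesis by (simp add: U_def)
  qed
  have "(\<lambda>k. F (x k)) \<longlonglongrightarrow> F p"
    by (rule continuous_on_tendsto_compose[OF F x p]) (simp add: subsetD[OF US xU])
  moreover have "F (x k) = 0" for k unfolding F_def using int[OF xU] by simp
  ultimately have "(\<lambda>k. 0) \<longlonglongrightarrow> F p" by simp
  then have "F p = 0" using LIMSEQ_unique[OF tendsto_const] by metis
  then show ?thesis by (simp add: F_def)
qed

lemma dir_deriv_field: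
  assumes u: "smooth_on S u" and p: "p \<in> S" and V: "(V has_derivative V') (at p within S)"
  shows "((\<lambda>q. dd u q (V q)) has_derivative (\<lambda>v. dd (\<lambda>q. dd u q (V p)) p v + dd u p (V' v))) (at p within S)"
proof -
  have ex: "dd f q v = (\<Sum>i\<in>UNIV. v $ i *\<^sub>R dd f q (axis i 1))" if "f differentiable (at q within S)" for f :: "pt \<Rightarrow> 'a" and q v
  proof -
    have "dd f q v = dd f q (\<Sum>i\<in>UNIV. v $ i *\<^sub>R axis i 1)" by (simp only: vec4_expansion)
    then show ?thesis unfolding linear_sum[OF linear_dir_deriv[OF that]] linear_scale[OF linear_dir_deriv[OF that]] .
  qed
  have Vd: "((\<lambda>q. V q $ i) has_derivative (\<lambda>u. V' u $ i)) (at p within S)" for i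
    by (rule bounded_linear.has_derivative[OF bounded_linear_vec_nth V])
  note D = has_dir_deriv[OF smooth_C2(2)[OF u p]]
  have 1: "((\<lambda>q. \<Sum>i\<in>UNIV. v q $ i *\<^sub>R dd u q (axis i 1)) has_derivative
    (\<lambda>x. \<Sum>i\<in>UNIV. v p $ i *\<^sub>R dd (\<lambda>q. dd u q (axis i 1)) p x + v' x $ i *\<^sub>R dd u p (axis i 1))) (at p within S)"
    if "\<And>i. ((\<lambda>q. v q $ i) has_derivative (\<lambda>u. v' u $ i)) (at p within S)" for v v'
    by (intro has_derivative_sum has_derivative_scaleR that D)
  have 2: "dd (\<lambda>q. dd u q (V p)) p = (\<lambda>x. \<Sum>i\<in>UNIV. V p $ i *\<^sub>R dd (\<lambda>q. dd u q (axis i 1)) p x)"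
  proof -
    have "dd (\<lambda>q. dd u q (V p)) p = dd (\<lambda>q. \<Sum>i\<in>UNIV. V p $ i *\<^sub>R dd u q (axis i 1)) p"
      by (rule dir_deriv_cong[OF p]) (rule ex[OF smooth_C2(1)[OF u]])
    also have "\<dots> = (\<lambda>x. \<Sum>i\<in>UNIV. V p $ i *\<^sub>R dd (\<lambda>q. dd u q (axis i 1)) p x)"
      using dir_deriv_eq[OF p 1[of "\<lambda>q. V p" "\<lambda>u. 0"]] by simp
    finally show ?thesis .
  qed
  show ?thesis
    by (rule has_derivative_transform[OF p _ has_derivative_eq_rhs[OF 1[OF Vd]]])
      (simp_all add: ex[OF smooth_C2(1)[OF u]] ex[OF smooth_C2(1)[OF u p], of "V' _"] 2 sum.distrib fun_eq_iff)
qed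

lemma hgrad_inner:
  assumes "u differentiable (at p within S)"
  shows "hgrad M a u p \<bullet> v = dd u p (hproj M a p v)"
proof -
  have "dd u p (hproj M a p v) = dd u p (hproj M a p (\<Sum>i\<in>UNIV. v $ i *\<^sub>R axis i 1))"
    by (simp only: vec4_expansion)
  then show ?thesis
    unfolding linear_sum[OF linear_hproj] linear_scale[OF linear_hproj]
      linear_sum[OF linear_dir_deriv[OF assms]] linear_scale[OF linear_dir_deriv[OF assms]]
    by (simp add: inner_vec_def hgrad_def mult.commute)
qed

lemma hgrad_hlift:
  assumes "p \<in> S" "u differentiable (at p within S)"
  shows "hgrad M a u p \<bullet> H p w = dd u p (H p w)" "hgrad M a u p \<bullet> e3 p = 0" "hgrad M a u p \<bullet> e4 M a p = 0"
  unfolding hgrad_inner[OF assms(2)]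
  by (simp_all add: hproj_of_hlift[OF rad_pos[OF assms(1)] a_le] hproj_null[OF rad_pos[OF assms(1)] a_le]
      linear_0[OF linear_dir_deriv[OF assms(2)]])

lemma hgrad_C1_horizontal:
  assumes u: "smooth_on S u"
  shows "C1_horizontal (hgrad M a u)"
proof -
  have h: "horizontal (hgrad M a u)"
    by (simp add: horizontal_def hgrad_hlift smooth_C2(1)[OF u])
  moreover have "hgrad M a u differentiable (at p within S)" if p: "p \<in> S" for p
  proof (rule differentiable_from_hlift[OF h p])
    fix w
    have "(\<lambda>q. dd u q (H q w)) differentiable (at p within S)"
      using dir_deriv_field[OF u p has_dir_deriv[OF hlift_differentiable[OF p]]] unfolding differentiable_def by blast
    then show "(\<lambda>q. hgrad M a u q \<bullet> H q w) differentiable (at p within S)"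
      by (rule differentiable_cong_exterior[OF p, rotated]) (simp add: hgrad_hlift smooth_C2(1)[OF u])
  qed
  ultimately show ?thesis by (simp add: C1_horizontal_def)
qed

lemma hstar_C1_horizontal:
  assumes w: "C1_horizontal \<omega>"
  shows "C1_horizontal (\<lambda>q. hstar M a q (\<omega> q))"
proof -
  have h: "horizontal (\<lambda>q. hstar M a q (\<omega> q))" by (simp add: horizontal_def hstar_null)
  moreover have "(\<lambda>q. hstar M a q (\<omega> q)) differentiable (at p within S)" if p: "p \<in> S" for p
  proof (rule differentiable_from_hlift[OF h p])
    fix w
    have "((\<lambda>q. cross (radial q) w) has_derivative (\<lambda>u. cross (dradial p u) w)) (at p within S)"
      using bounded_linear.has_derivative[OF bounded_bilinear.bounded_linear_left[OF bounded_bilinear_cross]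
        radial_has_derivative[OF rad_pos[OF p]]] .
    from hlift_has_derivative[OF rad_pos[OF p] this]
    have "(\<lambda>q. \<omega> q \<bullet> H q (cross (radial q) w)) differentiable (at p within S)"
      using assms p by (intro differentiable_inner) (auto simp: C1_horizontal_def differentiable_def)
    then show "(\<lambda>q. hstar M a q (\<omega> q) \<bullet> H q w) differentiable (at p within S)"
      by (rule differentiable_cong_exterior[OF p, rotated]) (simp add: hstar_hlift)
  qed
  ultimately show ?thesis by (simp add: C1_horizontal_def)
qed

lemma scaleR_C1_horizontal:
  assumes "C1_horizontal \<omega>" "\<And>p. p \<in> S \<Longrightarrow> f differentiable (at p within S)"
  shows "C1_horizontal (\<lambda>q. f q *\<^sub>R \<omega> q)"
proof -
  have "(\<lambda>q. f q *\<^sub>R \<omega> q) differentiable (at p within S)" if "p \<in> S" for p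
    using assms that by (intro differentiable_scaleR) (auto simp only: C1_horizontal_def)
  with assms(1) show ?thesis by (simp add: C1_horizontal_def horizontal_def)
qed

lemma add_C1_horizontal:
  assumes "C1_horizontal \<omega>" "C1_horizontal \<omega>'"
  shows "C1_horizontal (\<lambda>q. \<omega> q + \<omega>' q)"
  using assms by (simp add: C1_horizontal_def horizontal_def inner_add_left)

lemma linear_hstar: "linear (hstar M a p)"
  by (rule linearI) (simp_all add: hstar_def vec_eq_iff algebra_simps)

lemma hgrad_add:
  assumes "p \<in> S" "f differentiable (at p within S)" "h differentiable (at p within S)"
  shows "hgrad M a (\<lambda>q. f q + h q) p = hgrad M a f p + hgrad M a h p"
  using dir_deriv_eq[OF assms(1) has_derivative_add[OF has_dir_deriv[OF assms(2)] has_dir_deriv[OF assms(3)]]]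
  by (simp add: hgrad_def vec_eq_iff)

lemma hgrad_diff:
  assumes "p \<in> S" "f differentiable (at p within S)" "h differentiable (at p within S)"
  shows "hgrad M a (\<lambda>q. f q - h q) p = hgrad M a f p - hgrad M a h p"
  using dir_deriv_eq[OF assms(1) has_derivative_diff[OF has_dir_deriv[OF assms(2)] has_dir_deriv[OF assms(3)]]]
  by (simp add: hgrad_def vec_eq_iff)

lemma hgrad_mult:
  assumes "p \<in> S" "f differentiable (at p within S)" "h differentiable (at p within S)"
  shows "hgrad M a (\<lambda>q. f q * h q) p = f p *\<^sub>R hgrad M a h p + h p *\<^sub>R hgrad M a f p"
  using dir_deriv_eq[OF assms(1) has_derivative_mult[OF has_dir_deriv[OF assms(2)] has_dir_deriv[OF assms(3)]]]
  by (simp add: hgrad_def vec_eq_iff)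

end

section \<open>Shear-free null fields and the decoupling identity\<close>

text \<open>
  The properties of \<open>e3\<close> and \<open>e4\<close> that matter.  The brackets with lifts are a rotation at rate
  \<open>c\<close> and a multiple \<open>\<zeta>\<close> of the field itself; the radial direction is rotated at the same rate.
  The inner product of two lifts is \<open>\<Sigma>\<close> times the round one, so \<open>\<tau>\<close>, the logarithmic derivative
  of \<open>\<Sigma>\<close>, is the expansion.  The function \<open>\<epsilon>\<close> measures the failure of the lifts to commute and is
  the twist.
\<close>

locale principal_null = kerr_exterior +
  fixes X :: "pt \<Rightarrow> pt" and \<tau> \<epsilon> c :: "pt \<Rightarrow> real" and \<zeta> :: "pt \<Rightarrow> pt"
  assumes X_null: "p \<in> S \<Longrightarrow> X p = e3 p \<or> X p = e4 M a p"
    and X_differentiable: "p \<in> S \<Longrightarrow> X differentiable (at p within S)"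
    and X_orthogonal: "p \<in> S \<Longrightarrow> g p (X p) (H p w) = 0"
    and bracket: "p \<in> S \<Longrightarrow>
      dd X p (H p w) - dhlift a p (X p) w = c p *\<^sub>R H p (rot w) - (\<zeta> p \<bullet> H p w) *\<^sub>R X p"
    and X_radial: "p \<in> S \<Longrightarrow> dradial p (X p) = c p *\<^sub>R rot (radial p)"
    and expansion: "p \<in> S \<Longrightarrow> dd (Sigma_K a) p (X p) = \<tau> p * Sigma_K a p"
    and twist: "p \<in> S \<Longrightarrow> - g p (X p) (dhlift a p (H p w) w' - dhlift a p (H p w') w)
      = \<epsilon> p * (Sigma_K a p * (cross (radial p) w \<bullet> w'))"
    and \<zeta>_horizontal: "horizontal \<zeta>"
    and \<tau>_differentiable: "p \<in> S \<Longrightarrow> \<tau> differentiable (at p within S)"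
    and \<epsilon>_differentiable: "p \<in> S \<Longrightarrow> \<epsilon> differentiable (at p within S)"
begin

abbreviation "DX \<equiv> \<lambda>\<omega> p. hD M a (X p) \<omega> p"

text \<open>
  The Koszul formula for \<open>X\<close> and two lifts, in which the products with \<open>X\<close> vanish.  The
  rotational part of the bracket cancels against the rotation of the radial direction.  Hence the
  symmetric part is the pure trace \<open>\<tau>\<close>, that is, \<open>X\<close> is shear-free; the antisymmetric part comes
  from the bracket of the two lifts.
\<close>

lemma second_fundamental_form:
  assumes p: "p \<in> S"
  shows "2 * g p (dd X p (H p w) + christoffel M a p (H p w) (X p)) (H p w')
    = \<tau> p * g p (H p w) (H p w') + \<epsilon> p * g p (H p (cross (radial p) w)) (H p w')"
proof -
  note r = rad_pos[OF p]
  have Hd: "((\<lambda>q. H q w) has_derivative (\<lambda>u. dhlift a p u w)) (at p within S)" for w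
    using hlift_has_derivative[OF r has_derivative_const] by (simp add: linear_0[OF linear_hlift])
  have zero: "dd (\<lambda>q. g q (X q) (H q w)) p = (\<lambda>u. 0)" for w
  proof -
    have "dd (\<lambda>q. g q (X q) (H q w)) p = dd (\<lambda>q. 0) p"
      by (rule dir_deriv_cong[OF p]) (simp add: X_orthogonal)
    then show ?thesis using dir_deriv_eq[OF p has_derivative_const, of "0::real"] by simp
  qed
  define n where "n = radial p"
  define Q where "Q = spatial w \<bullet> spatial w' - (n \<bullet> w) * (n \<bullet> w')"
  have gg: "dd (\<lambda>q. g q (H q w) (H q w')) p (X p)
    = \<tau> p * Sigma_K a p * Q
      - Sigma_K a p * (c p * ((rot n \<bullet> w) * (n \<bullet> w') + (n \<bullet> w) * (rot n \<bullet> w')))"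
  proof -
    have "dd (\<lambda>q. g q (H q w) (H q w')) p = dd (\<lambda>q. Sigma_K a q * (spatial w \<bullet> spatial w' - (radial q \<bullet> w) * (radial q \<bullet> w'))) p"
      by (rule dir_deriv_cong[OF p]) (simp add: kerr_g_hlift[OF rad_pos a_le])
    also have "\<dots> = (\<lambda>u. Sigma_K a p * (- ((n \<bullet> w) * (dradial p u \<bullet> w') + (dradial p u \<bullet> w) * (n \<bullet> w')))
        + dd (Sigma_K a) p u * Q)"
      unfolding Q_def n_def
      by (rule dir_deriv_eq[OF p], rule has_derivative_eq_rhs,
          (rule derivative_intros radial_has_derivative[OF r]
            has_dir_deriv[OF differentiableI[OF Sigma_has_derivative[OF r]]])+) simp
    finally show ?thesis
      using expansion[OF p] by (simp add: X_radial[OF p] n_def algebra_simps)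
  qed
  have sr: "spatial (rot v) \<bullet> spatial w = rot v \<bullet> w" "n \<bullet> rot v = - (rot n \<bullet> v)" for v w
    by (simp_all add: vec4_simps)
  have rr: "rot w' \<bullet> w = - (rot w \<bullet> w')" by (simp add: vec4_simps)
  have sc: "spatial (cross n v) \<bullet> spatial w = cross n v \<bullet> w" "n \<bullet> cross n v = 0" for v w
    by (simp_all add: vec4_simps algebra_simps)
  have "2 * g p (dd X p (H p w) + christoffel M a p (H p w) (X p)) (H p w')
    = dd (\<lambda>q. g q (H q w) (H q w')) p (X p) + g p (dd X p (H p w) - dhlift a p (X p) w) (H p w')
      + g p (dd X p (H p w') - dhlift a p (X p) w') (H p w)
      - g p (X p) (dhlift a p (H p w) w' - dhlift a p (H p w') w)"
    using koszul[OF p has_dir_deriv[OF X_differentiable[OF p]] Hd Hd, of w w'] by (simp add: zero)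
  also have "\<dots> = \<tau> p * (Sigma_K a p * Q) + \<epsilon> p * (Sigma_K a p * (cross n w \<bullet> w'))"
    using twist[OF p, of w w'] unfolding gg bracket[OF p] n_def[symmetric]
    by (simp add: kerr_g_bilinear X_orthogonal[OF p] kerr_g_hlift[OF r a_le] n_def[symmetric] sr rr algebra_simps)
  finally show ?thesis
    unfolding kerr_g_hlift[OF r a_le] n_def[symmetric] Q_def sc by simp
qed

lemma horizontal_form_second_fundamental_form:
  assumes p: "p \<in> S" and h: "x \<bullet> e3 p = 0" "x \<bullet> e4 M a p = 0"
  shows "x \<bullet> (dd X p (H p w) + christoffel M a p (H p w) (X p))
    = \<tau> p / 2 * (x \<bullet> H p w) + \<epsilon> p / 2 * (x \<bullet> H p (cross (radial p) w))"
proof -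
  note r = rad_pos[OF p]
  define N where "N = dd X p (H p w) + christoffel M a p (H p w) (X p)"
  \<comment> \<open>the difference of the two sides as horizontal vectors; it is a lift and orthogonal to itself\<close>
  define d where "d = hproj M a p N - ((\<tau> p / 2) *\<^sub>R H p w + (\<epsilon> p / 2) *\<^sub>R H p (cross (radial p) w))"
  obtain w' where w': "d = H p w'"
  proof
    show "d = H p ((1 / rad p) *\<^sub>R hproj M a p N - ((\<tau> p / 2) *\<^sub>R w + (\<epsilon> p / 2) *\<^sub>R cross (radial p) w))"
      unfolding linear_diff[OF linear_hlift] hproj_hlift[OF r a_le, symmetric] hlift_add
      by (simp add: d_def hlift_scaleR)
  qed
  have "g p (hproj M a p N) (H p w') = g p N (H p w')"
    using kerr_g_hlift_null[OF r a_le] by (simp add: hproj_def kerr_g_bilinear)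
  then have "g p d (H p w') = 0"
    using second_fundamental_form[OF p, of w w'] unfolding N_def[symmetric]
    by (simp add: d_def kerr_g_bilinear)
  then have "d = 0"
    using horizontal_eq_0[OF r a_le, of d] kerr_g_hlift_null[OF r a_le] unfolding w' by blast
  then have "x \<bullet> hproj M a p N = \<tau> p / 2 * (x \<bullet> H p w) + \<epsilon> p / 2 * (x \<bullet> H p (cross (radial p) w))"
    by (simp add: d_def inner_add_right)
  then show ?thesis using inner_hproj[OF h] by (simp add: N_def)
qed

lemma inner_X:
  assumes "horizontal \<omega>" "p \<in> S"
  shows "\<omega> p \<bullet> X p = 0"
  using X_null[OF assms(2)] assms by (auto simp: horizontal_def)

text \<open>
  Torsion-freeness replaces \<open>\<nabla>\<^sub>X H\<close> by the bracket and \<open>\<nabla>\<^sub>H X\<close>, both of which are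
  known.
\<close>

lemma DX_hlift:
  assumes p: "p \<in> S" and w: "C1_horizontal \<omega>"
  shows "DX \<omega> p \<bullet> H p w = dd (\<lambda>q. \<omega> q \<bullet> H q w) p (X p) + c p * (\<omega> p \<bullet> H p (rot w))
    - \<tau> p / 2 * (\<omega> p \<bullet> H p w) - \<epsilon> p / 2 * (\<omega> p \<bullet> H p (cross (radial p) w))"
proof -
  have h: "horizontal \<omega>" and d: "\<omega> differentiable (at p within S)" using w p by (auto simp: C1_horizontal_def)
  have h': "\<omega> p \<bullet> e3 p = 0" "\<omega> p \<bullet> e4 M a p = 0" using h p by (auto simp: horizontal_def)
  have "\<omega> p \<bullet> (dd X p (H p w) - dhlift a p (X p) w) = c p * (\<omega> p \<bullet> H p (rot w))"
    unfolding bracket[OF p] by (simp add: inner_diff_right inner_X[OF h p])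
  then show ?thesis
    using hD_hlift[OF p d h, of "X p" w] horizontal_form_second_fundamental_form[OF p h', of w]
      christoffel_sym[of p "X p" "H p w"]
    by (simp add: inner_add_right inner_diff_right)
qed

lemma DX_null:
  assumes "p \<in> S" "C1_horizontal \<omega>"
  shows "DX \<omega> p \<bullet> e3 p = 0" "DX \<omega> p \<bullet> e4 M a p = 0"
  using hD_null[OF assms(1)] assms by (auto simp: C1_horizontal_def)

text \<open>
  The star turns a lift by the cross product with the radial direction.  The derivative of the radial
  direction along \<open>X\<close> is a rotation at rate \<open>c\<close>, and the cross product is equivariant under
  rotations.
\<close>

lemma DX_hstar:
  assumes p: "p \<in> S" and w: "C1_horizontal \<omega>"
  shows "DX (\<lambda>q. hstar M a q (\<omega> q)) p = hstar M a p (DX \<omega> p)"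
proof (rule horizontal_eqI[OF p])
  note s = hstar_C1_horizontal[OF w]
  note r = rad_pos[OF p]
  show "DX (\<lambda>q. hstar M a q (\<omega> q)) p \<bullet> e3 p = 0" "DX (\<lambda>q. hstar M a q (\<omega> q)) p \<bullet> e4 M a p = 0"
    by (rule DX_null[OF p s])+
  show "hstar M a p (DX \<omega> p) \<bullet> e3 p = 0" "hstar M a p (DX \<omega> p) \<bullet> e4 M a p = 0"
    by (rule hstar_null[OF p])+
  fix w
  have \<omega>d: "\<omega> differentiable (at p within S)" using assms by (auto simp: C1_horizontal_def)
  define w' where "w' = cross (radial p) w"
  have cd: "((\<lambda>q. cross (radial q) w) has_derivative (\<lambda>u. cross (dradial p u) w)) (at p within S)"
    using bounded_linear.has_derivative[OF bounded_bilinear.bounded_linear_left[OF bounded_bilinear_cross]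
      radial_has_derivative[OF rad_pos[OF p]]] .
  have 1: "dd (\<lambda>q. \<omega> q \<bullet> H q (cross (radial q) w)) p (X p)
      = dd (\<lambda>q. \<omega> q \<bullet> H q w') p (X p) + \<omega> p \<bullet> H p (cross (dradial p (X p)) w)"
    using dir_deriv_eq[OF p has_derivative_inner[OF has_dir_deriv[OF \<omega>d] hlift_has_derivative[OF r cd]]]
      dir_deriv_eq[OF p has_derivative_inner[OF has_dir_deriv[OF \<omega>d] hlift_has_derivative[OF r has_derivative_const[of w']]]]
    by (simp add: w'_def linear_0[OF linear_hlift] inner_add_right)
  have 2: "dd (\<lambda>q. hstar M a q (\<omega> q) \<bullet> H q w) p = dd (\<lambda>q. \<omega> q \<bullet> H q (cross (radial q) w)) p"
    by (rule dir_deriv_cong[OF p]) (simp add: hstar_hlift)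
  have rc: "rot w' = cross (rot (radial p)) w + cross (radial p) (rot w)"
    by (simp add: w'_def vec4_simps algebra_simps)
  have cs: "cross (k *\<^sub>R v) w = k *\<^sub>R cross v w" for k v by (simp add: vec4_simps algebra_simps)
  show "DX (\<lambda>q. hstar M a q (\<omega> q)) p \<bullet> H p w = hstar M a p (DX \<omega> p) \<bullet> H p w"
    unfolding DX_hlift[OF p s] hstar_hlift[OF p] w'_def[symmetric] DX_hlift[OF p w] 2 1 X_radial[OF p] cs rc hlift_add hlift_scaleR
    by (simp add: inner_add_right distrib_left)
qed

lemma hstar_hstar:
  assumes p: "p \<in> S" and h: "x \<bullet> e3 p = 0" "x \<bullet> e4 M a p = 0"
  shows "hstar M a p (hstar M a p x) = - x"
  by (rule horizontal_eqI[OF p hstar_null[OF p]])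
    (simp_all add: h hstar_hlift[OF p] hlift_cross_cross[OF p])

text \<open>
  The commutator of \<open>D\<^sub>X\<close> with \<open>D\<close> on functions.  Second derivatives being symmetric, it is the
  bracket of \<open>X\<close> with lifts together with the second fundamental form; the rotational part of the
  bracket cancels against the one in \<open>DX_hlift\<close>.
\<close>

lemma DX_hgrad:
  assumes p: "p \<in> S" and u: "smooth_on S u"
  shows "DX (hgrad M a u) p = hgrad M a (\<lambda>q. dd u q (X q)) p + dd u p (X p) *\<^sub>R \<zeta> p
    - (\<tau> p / 2) *\<^sub>R hgrad M a u p - (\<epsilon> p / 2) *\<^sub>R hstar M a p (hgrad M a u p)"
proof (rule horizontal_eqI[OF p])
  note s = hgrad_C1_horizontal[OF u]
  note r = rad_pos[OF p]
  note ud = smooth_C2(1)[OF u p]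
  note Xu = dir_deriv_field[OF u p has_dir_deriv[OF X_differentiable[OF p]]]
  note Xud = differentiableI[OF Xu]
  show "DX (hgrad M a u) p \<bullet> e3 p = 0" "DX (hgrad M a u) p \<bullet> e4 M a p = 0"
    by (rule DX_null[OF p s])+
  let ?R = "hgrad M a (\<lambda>q. dd u q (X q)) p + dd u p (X p) *\<^sub>R \<zeta> p
    - (\<tau> p / 2) *\<^sub>R hgrad M a u p - (\<epsilon> p / 2) *\<^sub>R hstar M a p (hgrad M a u p)"
  have z: "\<zeta> p \<bullet> e3 p = 0" "\<zeta> p \<bullet> e4 M a p = 0" using \<zeta>_horizontal p by (auto simp: horizontal_def)
  show "?R \<bullet> e3 p = 0" "?R \<bullet> e4 M a p = 0"
    by (simp_all add: inner_add_left inner_diff_left z hstar_null[OF p] hgrad_hlift[OF p ud] hgrad_hlift[OF p Xud])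
  fix w
  have Hd: "((\<lambda>q. H q w) has_derivative (\<lambda>u. dhlift a p u w)) (at p within S)"
    using hlift_has_derivative[OF r has_derivative_const] by (simp add: linear_0[OF linear_hlift])
  have 1: "dd (\<lambda>q. hgrad M a u q \<bullet> H q w) p = dd (\<lambda>q. dd u q (H q w)) p"
    by (rule dir_deriv_cong[OF p]) (simp add: hgrad_hlift smooth_C2(1)[OF u])
  have 2: "dd (\<lambda>q. dd u q (H q w)) p (X p) = dd (\<lambda>q. dd u q (H p w)) p (X p) + dd u p (dhlift a p (X p) w)"
    using dir_deriv_eq[OF p dir_deriv_field[OF u p Hd]] by simp
  have 3: "dd (\<lambda>q. dd u q (X q)) p (H p w) = dd (\<lambda>q. dd u q (X p)) p (H p w) + dd u p (dd X p (H p w))"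
    using dir_deriv_eq[OF p Xu] by simp
  note lin = linear_dir_deriv[OF ud]
  have "dd u p (dd X p (H p w)) - dd u p (dhlift a p (X p) w) = c p * dd u p (H p (rot w)) - (\<zeta> p \<bullet> H p w) * dd u p (X p)"
    using arg_cong[OF bracket[OF p, of w], of "dd u p"]
    by (simp add: linear_diff[OF lin] linear_scale[OF lin])
  then show "DX (hgrad M a u) p \<bullet> H p w = ?R \<bullet> H p w"
    unfolding DX_hlift[OF p s] 1 2
    using 3 dir_deriv_commute[OF u p, of "H p w" "X p"]
    by (simp add: inner_add_left inner_diff_left hgrad_hlift[OF p ud] hgrad_hlift[OF p Xud] hstar_hlift[OF p])
      (simp add: algebra_simps)
qed

text \<open>
  The common core of both wave equations.  Expanding \<open>D\<^sub>X \<beta>\<close> by the Leibniz rule and the commutator,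
  the second derivatives and the first derivatives of \<open>u\<close> and \<open>v\<close> agree on both sides for every
  \<open>\<xi>\<close>, owing to the coefficients \<open>3/2\<close> and \<open>-1/2\<close>.  The terms with \<open>u\<close> undifferentiated
  agree by the structure equation, those with \<open>v\<close> by its Hodge dual.
\<close>

theorem decoupling_identity:
  assumes u: "smooth_on S u" and v: "smooth_on S v" and \<xi>: "C1_horizontal \<xi>"
    and structure_eq: "\<And>p. p \<in> S \<Longrightarrow> 2 *\<^sub>R DX \<xi> p + (2 * \<epsilon> p) *\<^sub>R hstar M a p (\<xi> p)
      = hgrad M a \<tau> p - hstar M a p (hgrad M a \<epsilon> p) + \<tau> p *\<^sub>R (\<zeta> p - \<xi> p)
        - \<epsilon> p *\<^sub>R hstar M a p (\<zeta> p - \<xi> p)"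
    and \<beta>: "\<And>q. q \<in> S \<Longrightarrow> \<beta> q = hgrad M a u q + hstar M a q (hgrad M a v q)
      + (2 * u q) *\<^sub>R \<xi> q + (2 * v q) *\<^sub>R hstar M a q (\<xi> q)"
    and p: "p \<in> S"
  shows "DX \<beta> p + (3/2 * \<tau> p) *\<^sub>R \<beta> p - (1/2 * \<epsilon> p) *\<^sub>R hstar M a p (\<beta> p)
    = D_plus M a (\<lambda>q. 2 *\<^sub>R \<xi> q + \<zeta> q) (\<lambda>q. dd u q (X q) + \<tau> q * u q + \<epsilon> q * v q) p
      + star_D_plus M a (\<lambda>q. 2 *\<^sub>R \<xi> q + \<zeta> q) (\<lambda>q. dd v q (X q) + \<tau> q * v q - \<epsilon> q * u q) p"
proof -
  note ud = smooth_C2(1)[OF u] and vd = smooth_C2(1)[OF v]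
  note Xud = differentiableI[OF dir_deriv_field[OF u p has_dir_deriv[OF X_differentiable[OF p]]]]
  note Xvd = differentiableI[OF dir_deriv_field[OF v p has_dir_deriv[OF X_differentiable[OF p]]]]
  note C = hgrad_C1_horizontal[OF u] hgrad_C1_horizontal[OF v]
  have d2: "(\<lambda>q. 2 * u q) differentiable (at q within S)" "(\<lambda>q. 2 * v q) differentiable (at q within S)" if "q \<in> S" for q
    using ud[OF that] vd[OF that] by simp_all
  have dd2: "dd (\<lambda>q. 2 * u q) p = (\<lambda>x. 2 * dd u p x)" "dd (\<lambda>q. 2 * v q) p = (\<lambda>x. 2 * dd v p x)"
    by (rule dir_deriv_eq[OF p has_derivative_mult_right[OF has_dir_deriv[OF ud[OF p]]]]
        dir_deriv_eq[OF p has_derivative_mult_right[OF has_dir_deriv[OF vd[OF p]]]])+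
  note s\<xi> = hstar_C1_horizontal[OF \<xi>]
  have "DX \<beta> p = DX (\<lambda>q. hgrad M a u q + hstar M a q (hgrad M a v q) + (2 * u q) *\<^sub>R \<xi> q + (2 * v q) *\<^sub>R hstar M a q (\<xi> q)) p"
    by (rule hD_cong[OF p \<beta>])
  also have "\<dots> = DX (hgrad M a u) p + DX (\<lambda>q. hstar M a q (hgrad M a v q)) p + DX (\<lambda>q. (2 * u q) *\<^sub>R \<xi> q) p
      + DX (\<lambda>q. (2 * v q) *\<^sub>R hstar M a q (\<xi> q)) p"
    by (simp add: hD_add[OF p] add_C1_horizontal scaleR_C1_horizontal hstar_C1_horizontal C \<xi> d2)
  also have "\<dots> = DX (hgrad M a u) p + hstar M a p (DX (hgrad M a v) p)
      + ((2 * u p) *\<^sub>R DX \<xi> p + (2 * dd u p (X p)) *\<^sub>R \<xi> p)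
      + ((2 * v p) *\<^sub>R hstar M a p (DX \<xi> p) + (2 * dd v p (X p)) *\<^sub>R hstar M a p (\<xi> p))"
    by (simp add: DX_hstar[OF p] C \<xi> s\<xi> hD_scaleR[OF p] d2[OF p] dd2)
  finally have D\<beta>: "DX \<beta> p = \<dots>" .
  have A: "hgrad M a (\<lambda>q. dd u q (X q) + \<tau> q * u q + \<epsilon> q * v q) p
      = hgrad M a (\<lambda>q. dd u q (X q)) p + (\<tau> p *\<^sub>R hgrad M a u p + u p *\<^sub>R hgrad M a \<tau> p)
        + (\<epsilon> p *\<^sub>R hgrad M a v p + v p *\<^sub>R hgrad M a \<epsilon> p)"
    by (simp add: hgrad_add[OF p] hgrad_mult[OF p] Xud \<tau>_differentiable[OF p] \<epsilon>_differentiable[OF p] ud[OF p] vd[OF p])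
  have B: "hgrad M a (\<lambda>q. dd v q (X q) + \<tau> q * v q - \<epsilon> q * u q) p
      = hgrad M a (\<lambda>q. dd v q (X q)) p + (\<tau> p *\<^sub>R hgrad M a v p + v p *\<^sub>R hgrad M a \<tau> p)
        - (\<epsilon> p *\<^sub>R hgrad M a u p + u p *\<^sub>R hgrad M a \<epsilon> p)"
    by (simp add: hgrad_add[OF p] hgrad_diff[OF p] hgrad_mult[OF p] Xvd \<tau>_differentiable[OF p] \<epsilon>_differentiable[OF p] ud[OF p] vd[OF p])
  interpret J: linear "hstar M a p" by (rule linear_hstar)
  have JJ: "hstar M a p (hstar M a p (\<omega> p)) = - \<omega> p" if "horizontal \<omega>" for \<omega>
    using hstar_hstar[OF p] that p by (simp add: horizontal_def)
  have hor: "horizontal \<xi>" "horizontal (hgrad M a u)" "horizontal (hgrad M a v)" "horizontal (hgrad M a \<epsilon>)"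
    using \<xi> C \<epsilon>_differentiable by (auto simp: C1_horizontal_def horizontal_def hgrad_hlift)
  note JJ = JJ[OF hor(1)] JJ[OF hor(2)] JJ[OF hor(3)] JJ[OF hor(4)] JJ[OF \<zeta>_horizontal]
  have E2: "hstar M a p (2 *\<^sub>R DX \<xi> p + (2 * \<epsilon> p) *\<^sub>R hstar M a p (\<xi> p))
      = hstar M a p (hgrad M a \<tau> p - hstar M a p (hgrad M a \<epsilon> p) + \<tau> p *\<^sub>R (\<zeta> p - \<xi> p)
        - \<epsilon> p *\<^sub>R hstar M a p (\<zeta> p - \<xi> p))"
    by (simp only: structure_eq[OF p])
  note Jl = J.add J.diff J.scale J.neg JJ
  show ?thesis
  proof (rule vector_eq_rdot[THEN iffD1, rule_format])
    fix z :: pt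
    have E1': "2 * (DX \<xi> p \<bullet> z) + 2 * \<epsilon> p * (hstar M a p (\<xi> p) \<bullet> z)
      = hgrad M a \<tau> p \<bullet> z - hstar M a p (hgrad M a \<epsilon> p) \<bullet> z + \<tau> p * (\<zeta> p \<bullet> z - \<xi> p \<bullet> z)
        - \<epsilon> p * (hstar M a p (\<zeta> p) \<bullet> z - hstar M a p (\<xi> p) \<bullet> z)"
      using arg_cong[OF structure_eq[OF p], of "\<lambda>x. x \<bullet> z"] by (simp add: Jl inner_simps)
    have E2': "2 * (hstar M a p (DX \<xi> p) \<bullet> z) - 2 * \<epsilon> p * (\<xi> p \<bullet> z)
      = hstar M a p (hgrad M a \<tau> p) \<bullet> z + hgrad M a \<epsilon> p \<bullet> z + \<tau> p * (hstar M a p (\<zeta> p) \<bullet> z - hstar M a p (\<xi> p) \<bullet> z)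
        + \<epsilon> p * (\<zeta> p \<bullet> z - \<xi> p \<bullet> z)"
      using arg_cong[OF E2, of "\<lambda>x. x \<bullet> z"] by (simp add: Jl inner_simps) (simp add: algebra_simps)
    \<comment> \<open>the sum of \<open>u p\<close> times the structure equation and \<open>v p\<close> times its dual\<close>
    show "(DX \<beta> p + (3/2 * \<tau> p) *\<^sub>R \<beta> p - (1/2 * \<epsilon> p) *\<^sub>R hstar M a p (\<beta> p)) \<bullet> z
     = (D_plus M a (\<lambda>q. 2 *\<^sub>R \<xi> q + \<zeta> q) (\<lambda>q. dd u q (X q) + \<tau> q * u q + \<epsilon> q * v q) p
      + star_D_plus M a (\<lambda>q. 2 *\<^sub>R \<xi> q + \<zeta> q) (\<lambda>q. dd v q (X q) + \<tau> q * v q - \<epsilon> q * u q) p) \<bullet> z"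
      unfolding D\<beta> \<beta>[OF p] star_D_plus_def D_plus_def A B DX_hgrad[OF p u] DX_hgrad[OF p v]
        Jl inner_add_left inner_diff_left inner_minus_left inner_scaleR_left
      using E1' E2' by algebra
  qed
qed

end

section \<open>The two principal null directions of Kerr\<close>

lemma d_th_eq:
  assumes "rad p > 0"
  shows "sinth p * (d_th p \<bullet> u) = - (u $ 4 - radial p $ 4 * (radial p \<bullet> u)) / rad p"
proof -
  define s c s' c' R where "s = sinth p" "c = costh p" "s' = sinph p" "c' = cosph p" "R = rad p"
  note d = this
  have 1: "s\<^sup>2 + c\<^sup>2 = 1" and R: "R \<noteq> 0"
    using trig_identities[OF assms] assms by (auto simp: d)
  have th: "d_th p \<bullet> u = (c * c' * u$2 + c * s' * u$3 - s * u$4) / R"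
    using R by (simp add: d_th_def v_th_def vec4_simps d[symmetric] power2_eq_square field_simps)
  have n: "radial p \<bullet> u = s * c' * u$2 + s * s' * u$3 + c * u$4"
    by (simp add: v_r_eq[symmetric] v_r_def vec4_simps d[symmetric])
  have "s * (c * c' * u$2 + c * s' * u$3 - s * u$4) = - (u$4 - c * (s * c' * u$2 + s * s' * u$3 + c * u$4))"
    using 1 by algebra
  then show ?thesis unfolding th n costh_eq[symmetric] d(1,2,5)[symmetric] using R
    by (simp add: field_simps)
qed

lemma eta_inner:
  assumes "rad p > 0"
  shows "eta a p \<bullet> v = - (a\<^sup>2 * rad p * (1 - (radial p $ 4)\<^sup>2) / (Sigma_K a p)\<^sup>2) * v $ 1
      + a\<^sup>2 * radial p $ 4 / Sigma_K a p * ((v $ 4 - radial p $ 4 * (radial p \<bullet> v)) / rad p)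
      + a * rad p * ((rad p)\<^sup>2 + a\<^sup>2) / (Sigma_K a p)\<^sup>2 * (rot (radial p) \<bullet> v / rad p)" (is ?eta)
    and "etab a p \<bullet> v = a\<^sup>2 * rad p * (1 - (radial p $ 4)\<^sup>2) / (Sigma_K a p)\<^sup>2 * v $ 1
      + a\<^sup>2 * radial p $ 4 / Sigma_K a p * ((v $ 4 - radial p $ 4 * (radial p \<bullet> v)) / rad p)
      - a * rad p * ((rad p)\<^sup>2 + a\<^sup>2) / (Sigma_K a p)\<^sup>2 * (rot (radial p) \<bullet> v / rad p)" (is ?etab)
proof -
  have t: "d_t p \<bullet> v = v $ 1" by (simp add: d_t_def v_t_eq inner_axis')
  have "a\<^sup>2 * (2 * sinth p * costh p) / (2 * Sigma_K a p) * (d_th p \<bullet> v)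
      = a\<^sup>2 * costh p / Sigma_K a p * (sinth p * (d_th p \<bullet> v))"
    by (simp add: field_simps)
  note th = this[unfolded d_th_eq[OF assms]]
  have ph: "x * sinth p * (d_phs p \<bullet> v) = x * (rot (radial p) \<bullet> v / rad p)" for x
    unfolding d_phs_eq[OF assms, symmetric] by simp
  show ?eta ?etab
    unfolding eta_def etab_def inner_add_left inner_diff_left inner_scaleR_left inner_minus_left t th ph
      sinth_sq[OF assms]
    unfolding costh_eq by (simp_all add: algebra_simps diff_divide_distrib)
qed

text \<open>
  The two angular functions are \<open>sin\<^sup>2\<theta> d\<phi>\<close> and \<open>d(cos \<theta>)\<close> on the lift of \<open>w\<close>.  In particular the
  sum of \<open>eta\<close> and \<open>etab\<close> is the horizontal gradient of \<open>log \<Sigma>\<close>.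
\<close>

lemma eta_hlift:
  assumes r: "rad p > 0"
  defines "\<psi> \<equiv> \<lambda>w. rot (radial p) \<bullet> w" and "\<kappa> \<equiv> \<lambda>w. w $ 4 - radial p $ 4 * (radial p \<bullet> w)"
  shows "eta a p \<bullet> hlift a p w = a * rad p / Sigma_K a p * \<psi> w + a\<^sup>2 * radial p $ 4 / Sigma_K a p * \<kappa> w"
    and "etab a p \<bullet> hlift a p w = - (a * rad p / Sigma_K a p * \<psi> w) + a\<^sup>2 * radial p $ 4 / Sigma_K a p * \<kappa> w"
proof -
  define R S c where "R = rad p" "S = Sigma_K a p" "c = radial p $ 4"
  note d = this
  have R: "R \<noteq> 0" and S: "S \<noteq> 0" and Sd: "S = R\<^sup>2 + a\<^sup>2 * c\<^sup>2"
    using r Sigma_pos[OF r, of a] by (simp_all add: d Sigma_eq)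
  have 1: "hlift a p w $ 1 = a * \<psi> w" by (simp add: hlift_def \<psi>_def)
  have 4: "hlift a p w $ 4 - c * (radial p \<bullet> hlift a p w) = R * \<kappa> w"
    unfolding radial_hlift[OF r] by (simp add: hlift_def \<kappa>_def d)
  have p: "rot (radial p) \<bullet> hlift a p w = R * \<psi> w"
    unfolding hlift_def by (simp add: inner_simps radial_unit[OF r] \<psi>_def d) (simp add: vec4_simps)
  have e: "- (a\<^sup>2 * R * (1 - c\<^sup>2) / S\<^sup>2) * (a * \<psi> w) + a * R * (R\<^sup>2 + a\<^sup>2) / S\<^sup>2 * \<psi> w = a * R / S * \<psi> w"
  proof -
    have "- (a\<^sup>2 * R * (1 - c\<^sup>2)) * (a * \<psi> w) + a * R * (R\<^sup>2 + a\<^sup>2) * \<psi> w = a * R * S * \<psi> w"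
      unfolding Sd by (simp add: algebra_simps power2_eq_square)
    then have "(- (a\<^sup>2 * R * (1 - c\<^sup>2)) * (a * \<psi> w) + a * R * (R\<^sup>2 + a\<^sup>2) * \<psi> w) / S\<^sup>2 = a * R * S * \<psi> w / S\<^sup>2"
      by (rule arg_cong)
    also have "\<dots> = a * R / S * \<psi> w" using S by (simp add: power2_eq_square)
    finally show ?thesis by (simp add: add_divide_distrib diff_divide_distrib)
  qed
  show "eta a p \<bullet> hlift a p w = a * rad p / Sigma_K a p * \<psi> w + a\<^sup>2 * radial p $ 4 / Sigma_K a p * \<kappa> w"
    unfolding eta_inner[OF r] d[symmetric] 1 4 p using e R by simp
  show "etab a p \<bullet> hlift a p w = - (a * rad p / Sigma_K a p * \<psi> w) + a\<^sup>2 * radial p $ 4 / Sigma_K a p * \<kappa> w"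
    unfolding eta_inner[OF r] d[symmetric] 1 4 p using e R by simp
qed

lemma eta_null:
  assumes r: "rad p > 0"
  shows "eta a p \<bullet> e3 p = 0" "etab a p \<bullet> e3 p = 0" "eta a p \<bullet> e4 M a p = 0" "etab a p \<bullet> e4 M a p = 0"
proof -
  define R S c where "R = rad p" "S = Sigma_K a p" "c = radial p $ 4"
  note d = this
  have R: "R \<noteq> 0" and S: "S \<noteq> 0" and Sd: "S = R\<^sup>2 + a\<^sup>2 * c\<^sup>2"
    using r Sigma_pos[OF r, of a] by (simp_all add: d Sigma_eq)
  have n: "(radial p $ 2)\<^sup>2 + (radial p $ 3)\<^sup>2 = 1 - c\<^sup>2" using radial_sum_squares[OF r] by (simp add: d)
  have e3: "e3 p $ 1 = 0" "e3 p $ 4 - c * (radial p \<bullet> e3 p) = 0" "rot (radial p) \<bullet> e3 p = 0"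
    by (simp_all add: e3_eq radial_unit[OF r] d)
  show "eta a p \<bullet> e3 p = 0" "etab a p \<bullet> e3 p = 0"
    unfolding eta_inner[OF r] d[symmetric] e3 by simp_all
  have rp: "rot p = R *\<^sub>R rot (radial p)" using r by (simp add: vec4_simps radial_def d)
  have rr: "rot (radial p) \<bullet> rot (radial p) = 1 - c\<^sup>2" using n by (simp add: vec4_simps power2_eq_square)
  have e41: "e4 M a p $ 1 = 2 * (R\<^sup>2 + a\<^sup>2) / S"
    unfolding e4_eq[OF r] by (simp add: d)
  have e44: "e4 M a p $ 4 - c * (radial p \<bullet> e4 M a p) = 0"
    unfolding e4_radial[OF r] unfolding e4_eq[OF r] by (simp add: d)
  have e4r: "rot (radial p) \<bullet> e4 M a p = 2 * a * R * (1 - c\<^sup>2) / S"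
    unfolding e4_eq[OF r] rp by (simp add: inner_simps radial_unit[OF r] rr inner_axis d)
  show "eta a p \<bullet> e4 M a p = 0" "etab a p \<bullet> e4 M a p = 0"
    unfolding eta_inner[OF r] d[symmetric] e41 e44 e4r using R S by (simp_all add: field_simps power2_eq_square)
qed

lemma radial_bracket_hlift:
  assumes r: "rad p > 0"
  shows "radial p \<bullet> (dhlift a p (hlift a p w) w' - dhlift a p (hlift a p w') w) = 0"
  unfolding dhlift_def radial_hlift[OF r] dradial_hlift[OF r]
  by (simp add: inner_simps radial_unit[OF r] inner_axis) (simp add: vec4_simps algebra_simps)

context kerr_exterior
begin

lemma tr_eps_differentiable:
  assumes p: "p \<in> S"
  shows "tr_chi M a differentiable (at p within S)" "eps_chi M a differentiable (at p within S)"
    "tr_chib a differentiable (at p within S)" "eps_chib a differentiable (at p within S)"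
proof -
  note r = rad_pos[OF p]
  have S0: "Sigma_K a p \<noteq> 0" "(Sigma_K a p)\<^sup>2 \<noteq> 0" using Sigma_pos[OF r, of a] by simp_all
  have R: "rad differentiable (at p within S)"
      "Sigma_K a differentiable (at p within S)" "Delta M a differentiable (at p within S)"
    using rad_has_derivative[OF r] Sigma_has_derivative[OF r]
      Delta_has_derivative[OF r a_le] unfolding differentiable_def by blast+
  have r4: "(\<lambda>q. radial q $ 4) differentiable (at p within S)"
    using bounded_linear.has_derivative[OF bounded_linear_vec_nth radial_has_derivative[OF r]]
    unfolding differentiable_def by blast
  show "tr_chi M a differentiable (at p within S)" "eps_chi M a differentiable (at p within S)"
    "tr_chib a differentiable (at p within S)" "eps_chib a differentiable (at p within S)"
    unfolding tr_chi_def[abs_def] eps_chi_def[abs_def] tr_chib_def[abs_def] eps_chib_def[abs_def] costh_eq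
    by (intro differentiable_minus differentiable_divide differentiable_mult differentiable_power R r4 S0 differentiable_const)+
qed

lemma dir_deriv_Sigma:
  assumes p: "p \<in> S"
  shows "dd (Sigma_K a) p u = 2 * rad p * (radial p \<bullet> u) + 2 * a\<^sup>2 * radial p $ 4 * dradial p u $ 4"
  using dir_deriv_eq[OF p Sigma_has_derivative[OF rad_pos[OF p]]] by simp

lemma horizontal_eta: "horizontal (eta a)" "horizontal (etab a)"
  by (simp_all add: horizontal_def eta_null rad_pos)

lemma eta_plus_etab_hlift:
  assumes p: "p \<in> S"
  shows "Sigma_K a p * ((eta a p + etab a p) \<bullet> H p w) = dd (Sigma_K a) p (H p w)"
  using Sigma_pos[OF rad_pos[OF p], of a]
  by (simp add: dir_deriv_Sigma[OF p] radial_hlift[OF rad_pos[OF p]] dradial_hlift[OF rad_pos[OF p]] inner_add_left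
      eta_hlift[OF rad_pos[OF p]] algebra_simps)

sublocale e4: principal_null M a "e4 M a" "tr_chi M a" "eps_chi M a" "\<lambda>p. 2 * a / Sigma_K a p"
  "\<lambda>p. eta a p + etab a p"
proof
  fix p assume p: "p \<in> S"
  note r = rad_pos[OF p]
  have S0: "Sigma_K a p \<noteq> 0" using Sigma_pos[OF r, of a] by simp
  show "e4 M a p = e3 p \<or> e4 M a p = e4 M a p" by simp
  show "e4 M a differentiable (at p within S)" by (rule null_differentiable[OF p])
  show "g p (e4 M a p) (H p w) = 0" for w by (rule kerr_g_hlift_null[OF r a_le])
  show "dradial p (e4 M a p) = (2 * a / Sigma_K a p) *\<^sub>R rot (radial p)" by (rule e4_radial[OF r])
  have z: "(eta a p + etab a p) \<bullet> H p w = 2 * a\<^sup>2 * radial p $ 4 * (w $ 4 - (radial p \<bullet> w) * radial p $ 4) / Sigma_K a p" for w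
    using S0 by (simp add: inner_add_left eta_hlift[OF r] field_simps)
  show "dd (e4 M a) p (H p w) - dhlift a p (e4 M a p) w
    = (2 * a / Sigma_K a p) *\<^sub>R H p (rot w) - ((eta a p + etab a p) \<bullet> H p w) *\<^sub>R e4 M a p" for w
    using bracket_e4[OF r, of a w M] dir_deriv_eq[OF p e4_has_derivative[OF r a_le p]] unfolding z by simp
  show "dd (Sigma_K a) p (e4 M a p) = tr_chi M a p * Sigma_K a p"
    using S0 by (simp add: dir_deriv_Sigma[OF p] e4_radial[OF r] tr_chi_def power2_eq_square)
  show "- g p (e4 M a p) (dhlift a p (H p w) w' - dhlift a p (H p w') w)
      = eps_chi M a p * (Sigma_K a p * (cross (radial p) w \<bullet> w'))" for w w'
    unfolding kerr_g_e4[OF r a_le] contact_form_bracket_hlift[OF r] radial_bracket_hlift[OF r]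
    using S0 by (simp add: eps_chi_def costh_eq power2_eq_square)
  show "tr_chi M a differentiable (at p within S)" "eps_chi M a differentiable (at p within S)"
    by (rule tr_eps_differentiable[OF p])+
next
  show "horizontal (\<lambda>p. eta a p + etab a p)"
    using horizontal_eta by (simp add: horizontal_def inner_add_left)
qed

sublocale e3: principal_null M a e3 "tr_chib a" "eps_chib a" "\<lambda>p. 0" "\<lambda>p. 0"
proof
  fix p assume p: "p \<in> S"
  note r = rad_pos[OF p]
  have S0: "Sigma_K a p \<noteq> 0" using Sigma_pos[OF r, of a] by simp
  show "e3 p = e3 p \<or> e3 p = e4 M a p" by simp
  show "e3 differentiable (at p within S)" by (rule null_differentiable[OF p])
  show "g p (e3 p) (H p w) = 0" for w by (rule kerr_g_hlift_null[OF r a_le])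
  have dr: "dradial p (e3 p) = 0" by (simp add: e3_eq dradial_def radial_unit[OF r] spatial_minus)
  then show "dradial p (e3 p) = 0 *\<^sub>R rot (radial p)" by simp
  show "dd e3 p (H p w) - dhlift a p (e3 p) w = 0 *\<^sub>R H p (rot w) - (0 \<bullet> H p w) *\<^sub>R e3 p" for w
    using bracket_e3[OF r, of a w] dir_deriv_eq[OF p e3_has_derivative[OF r]] by simp
  show "dd (Sigma_K a) p (e3 p) = tr_chib a p * Sigma_K a p"
    using S0 by (simp add: dir_deriv_Sigma[OF p] dr tr_chib_def) (simp add: e3_eq radial_unit[OF r])
  show "- g p (e3 p) (dhlift a p (H p w) w' - dhlift a p (H p w') w)
      = eps_chib a p * (Sigma_K a p * (cross (radial p) w \<bullet> w'))" for w w'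
    unfolding kerr_g_e3[OF r a_le] contact_form_bracket_hlift[OF r]
    using S0 by (simp add: eps_chib_def costh_eq)
  show "tr_chib a differentiable (at p within S)" "eps_chib a differentiable (at p within S)"
    by (rule tr_eps_differentiable[OF p])+
next
  show "horizontal (\<lambda>p. 0)"
    by (simp add: horizontal_def)
qed

end

text \<open>
  The Hodge star exchanges the two angular functions that occur in \<open>eta_hlift\<close>, up to sign.
\<close>

lemma cross_components:
  assumes r: "rad p > 0"
  shows "rot (radial p) \<bullet> cross (radial p) w = - (w $ 4 - radial p $ 4 * (radial p \<bullet> w))"
    and "cross (radial p) w $ 4 - radial p $ 4 * (radial p \<bullet> cross (radial p) w) = rot (radial p) \<bullet> w"
proof -
  define n2 n3 n4 where "n2 = radial p $ 2" "n3 = radial p $ 3" "n4 = radial p $ 4"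
  note d = this
  have n: "n2\<^sup>2 + n3\<^sup>2 + n4\<^sup>2 = 1" using radial_sum_squares[OF r] by (simp add: d)
  show "rot (radial p) \<bullet> cross (radial p) w = - (w $ 4 - radial p $ 4 * (radial p \<bullet> w))"
    using n by (simp add: vec4_simps d[symmetric]) algebra
  show "cross (radial p) w $ 4 - radial p $ 4 * (radial p \<bullet> cross (radial p) w) = rot (radial p) \<bullet> w"
    by (simp add: vec4_simps d[symmetric] algebra_simps)
qed

context kerr_exterior
begin

lemma coefficient_gradients:
  assumes p: "p \<in> S"
  defines "\<kappa> \<equiv> \<lambda>w. w $ 4 - radial p $ 4 * (radial p \<bullet> w)"
  shows "dd (tr_chi M a) p (H p w) = - (8 * a\<^sup>2 * rad p * radial p $ 4 * Delta M a p * \<kappa> w / Sigma_K a p ^ 3)"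
    and "dd (eps_chi M a) p (H p w) = 2 * a * Delta M a p * \<kappa> w / (Sigma_K a p)\<^sup>2
      - 8 * a ^ 3 * (radial p $ 4)\<^sup>2 * Delta M a p * \<kappa> w / Sigma_K a p ^ 3"
    and "dd (tr_chib a) p (H p w) = 4 * a\<^sup>2 * rad p * radial p $ 4 * \<kappa> w / (Sigma_K a p)\<^sup>2"
    and "dd (eps_chib a) p (H p w) = 2 * a * \<kappa> w / Sigma_K a p
      - 4 * a ^ 3 * (radial p $ 4)\<^sup>2 * \<kappa> w / (Sigma_K a p)\<^sup>2"
proof -
  note r = rad_pos[OF p]
  have S0: "Sigma_K a p \<noteq> 0" "(Sigma_K a p)\<^sup>2 \<noteq> 0" using Sigma_pos[OF r, of a] by simp_all
  note D = rad_has_derivative[OF r] Sigma_has_derivative[OF r] Delta_has_derivative[OF r a_le]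
    bounded_linear.has_derivative[OF bounded_linear_vec_nth radial_has_derivative[OF r]]
  note ev = radial_hlift[OF r] dradial_hlift[OF r]
  define I where "I = inverse (Sigma_K a p)"
  have I: "Sigma_K a p * I = 1" using S0 by (simp add: I_def)
  have dI: "x / (Sigma_K a p)\<^sup>2 = x * I\<^sup>2" "x / Sigma_K a p ^ 3 = x * I ^ 3"
    "x / ((Sigma_K a p)\<^sup>2 * (Sigma_K a p)\<^sup>2) = x * I ^ 4" for x
    by (simp_all add: I_def divide_inverse power_inverse flip: power_add)
  have "dd (tr_chi M a) p (H p w) =
     (2 * rad p * Delta M a p) * - (2 * Sigma_K a p * (2 * a\<^sup>2 * radial p $ 4 * \<kappa> w)) / ((Sigma_K a p)\<^sup>2 * (Sigma_K a p)\<^sup>2)"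
    unfolding tr_chi_def[abs_def]
    by (subst dir_deriv_eq[OF p has_derivative_divide'[OF has_derivative_mult[OF has_derivative_mult[OF has_derivative_const D(1)] D(3)]
        has_derivative_power[OF D(2), where n = 2] S0(2)]])
      (simp add: ev \<kappa>_def mult.commute[of "radial p \<bullet> w"])
  then show "dd (tr_chi M a) p (H p w) = - (8 * a\<^sup>2 * rad p * radial p $ 4 * Delta M a p * \<kappa> w / Sigma_K a p ^ 3)"
    using S0 by (simp add: field_simps power2_eq_square power3_eq_cube)
  have "dd (eps_chi M a) p (H p w) =
     (2 * a * Delta M a p * \<kappa> w * (Sigma_K a p)\<^sup>2 - (2 * a * Delta M a p * radial p $ 4) * (2 * Sigma_K a p * (2 * a\<^sup>2 * radial p $ 4 * \<kappa> w))) / ((Sigma_K a p)\<^sup>2 * (Sigma_K a p)\<^sup>2)"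
    unfolding eps_chi_def[abs_def] costh_eq
    by (subst dir_deriv_eq[OF p has_derivative_divide'[OF has_derivative_mult[OF has_derivative_mult[OF has_derivative_const D(3)] D(4)]
        has_derivative_power[OF D(2), where n = 2] S0(2)]])
      (simp add: ev \<kappa>_def mult.commute[of "radial p \<bullet> w"])
  then show "dd (eps_chi M a) p (H p w) = 2 * a * Delta M a p * \<kappa> w / (Sigma_K a p)\<^sup>2
      - 8 * a ^ 3 * (radial p $ 4)\<^sup>2 * Delta M a p * \<kappa> w / Sigma_K a p ^ 3"
    unfolding dI using I by algebra
  have "dd (tr_chib a) p (H p w) =
     - ((2 * rad p) * - (2 * a\<^sup>2 * radial p $ 4 * \<kappa> w) / (Sigma_K a p * Sigma_K a p))"
    unfolding tr_chib_def[abs_def]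
    by (subst dir_deriv_eq[OF p has_derivative_minus[OF has_derivative_divide'[OF has_derivative_mult[OF has_derivative_const D(1)]
        D(2) S0(1)]]])
      (simp add: ev \<kappa>_def mult.commute[of "radial p \<bullet> w"])
  then show "dd (tr_chib a) p (H p w) = 4 * a\<^sup>2 * rad p * radial p $ 4 * \<kappa> w / (Sigma_K a p)\<^sup>2"
    using S0 by (simp add: field_simps power2_eq_square power3_eq_cube)
  have "dd (eps_chib a) p (H p w) =
     (2 * a * \<kappa> w * Sigma_K a p - (2 * a * radial p $ 4) * (2 * a\<^sup>2 * radial p $ 4 * \<kappa> w)) / (Sigma_K a p * Sigma_K a p)"
    unfolding eps_chib_def[abs_def] costh_eq
    by (subst dir_deriv_eq[OF p has_derivative_divide'[OF has_derivative_mult[OF has_derivative_const D(4)]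
        D(2) S0(1)]])
      (simp add: ev \<kappa>_def mult.commute[of "radial p \<bullet> w"])
  then show "dd (eps_chib a) p (H p w) = 2 * a * \<kappa> w / Sigma_K a p
      - 4 * a ^ 3 * (radial p $ 4)\<^sup>2 * \<kappa> w / (Sigma_K a p)\<^sup>2"
    using S0 by (simp add: field_simps power2_eq_square power3_eq_cube)
qed

lemma eta_hlift_has_derivative:
  fixes w :: pt
  assumes p: "p \<in> S"
  defines "\<psi> \<equiv> rot (radial p) \<bullet> w" and "\<kappa> \<equiv> w $ 4 - radial p $ 4 * (radial p \<bullet> w)"
  defines "D \<equiv> \<lambda>s u. s * ((a * (radial p \<bullet> u) * Sigma_K a p - a * rad p * dd (Sigma_K a) p u) / (Sigma_K a p)\<^sup>2 * \<psi>
      + a * rad p / Sigma_K a p * (rot (dradial p u) \<bullet> w))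
      + ((a\<^sup>2 * dradial p u $ 4 * Sigma_K a p - a\<^sup>2 * radial p $ 4 * dd (Sigma_K a) p u) / (Sigma_K a p)\<^sup>2 * \<kappa>
      - a\<^sup>2 * radial p $ 4 / Sigma_K a p * (dradial p u $ 4 * (radial p \<bullet> w) + radial p $ 4 * (dradial p u \<bullet> w)))"
  shows "((\<lambda>q. eta a q \<bullet> H q w) has_derivative D 1) (at p within S)"
    and "((\<lambda>q. etab a q \<bullet> H q w) has_derivative D (-1)) (at p within S)"
proof -
  note r = rad_pos[OF p]
  have S0: "Sigma_K a p \<noteq> 0" using Sigma_pos[OF r, of a] by simp_all
  note Sd = has_dir_deriv[OF differentiableI[OF Sigma_has_derivative[OF r]]]
  note rd = radial_has_derivative[OF r]
  note d4 = bounded_linear.has_derivative[OF bounded_linear_vec_nth rd, of 4]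
  note dr = bounded_linear.has_derivative[OF bounded_linear_rot rd]
  have *: "((\<lambda>q. s * (a * rad q / Sigma_K a q * (rot (radial q) \<bullet> w))
      + a\<^sup>2 * radial q $ 4 / Sigma_K a q * (w $ 4 - radial q $ 4 * (radial q \<bullet> w))) has_derivative D s) (at p within S)" for s
    unfolding D_def \<psi>_def \<kappa>_def
    by (rule has_derivative_eq_rhs, (rule has_derivative_add has_derivative_diff has_derivative_mult has_derivative_divide'
          has_derivative_inner has_derivative_const rad_has_derivative[OF r] Sd rd d4 dr S0)+)
      (simp add: fun_eq_iff power2_eq_square algebra_simps add_divide_distrib diff_divide_distrib)
  show "((\<lambda>q. eta a q \<bullet> H q w) has_derivative D 1) (at p within S)"
    by (rule has_derivative_transform[OF p _ *]) (simp add: eta_hlift rad_pos)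
  show "((\<lambda>q. etab a q \<bullet> H q w) has_derivative D (-1)) (at p within S)"
    by (rule has_derivative_transform[OF p _ *]) (simp add: eta_hlift rad_pos)
qed

lemma C1_horizontal_eta: "C1_horizontal (eta a)" "C1_horizontal (etab a)"
  using differentiable_from_hlift[OF horizontal_eta(1) _ differentiableI[OF eta_hlift_has_derivative(1)]]
    differentiable_from_hlift[OF horizontal_eta(2) _ differentiableI[OF eta_hlift_has_derivative(2)]]
  by (auto simp: C1_horizontal_def horizontal_eta)

lemma structure_equationI:
  assumes p: "p \<in> S" and f: "f differentiable (at p within S)" and e: "e differentiable (at p within S)"
    and x: "x \<bullet> e3 p = 0" "x \<bullet> e4 M a p = 0" and y: "y \<bullet> e3 p = 0" "y \<bullet> e4 M a p = 0"
    and z: "z \<bullet> e3 p = 0" "z \<bullet> e4 M a p = 0"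
    and eq: "\<And>w. 2 * (x \<bullet> H p w) + 2 * e p * (y \<bullet> H p (cross (radial p) w))
      = dd f p (H p w) - dd e p (H p (cross (radial p) w)) + f p * (z \<bullet> H p w) - e p * (z \<bullet> H p (cross (radial p) w))"
  shows "2 *\<^sub>R x + (2 * e p) *\<^sub>R hstar M a p y = hgrad M a f p - hstar M a p (hgrad M a e p)
    + f p *\<^sub>R z - e p *\<^sub>R hstar M a p z"
  by (rule horizontal_eqI[OF p])
    (simp_all add: inner_add_left inner_diff_left x y z hstar_null[OF p] hstar_hlift[OF p] hgrad_hlift[OF p f] hgrad_hlift[OF p e] eq)

text \<open>
  On the lift of \<open>w\<close> both sides are linear in the angular functions \<open>\<psi>\<close> and \<open>\<kappa>\<close>.  The
  rotation of the angular functions along \<open>e4\<close> cancels against the rotational part of the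
  bracket.  The coefficients agree because \<open>\<Sigma> = r\<^sup>2 + a\<^sup>2 cos\<^sup>2\<theta>\<close>.
\<close>

lemma structure_equation_e4:
  assumes p: "p \<in> S"
  shows "2 *\<^sub>R D4 M a (eta a) p + (2 * eps_chi M a p) *\<^sub>R hstar M a p (eta a p)
    = hgrad M a (tr_chi M a) p - hstar M a p (hgrad M a (eps_chi M a) p) + tr_chi M a p *\<^sub>R etab a p
      - eps_chi M a p *\<^sub>R hstar M a p (etab a p)"
  unfolding D4_def
proof (rule structure_equationI[OF p])
  note r = rad_pos[OF p]
  show "tr_chi M a differentiable (at p within S)" "eps_chi M a differentiable (at p within S)"
    by (rule tr_eps_differentiable[OF p])+
  show "hD M a (e4 M a p) (eta a) p \<bullet> e3 p = 0" "hD M a (e4 M a p) (eta a) p \<bullet> e4 M a p = 0"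
    by (rule e4.DX_null[OF p C1_horizontal_eta(1)])+
  show "eta a p \<bullet> e3 p = 0" "eta a p \<bullet> e4 M a p = 0" "etab a p \<bullet> e3 p = 0" "etab a p \<bullet> e4 M a p = 0"
    by (rule eta_null[OF r])+
  fix w
  define \<psi> \<kappa> where "\<psi> = rot (radial p) \<bullet> w" "\<kappa> = w $ 4 - radial p $ 4 * (radial p \<bullet> w)"
  \<comment> \<open>with \<open>I\<close> the inverse of \<open>\<Sigma>\<close> the claim is a polynomial identity modulo \<open>\<Sigma> I = 1\<close>\<close>
  define R c T I where "R = rad p" "c = radial p $ 4" "T = Delta M a p" "I = inverse (Sigma_K a p)"
  note d = \<psi>_\<kappa>_def this
  have S0: "Sigma_K a p \<noteq> 0" using Sigma_pos[OF r, of a] by simp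
  then have I: "(R\<^sup>2 + a\<^sup>2 * c\<^sup>2) * I = 1" by (simp add: d Sigma_eq[symmetric])
  have Sg: "Sigma_K a p = R\<^sup>2 + a\<^sup>2 * c\<^sup>2" by (simp add: d Sigma_eq)
  have rw: "rot (radial p) \<bullet> rot w = - (rot (rot (radial p)) \<bullet> w)" "rot w $ 4 - radial p $ 4 * (radial p \<bullet> rot w) = c * \<psi>"
    by (simp_all add: vec4_simps d algebra_simps)
  have dS: "dd (Sigma_K a) p (e4 M a p) = 2 * R * T * I"
    using e4.expansion[OF p] S0 by (simp add: tr_chi_def d power2_eq_square divide_inverse)
  have dI: "x / Sigma_K a p = x * I" "x / (Sigma_K a p)\<^sup>2 = x * I\<^sup>2" "x / (Sigma_K a p) ^ 3 = x * I ^ 3" for x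
    by (simp_all add: d divide_inverse power_inverse)
  have rr: "rot ((2 * a / Sigma_K a p) *\<^sub>R rot (radial p)) \<bullet> w = (2 * a * I) * (rot (rot (radial p)) \<bullet> w)"
    by (simp add: vec4_simps dI algebra_simps)
  have r4: "((2 * a / Sigma_K a p) *\<^sub>R rot (radial p)) $ 4 = 0" by simp
  have rin: "((2 * a / Sigma_K a p) *\<^sub>R rot (radial p)) \<bullet> w = 2 * a * I * \<psi>" by (simp add: dI d)
  define k where "k = rot (rot (radial p)) \<bullet> w"
  show "2 * (hD M a (e4 M a p) (eta a) p \<bullet> H p w) + 2 * eps_chi M a p * (eta a p \<bullet> H p (cross (radial p) w))
      = dd (tr_chi M a) p (H p w) - dd (eps_chi M a) p (H p (cross (radial p) w)) + tr_chi M a p * (etab a p \<bullet> H p w)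
        - eps_chi M a p * (etab a p \<bullet> H p (cross (radial p) w))"
    unfolding e4.DX_hlift[OF p C1_horizontal_eta(1)] dir_deriv_eq[OF p eta_hlift_has_derivative(1)[OF p]]
      e4_radial[OF r] dS rr r4 rin
      coefficient_gradients[OF p] eta_hlift[OF r] cross_components[OF r] rw d(1,2)[symmetric] k_def[symmetric]
    unfolding tr_chi_def eps_chi_def costh_eq dI
    unfolding d(3-5)[symmetric] Sg
    using I by algebra
qed

lemma structure_equation_e3:
  assumes p: "p \<in> S"
  shows "2 *\<^sub>R D3 M a (etab a) p + (2 * eps_chib a p) *\<^sub>R hstar M a p (etab a p)
    = hgrad M a (tr_chib a) p - hstar M a p (hgrad M a (eps_chib a) p) + tr_chib a p *\<^sub>R (- etab a p)
      - eps_chib a p *\<^sub>R hstar M a p (- etab a p)"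
  unfolding D3_def
proof (rule structure_equationI[OF p])
  note r = rad_pos[OF p]
  show "tr_chib a differentiable (at p within S)" "eps_chib a differentiable (at p within S)"
    by (rule tr_eps_differentiable[OF p])+
  show "hD M a (e3 p) (etab a) p \<bullet> e3 p = 0" "hD M a (e3 p) (etab a) p \<bullet> e4 M a p = 0"
    by (rule e3.DX_null[OF p C1_horizontal_eta(2)])+
  show "etab a p \<bullet> e3 p = 0" "etab a p \<bullet> e4 M a p = 0" "- etab a p \<bullet> e3 p = 0" "- etab a p \<bullet> e4 M a p = 0"
    by (simp_all add: eta_null[OF r])
  fix w
  define \<psi> \<kappa> where "\<psi> = rot (radial p) \<bullet> w" "\<kappa> = w $ 4 - radial p $ 4 * (radial p \<bullet> w)"
  \<comment> \<open>again a polynomial identity modulo \<open>\<Sigma> I = 1\<close>\<close>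
  define R c I where "R = rad p" "c = radial p $ 4" "I = inverse (Sigma_K a p)"
  note d = \<psi>_\<kappa>_def this
  have S0: "Sigma_K a p \<noteq> 0" using Sigma_pos[OF r, of a] by simp
  then have I: "(R\<^sup>2 + a\<^sup>2 * c\<^sup>2) * I = 1" by (simp add: d Sigma_eq[symmetric])
  have Sg: "Sigma_K a p = R\<^sup>2 + a\<^sup>2 * c\<^sup>2" by (simp add: d Sigma_eq)
  have dI: "x / Sigma_K a p = x * I" "x / (Sigma_K a p)\<^sup>2 = x * I\<^sup>2" for x
    by (simp_all add: d divide_inverse power_inverse)
  have dr: "dradial p (e3 p) = 0" using e3.X_radial[OF p] by simp
  have dS: "dd (Sigma_K a) p (e3 p) = - (2 * R)"
    using e3.expansion[OF p] S0 by (simp add: tr_chib_def d)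
  have ne: "radial p \<bullet> e3 p = - 1" by (simp add: e3_eq radial_unit[OF r])
  have z: "rot 0 \<bullet> w = 0" "(0::pt) $ 4 = 0" "(0::pt) \<bullet> w = 0" by (simp_all add: vec4_simps)
  show "2 * (hD M a (e3 p) (etab a) p \<bullet> H p w) + 2 * eps_chib a p * (etab a p \<bullet> H p (cross (radial p) w))
      = dd (tr_chib a) p (H p w) - dd (eps_chib a) p (H p (cross (radial p) w)) + tr_chib a p * (- etab a p \<bullet> H p w)
        - eps_chib a p * (- etab a p \<bullet> H p (cross (radial p) w))"
    unfolding e3.DX_hlift[OF p C1_horizontal_eta(2)] dir_deriv_eq[OF p eta_hlift_has_derivative(2)[OF p]]
      dr dS ne z inner_minus_left
      coefficient_gradients[OF p] eta_hlift[OF r] cross_components[OF r] d(1,2)[symmetric]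
    unfolding tr_chib_def eps_chib_def costh_eq dI
    unfolding d(3-4)[symmetric] Sg
    using I by algebra
qed

end

section \<open>The wave equations\<close>

context kerr_exterior
begin

lemma Ck_on_cong:
  assumes "\<And>q. q \<in> S \<Longrightarrow> f q = h q"
  shows "Ck_on k S f \<longleftrightarrow> Ck_on k S h"
  using assms
proof (induction k arbitrary: f h)
  case 0
  then show ?case by (simp cong: continuous_on_cong)
next
  case (Suc k)
  have "f differentiable (at p within S) \<longleftrightarrow> h differentiable (at p within S)" if "p \<in> S" for p
    using differentiable_cong_exterior[OF that, of f h] differentiable_cong_exterior[OF that, of h f] Suc.prems by auto
  moreover have "Ck_on k S (\<lambda>q. dd f q v) \<longleftrightarrow> Ck_on k S (\<lambda>q. dd h q v)" for v
    by (rule Suc.IH) (simp add: dir_deriv_cong[of _ f h] Suc.prems)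
  ultimately show ?case by simp
qed

lemma Ck_on_minus: "Ck_on k S f \<Longrightarrow> Ck_on k S (\<lambda>q. - f q)"
proof (induction k arbitrary: f)
  case 0
  then show ?case by (simp add: continuous_on_minus)
next
  case (Suc k)
  then have d: "f differentiable (at q within S)" if "q \<in> S" for q using that by simp
  have "Ck_on k S (\<lambda>q. - dd f q v)" for v using Suc.prems by (intro Suc.IH) simp
  moreover have "dd (\<lambda>q. - f q) q v = - dd f q v" if "q \<in> S" for q v
    using dir_deriv_eq[OF that has_derivative_minus[OF has_dir_deriv[OF d[OF that]]]] by simp
  ultimately have "Ck_on k S (\<lambda>q. dd (\<lambda>q. - f q) q v)" for v
    using Ck_on_cong[of "\<lambda>q. dd (\<lambda>q. - f q) q v" "\<lambda>q. - dd f q v" k] by simp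
  then show ?case using d by (simp add: differentiable_minus)
qed

lemma smooth_on_minus: "smooth_on S f \<Longrightarrow> smooth_on S (\<lambda>q. - f q)"
  by (simp add: smooth_on_def Ck_on_minus)

lemma dir_deriv_minus:
  assumes "p \<in> S" "f differentiable (at p within S)"
  shows "dd (\<lambda>q. - f q) p u = - dd f p u"
  using dir_deriv_eq[OF assms(1) has_derivative_minus[OF has_dir_deriv[OF assms(2)]]] by simp

lemma hgrad_cong:
  assumes "p \<in> S" "\<And>q. q \<in> S \<Longrightarrow> f q = h q"
  shows "hgrad M a f p = hgrad M a h p"
  using dir_deriv_cong[OF assms] by (simp add: hgrad_def)

lemma D_plus_cong:
  assumes "p \<in> S" "\<And>q. q \<in> S \<Longrightarrow> f q = h q" "\<xi> p = \<xi>' p"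
  shows "D_plus M a \<xi> f p = D_plus M a \<xi>' h p" "star_D_plus M a \<xi> f p = star_D_plus M a \<xi>' h p"
  using hgrad_cong[OF assms(1,2)] assms by (simp_all add: D_plus_def star_D_plus_def)

lemma star_D_plus_minus:
  assumes "p \<in> S" "f differentiable (at p within S)"
  shows "star_D_plus M a \<xi> (\<lambda>q. - f q) p = - star_D_plus M a \<xi> f p"
proof -
  have "D_plus M a \<xi> (\<lambda>q. - f q) p = - D_plus M a \<xi> f p"
    by (simp add: D_plus_def hgrad_def dir_deriv_minus[OF assms] vec_eq_iff)
  then show ?thesis by (simp add: star_D_plus_def linear_neg[OF linear_hstar])
qed

lemma frame_horizontal:
  assumes p: "p \<in> S" and E: "E = e1 a p \<or> E = e2 a p"
  obtains w where "E = H p w"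
  using hproj_hlift[OF rad_pos[OF p] a_le, of E] e1_hlift[OF rad_pos[OF p] a_le] e2_hlift[OF rad_pos[OF p] a_le] E by metis

lemma dir_deriv_Sigma_frame:
  assumes p: "p \<in> S" and E: "E = e1 a p \<or> E = e2 a p"
  shows "dd (Sigma_K a) p E = Sigma_K a p * ((eta a p + etab a p) \<bullet> E)"
  using frame_horizontal[OF p E] eta_plus_etab_hlift[OF p] by metis

lemma Sigma_differentiable:
  assumes p: "p \<in> S" shows "Sigma_K a differentiable (at p within S)"
  using Sigma_has_derivative[OF rad_pos[OF p]] unfolding differentiable_def by blast

lemma hgrad_Sigma:
  assumes p: "p \<in> S"
  shows "hgrad M a (Sigma_K a) p = Sigma_K a p *\<^sub>R (eta a p + etab a p)"
  by (rule horizontal_eqI[OF p])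
    (simp_all add: hgrad_hlift[OF p Sigma_differentiable[OF p]] inner_add_left eta_null[OF rad_pos[OF p]]
      eta_plus_etab_hlift[OF p, symmetric])

text \<open>
  The horizontal gradient of \<open>\<Sigma>\<close> supplies exactly the lower-order terms with which \<open>\<alpha>\<close> occurs in
  the transport equations along \<open>e4\<close>; this is why \<open>\<Sigma> \<alpha>\<close> is the natural unknown.
\<close>

lemma hdiv_hcurl_Sigma:
  assumes p: "p \<in> S" and w: "C1_horizontal \<omega>"
  shows "hdiv M a (\<lambda>q. Sigma_K a q *\<^sub>R \<omega> q) p
      = Sigma_K a p * (hdiv M a \<omega> p + hinner a p (eta a p + etab a p) (\<omega> p))"
    and "hcurl M a (\<lambda>q. Sigma_K a q *\<^sub>R \<omega> q) p
      = Sigma_K a p * (hcurl M a \<omega> p + hwedge a p (eta a p + etab a p) (\<omega> p))"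
  unfolding hdiv_def hcurl_def hinner_def hwedge_def hD_scaleR[OF p w Sigma_differentiable[OF p]]
  by (simp_all add: inner_add_left dir_deriv_Sigma_frame[OF p] algebra_simps)

text \<open>
  Moving \<open>\<Sigma>\<close> through \<open>D + \<xi>\<close> adds the term \<open>\<zeta>\<close> that the decoupling identity along
  \<open>e4\<close> requires.
\<close>

lemma D_plus_Sigma:
  assumes p: "p \<in> S" and f: "f differentiable (at p within S)"
  shows "D_plus M a \<xi> (\<lambda>q. Sigma_K a q * f q) p
      = Sigma_K a p *\<^sub>R D_plus M a (\<lambda>q. \<xi> q + (eta a q + etab a q)) f p"
    and "star_D_plus M a \<xi> (\<lambda>q. Sigma_K a q * f q) p
      = Sigma_K a p *\<^sub>R star_D_plus M a (\<lambda>q. \<xi> q + (eta a q + etab a q)) f p"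
proof -
  show 1: "D_plus M a \<xi> (\<lambda>q. Sigma_K a q * f q) p
      = Sigma_K a p *\<^sub>R D_plus M a (\<lambda>q. \<xi> q + (eta a q + etab a q)) f p"
    unfolding D_plus_def hgrad_mult[OF p Sigma_differentiable[OF p] f] hgrad_Sigma[OF p]
    by (simp add: algebra_simps)
  show "star_D_plus M a \<xi> (\<lambda>q. Sigma_K a q * f q) p
      = Sigma_K a p *\<^sub>R star_D_plus M a (\<lambda>q. \<xi> q + (eta a q + etab a q)) f p"
    unfolding star_D_plus_def 1 by (rule linear_scale[OF linear_hstar])
qed

lemma null_dir_deriv_differentiable:
  assumes p: "p \<in> S" and u: "smooth_on S u" and V: "V differentiable (at p within S)"
  shows "(\<lambda>q. dd u q (V q)) differentiable (at p within S)"
  by (rule differentiableI[OF dir_deriv_field[OF u p has_dir_deriv[OF V]]])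

lemma smooth_horizontal_C1:
  assumes "smooth_horizontal M a \<omega>" shows "C1_horizontal \<omega>"
proof -
  have "Ck_on (Suc 0) S \<omega>" using assms by (simp only: smooth_horizontal_def smooth_on_def)
  then show ?thesis using assms by (simp add: C1_horizontal_def horizontal_def smooth_horizontal_def)
qed

lemma alpha_wave_equation:
  assumes maxwell: "maxwell_solution M a \<alpha> \<alpha>b \<rho> \<sigma>" and p: "p \<in> S"
  defines "\<beta> \<equiv> \<lambda>q. D3 M a \<alpha> q + (1/2 * tr_chib a q) *\<^sub>R \<alpha> q + (1/2 * eps_chib a q) *\<^sub>R hstar M a q (\<alpha> q)"
    and "\<Sigma>\<alpha> \<equiv> \<lambda>q. Sigma_K a q *\<^sub>R \<alpha> q"
  shows "Sigma_K a p *\<^sub>R (D4 M a \<beta> p + (3/2 * tr_chi M a p) *\<^sub>R \<beta> p - (1/2 * eps_chi M a p) *\<^sub>R hstar M a p (\<beta> p))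
    - D_plus M a (\<lambda>q. 2 *\<^sub>R eta a q) (hdiv M a \<Sigma>\<alpha>) p
    + star_D_plus M a (\<lambda>q. 2 *\<^sub>R eta a q) (hcurl M a \<Sigma>\<alpha>) p = 0"
proof -
  have \<rho>: "smooth_on S \<rho>" and \<sigma>: "smooth_on S \<sigma>" and \<alpha>: "C1_horizontal \<alpha>"
    using maxwell smooth_horizontal_C1 by (auto simp: maxwell_solution_def)
  define A B where "A q = dd \<rho> q (e4 M a q) + tr_chi M a q * \<rho> q + eps_chi M a q * \<sigma> q"
    and "B q = dd \<sigma> q (e4 M a q) + tr_chi M a q * \<sigma> q - eps_chi M a q * \<rho> q" for q
  have AB: "A differentiable (at p within S)" "B differentiable (at p within S)"
    unfolding A_def[abs_def] B_def[abs_def]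
    by (intro differentiable_add differentiable_diff differentiable_mult null_dir_deriv_differentiable[OF p]
        null_differentiable[OF p] tr_eps_differentiable[OF p] smooth_C2(1)[OF _ p] \<rho> \<sigma>)+
  have div: "hdiv M a \<Sigma>\<alpha> q = Sigma_K a q * A q" and curl: "hcurl M a \<Sigma>\<alpha> q = - (Sigma_K a q * B q)"
    and \<beta>: "\<beta> q = hgrad M a \<rho> q + hstar M a q (hgrad M a \<sigma> q) + (2 * \<rho> q) *\<^sub>R eta a q
      + (2 * \<sigma> q) *\<^sub>R hstar M a q (eta a q)" if q: "q \<in> S" for q
  proof -
    have 1: "dd \<sigma> q (e4 M a q) + tr_chi M a q * \<sigma> q
        = - hcurl M a \<alpha> q - hwedge a q (eta a q + etab a q) (\<alpha> q) + eps_chi M a q * \<rho> q"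
      and 2: "dd \<rho> q (e4 M a q) + tr_chi M a q * \<rho> q
        = hdiv M a \<alpha> q + hinner a q (eta a q + etab a q) (\<alpha> q) - eps_chi M a q * \<sigma> q"
      and 3: "D3 M a \<alpha> q + chib_dot M a q (\<alpha> q)
        = hgrad M a \<rho> q + hstar M a q (hgrad M a \<sigma> q)
          + (2 * \<rho> q) *\<^sub>R eta a q + (2 * \<sigma> q) *\<^sub>R hstar M a q (eta a q)"
      using maxwell q unfolding maxwell_solution_def D4s_def by blast+
    have "hdiv M a \<alpha> q + hinner a q (eta a q + etab a q) (\<alpha> q) = A q" using 2 by (simp add: A_def)
    then show "hdiv M a \<Sigma>\<alpha> q = Sigma_K a q * A q"
      unfolding \<Sigma>\<alpha>_def hdiv_hcurl_Sigma(1)[OF q \<alpha>] by simp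
    have "hcurl M a \<alpha> q + hwedge a q (eta a q + etab a q) (\<alpha> q) = - B q" using 1 by (simp add: B_def)
    then show "hcurl M a \<Sigma>\<alpha> q = - (Sigma_K a q * B q)"
      unfolding \<Sigma>\<alpha>_def hdiv_hcurl_Sigma(2)[OF q \<alpha>] by simp
    show "\<beta> q = hgrad M a \<rho> q + hstar M a q (hgrad M a \<sigma> q) + (2 * \<rho> q) *\<^sub>R eta a q
      + (2 * \<sigma> q) *\<^sub>R hstar M a q (eta a q)"
      using 3 by (simp add: \<beta>_def chib_dot_def add.assoc)
  qed
  have "D4 M a \<beta> p + (3/2 * tr_chi M a p) *\<^sub>R \<beta> p - (1/2 * eps_chi M a p) *\<^sub>R hstar M a p (\<beta> p)
    = D_plus M a (\<lambda>q. 2 *\<^sub>R eta a q + (eta a q + etab a q)) A p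
      + star_D_plus M a (\<lambda>q. 2 *\<^sub>R eta a q + (eta a q + etab a q)) B p"
    unfolding D4_def A_def[abs_def] B_def[abs_def]
    by (rule e4.decoupling_identity[OF \<rho> \<sigma> C1_horizontal_eta(1) _ \<beta> p])
      (use structure_equation_e4 in \<open>simp_all add: D4_def\<close>)
  moreover have "D_plus M a (\<lambda>q. 2 *\<^sub>R eta a q) (hdiv M a \<Sigma>\<alpha>) p
      = Sigma_K a p *\<^sub>R D_plus M a (\<lambda>q. 2 *\<^sub>R eta a q + (eta a q + etab a q)) A p"
    unfolding D_plus_Sigma(1)[OF p AB(1), symmetric] by (rule D_plus_cong[OF p div refl])
  moreover have "star_D_plus M a (\<lambda>q. 2 *\<^sub>R eta a q) (hcurl M a \<Sigma>\<alpha>) p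
      = - (Sigma_K a p *\<^sub>R star_D_plus M a (\<lambda>q. 2 *\<^sub>R eta a q + (eta a q + etab a q)) B p)"
    unfolding D_plus_Sigma(2)[OF p AB(2), symmetric]
      star_D_plus_minus[OF p differentiable_mult[OF Sigma_differentiable[OF p] AB(2)], symmetric]
    by (rule D_plus_cong[OF p curl refl])
  ultimately show ?thesis by (simp add: scaleR_add_right)
qed

text \<open>
  The equation for \<open>D\<^sub>4\<close> of the other extremal component has the opposite sign in \<open>\<rho>\<close>, so
  the decoupling identity is applied to \<open>- \<rho>\<close> and \<open>\<sigma>\<close>.  Along \<open>e3\<close> the form \<open>\<zeta>\<close> vanishes,
  which is why the second equation has no factor \<open>\<Sigma>\<close>.
\<close>

lemma alpha_bar_wave_equation:
  assumes maxwell: "maxwell_solution M a \<alpha> \<alpha>b \<rho> \<sigma>" and p: "p \<in> S"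
  defines "\<beta> \<equiv> \<lambda>q. D4 M a \<alpha>b q + (1/2 * tr_chi M a q) *\<^sub>R \<alpha>b q
      + (1/2 * eps_chi M a q) *\<^sub>R hstar M a q (\<alpha>b q) + omega_hat M a q *\<^sub>R \<alpha>b q"
  shows "D3 M a \<beta> p + (3/2 * tr_chib a p) *\<^sub>R \<beta> p - (1/2 * eps_chib a p) *\<^sub>R hstar M a p (\<beta> p)
    - D_plus M a (\<lambda>q. 2 *\<^sub>R etab a q) (hdiv M a \<alpha>b) p
    + star_D_plus M a (\<lambda>q. 2 *\<^sub>R etab a q) (hcurl M a \<alpha>b) p = 0"
proof -
  have \<rho>: "smooth_on S \<rho>" and \<sigma>: "smooth_on S \<sigma>"
    using maxwell by (auto simp: maxwell_solution_def)
  note \<rho>' = smooth_on_minus[OF \<rho>]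
  define A B where "A q = dd (\<lambda>q. - \<rho> q) q (e3 q) + tr_chib a q * - \<rho> q + eps_chib a q * \<sigma> q"
    and "B q = dd \<sigma> q (e3 q) + tr_chib a q * \<sigma> q - eps_chib a q * - \<rho> q" for q
  have B: "B differentiable (at p within S)"
    unfolding A_def[abs_def] B_def[abs_def]
    by (intro differentiable_add differentiable_diff differentiable_mult differentiable_minus null_dir_deriv_differentiable[OF p]
        null_differentiable[OF p] tr_eps_differentiable[OF p] smooth_C2(1)[OF _ p] \<rho> \<sigma>)+
  have div: "hdiv M a \<alpha>b q = A q" and curl: "hcurl M a \<alpha>b q = - B q"
    and \<beta>: "\<beta> q = hgrad M a (\<lambda>q. - \<rho> q) q + hstar M a q (hgrad M a \<sigma> q) + (2 * - \<rho> q) *\<^sub>R etab a q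
      + (2 * \<sigma> q) *\<^sub>R hstar M a q (etab a q)" if q: "q \<in> S" for q
  proof -
    have 1: "dd \<sigma> q (e3 q) + tr_chib a q * \<sigma> q = - hcurl M a \<alpha>b q - eps_chib a q * \<rho> q"
      and 2: "dd \<rho> q (e3 q) + tr_chib a q * \<rho> q = - hdiv M a \<alpha>b q + eps_chib a q * \<sigma> q"
      and 3: "D4 M a \<alpha>b q + chi_dot M a q (\<alpha>b q) + omega_hat M a q *\<^sub>R \<alpha>b q
        = - hgrad M a \<rho> q + hstar M a q (hgrad M a \<sigma> q)
          - (2 * \<rho> q) *\<^sub>R etab a q + (2 * \<sigma> q) *\<^sub>R hstar M a q (etab a q)"
      using maxwell q unfolding maxwell_solution_def D3s_def by blast+
    note m = dir_deriv_minus[OF q smooth_C2(1)[OF \<rho> q]]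
    show "hdiv M a \<alpha>b q = A q" using 2 by (simp add: A_def m)
    show "hcurl M a \<alpha>b q = - B q" using 1 by (simp add: B_def)
    have "hgrad M a (\<lambda>q. - \<rho> q) q = - hgrad M a \<rho> q" by (simp add: hgrad_def m vec_eq_iff)
    then show "\<beta> q = hgrad M a (\<lambda>q. - \<rho> q) q + hstar M a q (hgrad M a \<sigma> q) + (2 * - \<rho> q) *\<^sub>R etab a q
      + (2 * \<sigma> q) *\<^sub>R hstar M a q (etab a q)"
      using 3 by (simp add: \<beta>_def chi_dot_def add.assoc)
  qed
  have "D3 M a \<beta> p + (3/2 * tr_chib a p) *\<^sub>R \<beta> p - (1/2 * eps_chib a p) *\<^sub>R hstar M a p (\<beta> p)
    = D_plus M a (\<lambda>q. 2 *\<^sub>R etab a q + 0) A p + star_D_plus M a (\<lambda>q. 2 *\<^sub>R etab a q + 0) B p"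
    unfolding D3_def A_def[abs_def] B_def[abs_def]
    by (rule e3.decoupling_identity[OF \<rho>' \<sigma> C1_horizontal_eta(2) _ \<beta> p])
      (use structure_equation_e3 in \<open>simp_all add: D3_def\<close>)
  moreover have "D_plus M a (\<lambda>q. 2 *\<^sub>R etab a q) (hdiv M a \<alpha>b) p = D_plus M a (\<lambda>q. 2 *\<^sub>R etab a q + 0) A p"
    by (rule D_plus_cong[OF p div]) simp_all
  moreover have "star_D_plus M a (\<lambda>q. 2 *\<^sub>R etab a q) (hcurl M a \<alpha>b) p
      = - star_D_plus M a (\<lambda>q. 2 *\<^sub>R etab a q + 0) B p"
    unfolding star_D_plus_minus[OF p B, symmetric] by (rule D_plus_cong[OF p curl]) simp_all
  ultimately show ?thesis by simp
qed

end

theorem proposition3p1: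
  fixes M a :: real
    and \<alpha> \<alpha>b :: "real^4 \<Rightarrow> real^4"
    and \<rho> \<sigma> :: "real^4 \<Rightarrow> real"
  assumes "M > 0" and "\<bar>a\<bar> \<le> M"
    and "maxwell_solution M a \<alpha> \<alpha>b \<rho> \<sigma>"
  shows "\<forall>p\<in>exterior M a.
     (let \<beta> = (\<lambda>q. D3 M a \<alpha> q + (1/2 * tr_chib a q) *\<^sub>R \<alpha> q
                   + (1/2 * eps_chib a q) *\<^sub>R hstar M a q (\<alpha> q));
          \<Sigma>\<alpha> = (\<lambda>q. Sigma_K a q *\<^sub>R \<alpha> q)
      in Sigma_K a p *\<^sub>R (D4 M a \<beta> p + (3/2 * tr_chi M a p) *\<^sub>R \<beta> p
                             - (1/2 * eps_chi M a p) *\<^sub>R hstar M a p (\<beta> p))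
         - D_plus M a (\<lambda>q. 2 *\<^sub>R eta a q) (hdiv M a \<Sigma>\<alpha>) p
         + star_D_plus M a (\<lambda>q. 2 *\<^sub>R eta a q) (hcurl M a \<Sigma>\<alpha>) p = 0) \<and>
     (let \<beta>b = (\<lambda>q. D4 M a \<alpha>b q + (1/2 * tr_chi M a q) *\<^sub>R \<alpha>b q
                    + (1/2 * eps_chi M a q) *\<^sub>R hstar M a q (\<alpha>b q)
                    + omega_hat M a q *\<^sub>R \<alpha>b q)
      in D3 M a \<beta>b p + (3/2 * tr_chib a p) *\<^sub>R \<beta>b p
           - (1/2 * eps_chib a p) *\<^sub>R hstar M a p (\<beta>b p)
         - D_plus M a (\<lambda>q. 2 *\<^sub>R etab a q) (hdiv M a \<alpha>b) p
         + star_D_plus M a (\<lambda>q. 2 *\<^sub>R etab a q) (hcurl M a \<alpha>b) p = 0)"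
proof -
  interpret kerr_exterior M a by (rule kerr_exterior.intro[OF assms(1,2)])
  show ?thesis
    unfolding Let_def using alpha_wave_equation[OF assms(3)] alpha_bar_wave_equation[OF assms(3)] by blast
qed

end
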